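(* Consider polynomials in $\mathbb{C}[x_{ijk}: 1\le i,j\le 4,\ 1\le k\le 2]$ (polynomials in the entries of a $4\times4\times2$ array) and the action of $\mathfrak{sl}_4(\mathbb{C})\oplus\mathfrak{sl}_4(\mathbb{C})\oplus\mathfrak{sl}_2(\mathbb{C})$ on them described in the context. Every nonzero homogeneous invariant polynomial has degree a multiple of $4$. In degree $0$ there is only the trivial invariant $1$ (up to scalar multiples); in degree $4$ there are no nonzero invariants; and in degree $8$ the space of invariants is $1$-dimensional. A basis of the space of invariants in degree $8$ consists of the polynomial $$F=\sum_{n=1}^{28} c_n\sum_{E\in O_n} X(E),\qquad X(E)=\prod_{i,j,k}x_{ijk}^{e_{ijk}},$$ where $O_n$ is the orbit of the exponent array $E_n$ under the group $(S_4\times S_4\times S_2)\rtimes S_2$ and the pairs $(c_n,E_n)$, $n=1,\dots,28$, are those listed explicitly in the context. The polynomial $F$ involves $32$ variables, has exactly $14148$ monomials (with nonzero coefficient), and has exactly $13$ distinct integer coefficients, which are constant on the $28$ distinct orbits $O_1,\dots,O_{28}$ (with sizes as listed in the context) into which its monomials fall.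
   Context: **Action and invariants.** Identify $x_{ijk}$ with the simple tensor $x_i\otimes x_j\otimes x_k$ of standard basis vectors of $\mathbb{C}^4\otimes\mathbb{C}^4\otimes\mathbb{C}^2$. The Lie algebra $\mathfrak{sl}_4(\mathbb{C})\oplus\mathfrak{sl}_4(\mathbb{C})\oplus\mathfrak{sl}_2(\mathbb{C})$ acts on this space by $(A,B,C)\cdot(u\otimes v\otimes w)=(Au)\otimes v\otimes w+u\otimes(Bv)\otimes w+u\otimes v\otimes(Cw)$, and this action is extended to the polynomial algebra $\mathbb{C}[x_{ijk}]$ by the derivation rule $D\cdot(fg)=(D\cdot f)g+f(D\cdot g)$. A polynomial $f$ is invariant if $D\cdot f=0$ for all $D$ in the Lie algebra. **Exponent arrays and group action.** An exponent array is $E=(e_{ijk})$, $1\le i,j\le4$, $1\le k\le2$, with nonnegative integer entries. The group $(S_4\times S_4\times S_2)\rtimes S_2$ acts on exponent arrays: $\alpha$ in the first $S_4$, $\beta$ in the second $S_4$ and $\gamma$ in the first $S_2$ act by $(\alpha\cdot E)_{ijk}=e_{\alpha(i),j,k}$, $(\beta\cdot E)_{ijk}=e_{i,\beta(j),k}$, $(\gamma\cdot E)_{ijk}=e_{i,j,\gamma(k)}$, and the nontrivial element of the last $S_2$ sends $E$ to the array with $(i,j,k)$ entry $e_{jik}$. Monomials $X(E)$ are permuted accordingly. **Encoding.** An exponent array is written as four blocks separated by commas, the $i$-th block being $e_{i11}e_{i21}e_{i31}e_{i41}|e_{i12}e_{i22}e_{i32}e_{i42}$ (all entries are single digits). **List.**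 Each item is "$n$: $c_n$; $E_n$; size of the orbit $O_n$". 1: 1; 0000|0002, 0000|0020, 0200|0000, 2000|0000; 144 2: -2; 0000|0002, 0000|0020, 1100|0000, 1100|0000; 144 3: -1; 0000|0002, 0010|0010, 0100|0100, 2000|0000; 288 4: 1; 0000|0002, 0010|0010, 0100|1000, 1100|0000; 1152 5: -2; 0000|0002, 0020|0000, 0000|1100, 1100|0000; 576 6: 3; 0000|0002, 0020|0000, 0100|1000, 1000|0100; 288 7: 2; 0000|0002, 0000|0110, 1010|0000, 1100|0000; 1152 8: 2; 0000|0002, 0010|0100, 0010|1000, 1100|0000; 576 9: -3; 0000|0002, 0010|0100, 0100|1000, 1010|0000; 1152 10: 6; 0001|0001, 0010|0010, 0100|0100, 1000|1000; 24 11: 2; 0001|0001, 0010|0010, 0000|1100, 1100|0000; 288 12: -8; 0001|0001, 0010|0010, 0100|1000, 1000|0100; 144 13: -1; 0001|0001, 0000|0110, 0010|1000, 1100|0000; 1152 14: -1; 0001|0001, 0000|0110, 1000|0010, 1100|0000; 576 15: 9; 0001|0001, 0010|0100, 0100|1000, 1000|0010; 192 16: 4; 0000|0011, 0000|0011, 1100|0000, 1100|0000; 36 17: -1; 0000|0011, 0001|0010, 0100|1000, 1100|0000; 576 18: 4; 0000|0011, 0011|0000, 0000|1100, 1100|0000; 144 19: 4; 0000|0011, 0011|0000, 0100|1000, 0100|1000; 144 20: -6; 0000|0011, 0011|0000, 0100|1000, 1000|0100; 288 21: -2; 0000|0011, 0000|0101, 1010|0000, 1100|0000; 576 22: -2;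 0000|0011, 0001|0100, 0010|1000, 1100|0000; 576 23: 3; 0000|0011, 0001|0100, 0100|1000, 1010|0000; 1152 24: 3; 0000|0011, 0001|0100, 1000|0010, 1100|0000; 1152 25: -2; 0000|0011, 0001|0100, 1010|0000, 1000|0100; 1152 26: -2; 0000|0011, 0101|0000, 0000|1100, 1010|0000; 288 27: 14; 0001|0010, 0010|0001, 0100|1000, 1000|0100; 72 28: -12; 0001|0010, 0010|0100, 0100|1000, 1000|0001; 144 *)

theory Defs
  imports "HOL-Analysis.Analysis" "HOL-Library.Poly_Mapping"
begin

(* The type 4 has the elements 1, 2, 3 and 4 = 0, the type 2 has the elements 1 and 2 = 0.
   They serve as the index sets {1,...,4} and {1,2}. *)

type_synonym idx = "4 \<times> 4 \<times> 2"
type_synonym array = "idx \<Rightarrow> nat"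
type_synonym cpoly = "(idx \<Rightarrow>\<^sub>0 nat) \<Rightarrow>\<^sub>0 complex"

definition poly_scale :: "complex \<Rightarrow> cpoly \<Rightarrow> cpoly" where
  "poly_scale c f = Poly_Mapping.single 0 c * f"

global_interpretation cpoly: vector_space poly_scale
proof
  fix a b :: complex and f g :: cpoly
  show "poly_scale a (f + g) = poly_scale a f + poly_scale a g"
    by (simp add: poly_scale_def distrib_left)
  show "poly_scale (a + b) f = poly_scale a f + poly_scale b f"
    by (simp add: poly_scale_def single_add distrib_right)
  show "poly_scale a (poly_scale b f) = poly_scale (a * b) f"
    by (simp add: poly_scale_def mult_single flip: mult.assoc)
  show "poly_scale 1 f = f"
    by (simp add: poly_scale_def)
qed

definition var :: "idx \<Rightarrow> cpoly" where
  "var v = Poly_Mapping.single (Poly_Mapping.single v 1) 1"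

definition X :: "array \<Rightarrow> cpoly" where
  "X E = (\<Prod>v\<in>UNIV. var v ^ E v)"

definition mcoeff :: "cpoly \<Rightarrow> array \<Rightarrow> complex" where
  "mcoeff f E = Poly_Mapping.lookup f (Abs_poly_mapping E)"

definition monomials :: "cpoly \<Rightarrow> array set" where
  "monomials f = {E. mcoeff f E \<noteq> 0}"

definition variables :: "cpoly \<Rightarrow> idx set" where
  "variables f = {v. \<exists>E\<in>monomials f. E v \<noteq> 0}"

definition homogeneous :: "nat \<Rightarrow> cpoly \<Rightarrow> bool" where
  "homogeneous d f \<longleftrightarrow> (\<forall>E\<in>monomials f. (\<Sum>v\<in>UNIV. E v) = d)"

lemma X_eq_single: "X E = Poly_Mapping.single (Abs_poly_mapping E) 1"
proof -
  have pow: "var v ^ n = Poly_Mapping.single (Poly_Mapping.single v n) 1" for v n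
    by (induction n) (auto simp: var_def mult_single simp flip: single_add)
  have prod: "(\<Prod>v\<in>S. Poly_Mapping.single (g v) (1::complex)) = Poly_Mapping.single (\<Sum>v\<in>S. g v) 1"
    if "finite S" for S :: "idx set" and g :: "idx \<Rightarrow> idx \<Rightarrow>\<^sub>0 nat"
    using that by (induction S) (auto simp: mult_single)
  have "(\<Sum>v\<in>UNIV. Poly_Mapping.single v (E v)) = Abs_poly_mapping E"
    by (rule poly_mapping_eqI) (simp add: lookup_sum lookup_single when_def)
  then show ?thesis
    by (simp add: X_def pow prod)
qed

lemma mcoeff_X: "mcoeff (X E) E' = (if E = E' then 1 else 0)"
proof -
  have "Abs_poly_mapping E = Abs_poly_mapping E' \<longleftrightarrow> E = E'"
    by (metis UNIV_I finite_class.finite finite_subset lookup_Abs_poly_mapping subset_UNIV)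
  then show ?thesis
    by (simp add: mcoeff_def X_eq_single lookup_single when_def)
qed

definition sl :: "(complex^'n^'n) set" where
  "sl = {A. trace A = 0}"

type_synonym lie = "(complex^4^4) \<times> (complex^4^4) \<times> (complex^2^2)"

definition lie_algebra :: "lie set" where
  "lie_algebra = sl \<times> sl \<times> sl"

(* Tensors are linear forms: the variable indexed by (i,j,k) is the simple tensor of the
   standard basis vectors with indices i, j, k. *)
definition tensor :: "complex^4 \<Rightarrow> complex^4 \<Rightarrow> complex^2 \<Rightarrow> cpoly" where
  "tensor u v w =
     (\<Sum>i\<in>UNIV. \<Sum>j\<in>UNIV. \<Sum>k\<in>UNIV. poly_scale (u $ i * v $ j * w $ k) (var (i, j, k)))"

fun act_var :: "lie \<Rightarrow> idx \<Rightarrow> cpoly" where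
  "act_var (A, B, C) (i, j, k) =
     tensor (A *v axis i 1) (axis j 1) (axis k 1)
   + tensor (axis i 1) (B *v axis j 1) (axis k 1)
   + tensor (axis i 1) (axis j 1) (C *v axis k 1)"

definition partial :: "idx \<Rightarrow> cpoly \<Rightarrow> cpoly" where
  "partial v f = (\<Sum>m\<in>Poly_Mapping.keys f.
     Poly_Mapping.single (m - Poly_Mapping.single v 1)
       (of_nat (Poly_Mapping.lookup m v) * Poly_Mapping.lookup f m))"

(* The only complex-linear derivation that agrees with act_var D on the variables; the lemmas
   below show that it has these properties and acts on simple tensors as it should. *)
definition act :: "lie \<Rightarrow> cpoly \<Rightarrow> cpoly" where
  "act D f = (\<Sum>v\<in>UNIV. partial v f * act_var D v)"

lemma lookup_partial:
  "Poly_Mapping.lookup (partial v f) m =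
     of_nat (Suc (Poly_Mapping.lookup m v)) * Poly_Mapping.lookup f (m + Poly_Mapping.single v 1)"
proof -
  let ?s = "Poly_Mapping.single v (1::nat)"
  have *: "of_nat (Poly_Mapping.lookup m' v) * Poly_Mapping.lookup f m' * (if m' - ?s = m then 1 else 0)
      = (if m' = m + ?s then of_nat (Poly_Mapping.lookup m' v) * Poly_Mapping.lookup f m' else 0)" for m'
  proof (cases "Poly_Mapping.lookup m' v = 0")
    case True
    then have "m' \<noteq> m + ?s" by (auto simp: lookup_add)
    with True show ?thesis by simp
  next
    case False
    then have "m' - ?s + ?s = m'"
      by (intro poly_mapping_eqI) (auto simp: lookup_add lookup_minus lookup_single when_def)
    then have "m' - ?s = m \<longleftrightarrow> m' = m + ?s" by (metis add_diff_cancel_right')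
    then show ?thesis by simp
  qed
  have "Poly_Mapping.lookup (partial v f) m = (\<Sum>m'\<in>Poly_Mapping.keys f.
      of_nat (Poly_Mapping.lookup m' v) * Poly_Mapping.lookup f m' * (if m' - ?s = m then 1 else 0))"
    by (auto simp: partial_def lookup_sum lookup_single when_def intro!: sum.cong)
  also have "\<dots> = (\<Sum>m'\<in>Poly_Mapping.keys f.
      if m' = m + ?s then of_nat (Poly_Mapping.lookup m' v) * Poly_Mapping.lookup f m' else 0)"
    by (simp only: *)
  also have "\<dots> = of_nat (Suc (Poly_Mapping.lookup m v)) * Poly_Mapping.lookup f (m + ?s)"
    by (auto simp: lookup_add in_keys_iff)
  finally show ?thesis .
qed

lemma partial_add: "partial v (f + g) = partial v f + partial v g"
  by (rule poly_mapping_eqI) (simp add: lookup_partial lookup_add algebra_simps)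

lemma partial_sum: "partial v (sum f S) = (\<Sum>s\<in>S. partial v (f s))"
proof (induction S rule: infinite_finite_induct)
  case (insert s S)
  then show ?case by (simp add: partial_add)
qed (simp_all add: partial_def)

lemma partial_single:
  "partial v (Poly_Mapping.single m c) =
     Poly_Mapping.single (m - Poly_Mapping.single v 1) (of_nat (Poly_Mapping.lookup m v) * c)"
  by (cases "c = 0") (simp_all add: partial_def)

lemma cpoly_decompose:
  "f = (\<Sum>m\<in>Poly_Mapping.keys f. Poly_Mapping.single m (Poly_Mapping.lookup f m))"
  by (rule poly_mapping_eqI) (auto simp: lookup_sum lookup_single when_def in_keys_iff)

lemma partial_mult_single:
  fixes c d :: complex
  shows "partial v (Poly_Mapping.single m c * Poly_Mapping.single n d) =
     partial v (Poly_Mapping.single m c) * Poly_Mapping.single n d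
     + Poly_Mapping.single m c * partial v (Poly_Mapping.single n d)"
proof -
  let ?s = "Poly_Mapping.single v (1::nat)"
  have *: "m - ?s + n = m + n - ?s" if "Poly_Mapping.lookup m v \<noteq> 0" for m n :: "idx \<Rightarrow>\<^sub>0 nat"
    using that by (intro poly_mapping_eqI) (auto simp: lookup_add lookup_minus lookup_single when_def)
  have 1: "Poly_Mapping.single (m - ?s + n) (of_nat (Poly_Mapping.lookup m v) * (c * d)) =
      Poly_Mapping.single (m + n - ?s) (of_nat (Poly_Mapping.lookup m v) * (c * d))"
    using *[of m n] by (cases "Poly_Mapping.lookup m v = 0") auto
  have 2: "Poly_Mapping.single (m + (n - ?s)) (of_nat (Poly_Mapping.lookup n v) * (c * d)) =
      Poly_Mapping.single (m + n - ?s) (of_nat (Poly_Mapping.lookup n v) * (c * d))"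
    using *[of n m] by (cases "Poly_Mapping.lookup n v = 0") (auto simp: add.commute)
  have "partial v (Poly_Mapping.single m c * Poly_Mapping.single n d) =
      Poly_Mapping.single (m + n - ?s) (of_nat (Poly_Mapping.lookup m v) * (c * d))
      + Poly_Mapping.single (m + n - ?s) (of_nat (Poly_Mapping.lookup n v) * (c * d))"
    by (simp add: mult_single partial_single lookup_add distrib_right flip: single_add)
  also have "\<dots> = Poly_Mapping.single (m - ?s + n) (of_nat (Poly_Mapping.lookup m v) * (c * d))
      + Poly_Mapping.single (m + (n - ?s)) (of_nat (Poly_Mapping.lookup n v) * (c * d))"
    by (simp only: 1 2)
  also have "\<dots> = partial v (Poly_Mapping.single m c) * Poly_Mapping.single n d
      + Poly_Mapping.single m c * partial v (Poly_Mapping.single n d)"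
    by (simp add: mult_single partial_single ac_simps)
  finally show ?thesis .
qed

lemma partial_mult: "partial v (f * g) = partial v f * g + f * partial v g"
proof -
  have 1: "partial v (Poly_Mapping.single m c * g) =
      partial v (Poly_Mapping.single m c) * g + Poly_Mapping.single m c * partial v g" for m c
    by (subst (1 2 3) cpoly_decompose[of g])
       (simp only: sum_distrib_left partial_sum partial_mult_single sum.distrib)
  show ?thesis
    by (subst (1 2 3) cpoly_decompose[of f])
       (simp only: sum_distrib_right partial_sum 1 sum.distrib)
qed

lemma act_add: "act D (f + g) = act D f + act D g"
  by (simp add: act_def partial_add distrib_right sum.distrib)

lemma act_mult: "act D (f * g) = act D f * g + f * act D g"
  by (simp add: act_def partial_mult sum_distrib_left sum_distrib_right algebra_simps
      flip: sum.distrib)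

lemma act_scale: "act D (poly_scale c f) = poly_scale c (act D f)"
proof -
  have "act D (Poly_Mapping.single 0 c) = 0"
    by (simp add: act_def partial_single)
  then show ?thesis by (simp add: poly_scale_def act_mult)
qed

lemma act_sum: "act D (sum f S) = (\<Sum>s\<in>S. act D (f s))"
  by (simp add: act_def partial_sum sum_distrib_right) (rule sum.swap)

lemma act_var: "act D (var v) = act_var D v"
proof -
  have "partial w (var v) = (if w = v then 1 else 0)" for w
    by (auto simp: var_def partial_single lookup_single when_def)
  then have "act D (var v) = (\<Sum>w\<in>UNIV. if w = v then act_var D w else 0)"
    unfolding act_def by (intro sum.cong) auto
  then show ?thesis by simp
qed

lemma tensor_sum1: "tensor (\<Sum>s\<in>S. a s *s f s) v w = (\<Sum>s\<in>S. poly_scale (a s) (tensor (f s) v w))"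
proof (induction S rule: infinite_finite_induct)
  case (insert s S)
  have "tensor (a s *s f s + u) v w = poly_scale (a s) (tensor (f s) v w) + tensor u v w" for u
    by (simp add: tensor_def cpoly.scale_sum_right cpoly.scale_left_distrib
        distrib_right sum.distrib mult.assoc)
  with insert show ?case by simp
qed (simp_all add: tensor_def)

lemma tensor_sum2: "tensor u (\<Sum>s\<in>S. a s *s f s) w = (\<Sum>s\<in>S. poly_scale (a s) (tensor u (f s) w))"
proof (induction S rule: infinite_finite_induct)
  case (insert s S)
  have "tensor u (a s *s f s + v) w = poly_scale (a s) (tensor u (f s) w) + tensor u v w" for v
    by (simp add: tensor_def cpoly.scale_sum_right cpoly.scale_left_distrib
        distrib_left distrib_right sum.distrib ac_simps)
  with insert show ?case by simp
qed (simp_all add: tensor_def)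

lemma tensor_sum3: "tensor u v (\<Sum>s\<in>S. a s *s f s) = (\<Sum>s\<in>S. poly_scale (a s) (tensor u v (f s)))"
proof (induction S rule: infinite_finite_induct)
  case (insert s S)
  have "tensor u v (a s *s f s + w) = poly_scale (a s) (tensor u v (f s)) + tensor u v w" for w
    by (simp add: tensor_def cpoly.scale_sum_right cpoly.scale_left_distrib
        distrib_left distrib_right sum.distrib ac_simps)
  with insert show ?case by simp
qed (simp_all add: tensor_def)

lemma mult_axis_expansion: "A *v (u :: complex^'n) = (\<Sum>i\<in>UNIV. u $ i *s (A *v axis i 1))"
proof -
  have "A *v axis i 1 = column i A" for i
    by (simp add: vec_eq_iff matrix_vector_mult_def column_def axis_def if_distrib cong: if_cong)
  then show ?thesis by (simp only: matrix_mult_sum[of A u])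
qed

lemma tensor_expansion:
  "tensor (A *v u) (B *v v) (C *v w) =
     (\<Sum>i\<in>UNIV. \<Sum>j\<in>UNIV. \<Sum>k\<in>UNIV. poly_scale (u $ i * v $ j * w $ k)
        (tensor (A *v axis i 1) (B *v axis j 1) (C *v axis k 1)))"
  by (subst mult_axis_expansion[of A u], subst tensor_sum1,
      subst mult_axis_expansion[of B v], subst tensor_sum2,
      subst mult_axis_expansion[of C w], subst tensor_sum3)
     (simp add: cpoly.scale_sum_right mult.assoc)

lemma act_tensor:
  "act (A, B, C) (tensor u v w) =
     tensor (A *v u) v w + tensor u (B *v v) w + tensor u v (C *v w)"
proof -
  have "act (A, B, C) (tensor u v w) =
      (\<Sum>i\<in>UNIV. \<Sum>j\<in>UNIV. \<Sum>k\<in>UNIV. poly_scale (u $ i * v $ j * w $ k) (act_var (A, B, C) (i, j, k)))"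
    by (simp add: tensor_def act_sum act_scale act_var del: act_var.simps)
  also have "\<dots> = tensor (A *v u) v w + tensor u (B *v v) w + tensor u v (C *v w)"
    by (simp add: tensor_expansion[of A u "mat 1" v "mat 1" w, unfolded matrix_vector_mul_lid]
        tensor_expansion[of "mat 1" u B v "mat 1" w, unfolded matrix_vector_mul_lid]
        tensor_expansion[of "mat 1" u "mat 1" v C w, unfolded matrix_vector_mul_lid]
        cpoly.scale_right_distrib sum.distrib)
  finally show ?thesis .
qed

lemma var_tensor: "var (i, j, k) = tensor (axis i 1) (axis j 1) (axis k 1)"
proof -
  have "poly_scale (axis i 1 $ i' * axis j 1 $ j' * axis k 1 $ k') (var (i', j', k')) =
      (if k' = k then if j' = j then if i' = i then var (i, j, k) else 0 else 0 else 0)" for i' j' k'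
    by (auto simp: axis_def)
  then show ?thesis by (simp add: tensor_def)
qed

definition invariant :: "cpoly \<Rightarrow> bool" where
  "invariant f \<longleftrightarrow> (\<forall>D\<in>lie_algebra. act D f = 0)"

definition invariants :: "nat \<Rightarrow> cpoly set" where
  "invariants d = {f. homogeneous d f \<and> invariant f}"

lemma subspace_invariants: "cpoly.subspace (invariants d)"
proof (rule cpoly.subspaceI)
  have "act D 0 = 0" for D
    by (simp add: act_def partial_def)
  then show "0 \<in> invariants d"
    by (simp add: invariants_def invariant_def homogeneous_def monomials_def mcoeff_def)
next
  fix f g
  assume fg: "f \<in> invariants d" "g \<in> invariants d"
  have "monomials (f + g) \<subseteq> monomials f \<union> monomials g"
    by (auto simp: monomials_def mcoeff_def lookup_add)
  with fg show "f + g \<in> invariants d"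
    by (auto simp: invariants_def invariant_def homogeneous_def act_add)
next
  fix c f
  assume f: "f \<in> invariants d"
  have "Poly_Mapping.lookup (poly_scale c f) m = c * Poly_Mapping.lookup f m" for m
    by (simp add: poly_scale_def Poly_Mapping.map.rep_eq when_def flip: mult_map_scale_conv_mult)
  then have "monomials (poly_scale c f) \<subseteq> monomials f"
    by (auto simp: monomials_def mcoeff_def)
  with f show "poly_scale c f \<in> invariants d"
    by (auto simp: invariants_def invariant_def homogeneous_def act_scale)
qed

(* An element of the semidirect product of S4 x S4 x S2 by S2 is a triple of permutations
   together with a truth value telling whether the component in the last S2 is nontrivial. *)
type_synonym sym = "(4 \<Rightarrow> 4) \<times> (4 \<Rightarrow> 4) \<times> (2 \<Rightarrow> 2) \<times> bool"

definition array_group :: "sym set" where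
  "array_group = {(\<alpha>, \<beta>, \<gamma>, t). bij \<alpha> \<and> bij \<beta> \<and> bij \<gamma>}"

definition flip_array :: "array \<Rightarrow> array" where
  "flip_array E = (\<lambda>(i, j, k). E (j, i, k))"

fun act_array :: "sym \<Rightarrow> array \<Rightarrow> array" where
  "act_array (\<alpha>, \<beta>, \<gamma>, t) E =
     (\<lambda>(i, j, k). (if t then flip_array E else E) (\<alpha> i, \<beta> j, \<gamma> k))"

definition orbit :: "array \<Rightarrow> array set" where
  "orbit E = (\<lambda>g. act_array g E) ` array_group"

(* Position in a list of the entry belonging to an index 1, 2, 3, 4. *)
definition pos :: "4 \<Rightarrow> nat" where
  "pos i = (if i = 1 then 0 else if i = 2 then 1 else if i = 3 then 2 else 3)"

(* The i-th block consists of the list of entries (i,1,1), ..., (i,4,1) and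
   the list of entries (i,1,2), ..., (i,4,2). *)
type_synonym blocks = "(nat list \<times> nat list) list"

definition array_of :: "blocks \<Rightarrow> array" where
  "array_of bs = (\<lambda>(i, j, k). (if k = 1 then fst else snd) (bs ! pos i) ! pos j)"

(* Coefficient, orbit representative and size of the orbit. *)
definition orbit_list :: "(int \<times> blocks \<times> nat) list" where
  "orbit_list = [
   (1, [([0,0,0,0],[0,0,0,2]), ([0,0,0,0],[0,0,2,0]), ([0,2,0,0],[0,0,0,0]), ([2,0,0,0],[0,0,0,0])], 144),
   (-2, [([0,0,0,0],[0,0,0,2]), ([0,0,0,0],[0,0,2,0]), ([1,1,0,0],[0,0,0,0]), ([1,1,0,0],[0,0,0,0])], 144),
   (-1, [([0,0,0,0],[0,0,0,2]), ([0,0,1,0],[0,0,1,0]), ([0,1,0,0],[0,1,0,0]), ([2,0,0,0],[0,0,0,0])], 288),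
   (1, [([0,0,0,0],[0,0,0,2]), ([0,0,1,0],[0,0,1,0]), ([0,1,0,0],[1,0,0,0]), ([1,1,0,0],[0,0,0,0])], 1152),
   (-2, [([0,0,0,0],[0,0,0,2]), ([0,0,2,0],[0,0,0,0]), ([0,0,0,0],[1,1,0,0]), ([1,1,0,0],[0,0,0,0])], 576),
   (3, [([0,0,0,0],[0,0,0,2]), ([0,0,2,0],[0,0,0,0]), ([0,1,0,0],[1,0,0,0]), ([1,0,0,0],[0,1,0,0])], 288),
   (2, [([0,0,0,0],[0,0,0,2]), ([0,0,0,0],[0,1,1,0]), ([1,0,1,0],[0,0,0,0]), ([1,1,0,0],[0,0,0,0])], 1152),
   (2, [([0,0,0,0],[0,0,0,2]), ([0,0,1,0],[0,1,0,0]), ([0,0,1,0],[1,0,0,0]), ([1,1,0,0],[0,0,0,0])], 576),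
   (-3, [([0,0,0,0],[0,0,0,2]), ([0,0,1,0],[0,1,0,0]), ([0,1,0,0],[1,0,0,0]), ([1,0,1,0],[0,0,0,0])], 1152),
   (6, [([0,0,0,1],[0,0,0,1]), ([0,0,1,0],[0,0,1,0]), ([0,1,0,0],[0,1,0,0]), ([1,0,0,0],[1,0,0,0])], 24),
   (2, [([0,0,0,1],[0,0,0,1]), ([0,0,1,0],[0,0,1,0]), ([0,0,0,0],[1,1,0,0]), ([1,1,0,0],[0,0,0,0])], 288),
   (-8, [([0,0,0,1],[0,0,0,1]), ([0,0,1,0],[0,0,1,0]), ([0,1,0,0],[1,0,0,0]), ([1,0,0,0],[0,1,0,0])], 144),
   (-1, [([0,0,0,1],[0,0,0,1]), ([0,0,0,0],[0,1,1,0]), ([0,0,1,0],[1,0,0,0]), ([1,1,0,0],[0,0,0,0])], 1152),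
   (-1, [([0,0,0,1],[0,0,0,1]), ([0,0,0,0],[0,1,1,0]), ([1,0,0,0],[0,0,1,0]), ([1,1,0,0],[0,0,0,0])], 576),
   (9, [([0,0,0,1],[0,0,0,1]), ([0,0,1,0],[0,1,0,0]), ([0,1,0,0],[1,0,0,0]), ([1,0,0,0],[0,0,1,0])], 192),
   (4, [([0,0,0,0],[0,0,1,1]), ([0,0,0,0],[0,0,1,1]), ([1,1,0,0],[0,0,0,0]), ([1,1,0,0],[0,0,0,0])], 36),
   (-1, [([0,0,0,0],[0,0,1,1]), ([0,0,0,1],[0,0,1,0]), ([0,1,0,0],[1,0,0,0]), ([1,1,0,0],[0,0,0,0])], 576),
   (4, [([0,0,0,0],[0,0,1,1]), ([0,0,1,1],[0,0,0,0]), ([0,0,0,0],[1,1,0,0]), ([1,1,0,0],[0,0,0,0])], 144),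
   (4, [([0,0,0,0],[0,0,1,1]), ([0,0,1,1],[0,0,0,0]), ([0,1,0,0],[1,0,0,0]), ([0,1,0,0],[1,0,0,0])], 144),
   (-6, [([0,0,0,0],[0,0,1,1]), ([0,0,1,1],[0,0,0,0]), ([0,1,0,0],[1,0,0,0]), ([1,0,0,0],[0,1,0,0])], 288),
   (-2, [([0,0,0,0],[0,0,1,1]), ([0,0,0,0],[0,1,0,1]), ([1,0,1,0],[0,0,0,0]), ([1,1,0,0],[0,0,0,0])], 576),
   (-2, [([0,0,0,0],[0,0,1,1]), ([0,0,0,1],[0,1,0,0]), ([0,0,1,0],[1,0,0,0]), ([1,1,0,0],[0,0,0,0])], 576),
   (3, [([0,0,0,0],[0,0,1,1]), ([0,0,0,1],[0,1,0,0]), ([0,1,0,0],[1,0,0,0]), ([1,0,1,0],[0,0,0,0])], 1152),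
   (3, [([0,0,0,0],[0,0,1,1]), ([0,0,0,1],[0,1,0,0]), ([1,0,0,0],[0,0,1,0]), ([1,1,0,0],[0,0,0,0])], 1152),
   (-2, [([0,0,0,0],[0,0,1,1]), ([0,0,0,1],[0,1,0,0]), ([1,0,1,0],[0,0,0,0]), ([1,0,0,0],[0,1,0,0])], 1152),
   (-2, [([0,0,0,0],[0,0,1,1]), ([0,1,0,1],[0,0,0,0]), ([0,0,0,0],[1,1,0,0]), ([1,0,1,0],[0,0,0,0])], 288),
   (14, [([0,0,0,1],[0,0,1,0]), ([0,0,1,0],[0,0,0,1]), ([0,1,0,0],[1,0,0,0]), ([1,0,0,0],[0,1,0,0])], 72),
   (-12, [([0,0,0,1],[0,0,1,0]), ([0,0,1,0],[0,1,0,0]), ([0,1,0,0],[1,0,0,0]), ([1,0,0,0],[0,0,0,1])], 144)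
  ]"

definition F :: cpoly where
  "F = (\<Sum>(c, bs, s)\<leftarrow>orbit_list. of_int c * (\<Sum>E\<in>orbit (array_of bs). X E))"

end

theory Submission
  imports Defs "HOL-Library.List_Lexorder" "HOL-Combinatorics.Multiset_Permutations"
begin

text \<open>A polynomial is invariant iff its coefficient function satisfies a linear relation for every
  off-diagonal matrix unit of the Lie algebra and all rows, all columns and all slices of the arrays in
  its support have equal sums. The latter makes the degree a multiple of 4.

  Uniqueness: a row operation followed by a column operation expresses a coefficient through
  coefficients of arrays with smaller entries off the diagonal \<open>i = j\<close>, so an invariant is determined by
  its coefficients at diagonal arrays. These are symmetric under exchanging two diagonal positions, and
  the slice operation leaves no freedom in degree 4 and one free parameter in degree 8.

  Existence: since \<open>F\<close> is constant on orbits, its relations need to be checked only at the 28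
  representatives. Sorting the four rows makes an orbit a finite set of keys, the images of
  the representative under the 24 column permutations, the exchange of slices and the transposition.
  A trie of all keys yields the sizes and the disjointness of the orbits and the coefficients of \<open>F\<close>,
  and everything becomes a computation by rewriting.\<close>

section \<open>The action on coefficients\<close>

text \<open>The relation of an off-diagonal matrix unit at an array \<open>G\<close> does not
  involve the coefficient at \<open>G\<close>, but those at the arrays obtained from
  \<open>G\<close> by moving one unit. It can fail only if one of these lies in the support, and for
  an orbit-constant function this one can be carried to a representative. So undoing moves at the
  representatives reaches every relation that needs a test, and the arrays \<open>G\<close> need not
  be enumerated. In the uniqueness part the obstacle is the third tensor factor. With a single
  slice, a row relation would express a coefficient through arrays with fewer units off the
  diagonal; with two slices it has one more term of the same \<open>offdiag\<close>. A column
  relation moves this term on, and the net effect is an exchange of units between the slices at two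
  diagonal positions, which cannot go on forever. The free parameter in degree 8 is the coefficient
  at the diagonal array with two squares in each slice. The slice relations force -1 and 6 times its
  value at the two other kinds of diagonal arrays, in agreement with the first, third and tenth
  entry of \<open>orbit_list\<close>.\<close>

definition move :: "array \<Rightarrow> idx \<Rightarrow> idx \<Rightarrow> array" where
  "move G w v = (let H = G(w := G w - 1) in H(v := Suc (H v)))"

text \<open>The contribution of \<open>x\<^sub>w \<partial>\<^sub>v\<close> to the coefficient at \<open>G\<close> is the derivative factor, which is
  the entry at \<open>v\<close> of the array before the operation, times the coefficient at that array.\<close>

definition mterm :: "(array \<Rightarrow> complex) \<Rightarrow> array \<Rightarrow> idx \<Rightarrow> idx \<Rightarrow> complex" where
  "mterm c G w v = (if G w = 0 then 0 else of_nat (move G w v v) * c (move G w v))"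

definition rel1 :: "(array \<Rightarrow> complex) \<Rightarrow> 4 \<Rightarrow> 4 \<Rightarrow> array \<Rightarrow> complex" where
  "rel1 c a b G = (\<Sum>j\<in>UNIV. \<Sum>k\<in>UNIV. mterm c G (a, j, k) (b, j, k))"

definition rel2 :: "(array \<Rightarrow> complex) \<Rightarrow> 4 \<Rightarrow> 4 \<Rightarrow> array \<Rightarrow> complex" where
  "rel2 c a b G = (\<Sum>i\<in>UNIV. \<Sum>k\<in>UNIV. mterm c G (i, a, k) (i, b, k))"

definition rel3 :: "(array \<Rightarrow> complex) \<Rightarrow> 2 \<Rightarrow> 2 \<Rightarrow> array \<Rightarrow> complex" where
  "rel3 c a b G = (\<Sum>i\<in>UNIV. \<Sum>j\<in>UNIV. mterm c G (i, j, a) (i, j, b))"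

lemma lookup_Abs_array [simp]: "Poly_Mapping.lookup (Abs_poly_mapping (G :: array)) = G"
  by (rule lookup_Abs_poly_mapping) (rule finite_subset[OF subset_UNIV finite])

lemma mcoeff_add: "mcoeff (f + g) E = mcoeff f E + mcoeff g E"
  by (simp add: mcoeff_def lookup_add)

lemma mcoeff_sum: "mcoeff (sum f S) E = (\<Sum>s\<in>S. mcoeff (f s) E)"
  by (simp add: mcoeff_def lookup_sum)

lemma mcoeff_scale: "mcoeff (poly_scale c f) E = c * mcoeff f E"
  by (simp add: mcoeff_def poly_scale_def Poly_Mapping.map.rep_eq when_def flip: mult_map_scale_conv_mult)

lemma mcoeff_zero [simp]: "mcoeff 0 E = 0"
  by (simp add: mcoeff_def)

lemma cpoly_eqI:
  assumes "\<And>E. mcoeff f E = mcoeff g E"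
  shows "f = g"
proof (rule poly_mapping_eqI)
  fix m
  show "Poly_Mapping.lookup f m = Poly_Mapping.lookup g m"
    using assms[of "Poly_Mapping.lookup m"] by (simp add: mcoeff_def)
qed

lemma lookup_times_single:
  fixes p :: cpoly
  shows "Poly_Mapping.lookup (p * Poly_Mapping.single s 1) (m + s) = Poly_Mapping.lookup p m"
    and "(\<And>m'. m \<noteq> m' + s) \<Longrightarrow> Poly_Mapping.lookup (p * Poly_Mapping.single s 1) m = 0"
proof -
  have eq: "p * Poly_Mapping.single s 1 =
      (\<Sum>n\<in>Poly_Mapping.keys p. Poly_Mapping.single (n + s) (Poly_Mapping.lookup p n))"
    by (subst cpoly_decompose[of p]) (simp add: sum_distrib_right mult_single)
  show "Poly_Mapping.lookup (p * Poly_Mapping.single s 1) (m + s) = Poly_Mapping.lookup p m"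
    unfolding eq by (auto simp: lookup_sum lookup_single when_def in_keys_iff)
  show "Poly_Mapping.lookup (p * Poly_Mapping.single s 1) m = 0" if "\<And>m'. m \<noteq> m' + s"
    unfolding eq using that by (auto simp: lookup_sum lookup_single when_def intro!: sum.neutral) metis
qed

lemma mcoeff_partial_times_var: "mcoeff (partial v f * var w) G = mterm (mcoeff f) G w v"
proof (cases "G w = 0")
  case True
  have "Abs_poly_mapping G \<noteq> m' + Poly_Mapping.single w 1" for m'
  proof
    assume "Abs_poly_mapping G = m' + Poly_Mapping.single w 1"
    then have "G w = Poly_Mapping.lookup (m' + Poly_Mapping.single w 1) w" by (metis lookup_Abs_array)
    with True show False by (simp add: lookup_add)
  qed
  then show ?thesis
    using True by (simp add: mcoeff_def var_def mterm_def lookup_times_single(2))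
next
  case False
  let ?H = "G(w := G w - 1)"
  have G: "Abs_poly_mapping G = Abs_poly_mapping ?H + Poly_Mapping.single w 1"
    by (rule poly_mapping_eqI) (use False in \<open>auto simp: lookup_add lookup_single when_def\<close>)
  have H: "Abs_poly_mapping ?H + Poly_Mapping.single v 1 = Abs_poly_mapping (move G w v)"
    by (rule poly_mapping_eqI) (auto simp: lookup_add lookup_single when_def move_def Let_def)
  have "mcoeff (partial v f * var w) G = Poly_Mapping.lookup (partial v f) (Abs_poly_mapping ?H)"
    unfolding mcoeff_def var_def G by (rule lookup_times_single(1))
  also have "\<dots> = of_nat (Suc (?H v)) * mcoeff f (move G w v)"
    by (simp only: lookup_partial H lookup_Abs_array mcoeff_def)
  finally show ?thesis using False by (simp add: mterm_def move_def Let_def)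
qed

lemma act_var_eq:
  "act_var (A, B, C) (i, j, k) =
     (\<Sum>a\<in>UNIV. poly_scale (A $ a $ i) (var (a, j, k)))
   + (\<Sum>a\<in>UNIV. poly_scale (B $ a $ j) (var (i, a, k)))
   + (\<Sum>a\<in>UNIV. poly_scale (C $ a $ k) (var (i, j, a)))"
proof -
  have A: "(A *v axis i 1) $ a = A $ a $ i" for A :: "complex^'n^'n" and a i
    by (simp add: matrix_vector_mult_def axis_def if_distrib cong: if_cong)
  have ax: "axis i (1::complex) $ j = (if j = i then 1 else 0)" for i j :: "'n::finite"
    by (auto simp: axis_def)
  have if2: "x * (if P then 1 else 0) = (if P then x else 0)" "(if P then z else 0) * x = (if P then z * x else 0)"
     "poly_scale (if P then x else 0) y = (if P then poly_scale x y else 0)" for P and x z::complex and y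
    by auto
  have 1: "tensor (A *v axis i 1) (axis j 1) (axis k 1) = (\<Sum>a\<in>UNIV. poly_scale (A $ a $ i) (var (a, j, k)))"
    unfolding tensor_def A ax if2 by (simp add: if2 sum.delta cong: if_cong)
  have 2: "tensor (axis i 1) (B *v axis j 1) (axis k 1) = (\<Sum>a\<in>UNIV. poly_scale (B $ a $ j) (var (i, a, k)))"
    unfolding tensor_def A ax if2 by (subst sum.swap) (simp add: if2 sum.delta cong: if_cong)
  have 3: "tensor (axis i 1) (axis j 1) (C *v axis k 1) = (\<Sum>a\<in>UNIV. poly_scale (C $ a $ k) (var (i, j, a)))"
  proof -
    have "tensor (axis i 1) (axis j 1) (C *v axis k 1) =
       (\<Sum>k'\<in>UNIV. \<Sum>i'\<in>UNIV. \<Sum>j'\<in>UNIV. poly_scale (axis i 1 $ i' * axis j 1 $ j' * (C *v axis k 1) $ k') (var (i', j', k')))"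
      unfolding tensor_def by (subst sum.swap[of _ _ "UNIV :: 2 set"], subst sum.swap[of _ _ "UNIV :: 2 set"]) simp
    also have "\<dots> = (\<Sum>k'\<in>UNIV. poly_scale (C $ k' $ k) (var (i, j, k')))"
      unfolding A ax if2 by (simp add: if2 sum.delta cong: if_cong)
    finally show ?thesis .
  qed
  show ?thesis by (simp only: act_var.simps 1 2 3)
qed

lemma mult_scale_right: "f * poly_scale c g = poly_scale c (f * g)"
  by (simp add: poly_scale_def ac_simps)

lemma sum_idx: "(\<Sum>v\<in>UNIV. f (v::idx)) = (\<Sum>i\<in>UNIV. \<Sum>j\<in>UNIV. \<Sum>k\<in>UNIV. f (i, j, k))"
  by (simp add: UNIV_Times_UNIV[symmetric] sum.cartesian_product del: UNIV_Times_UNIV)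

text \<open>A matrix \<open>A\<close> sends basis vector \<open>b\<close> to the combination of the
  basis vectors \<open>a\<close> with coefficients \<open>A $ a $ b\<close>, hence acts as the sum
  of these entries times x_a d/dx_b. \<open>rel1\<close>, \<open>rel2\<close>, \<open>rel3\<close>
  are the actions of the matrix units of the three factors on coefficients.\<close>

lemma mcoeff_act:
  "mcoeff (act (A, B, C) f) G =
     (\<Sum>a\<in>UNIV. \<Sum>b\<in>UNIV. A $ a $ b * rel1 (mcoeff f) a b G)
   + (\<Sum>a\<in>UNIV. \<Sum>b\<in>UNIV. B $ a $ b * rel2 (mcoeff f) a b G)
   + (\<Sum>a\<in>UNIV. \<Sum>b\<in>UNIV. C $ a $ b * rel3 (mcoeff f) a b G)"
proof -
  let ?t = "mterm (mcoeff f) G"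
  have *: "mcoeff (partial (i, j, k) f * act_var (A, B, C) (i, j, k)) G =
     (\<Sum>a\<in>UNIV. A $ a $ i * ?t (a, j, k) (i, j, k))
   + (\<Sum>a\<in>UNIV. B $ a $ j * ?t (i, a, k) (i, j, k))
   + (\<Sum>a\<in>UNIV. C $ a $ k * ?t (i, j, a) (i, j, k))" for i j k
    unfolding act_var_eq
    by (simp add: distrib_left sum_distrib_left mult_scale_right mcoeff_add mcoeff_sum mcoeff_scale
        mcoeff_partial_times_var)
  have "mcoeff (act (A, B, C) f) G = 
     (\<Sum>i\<in>UNIV. \<Sum>j\<in>UNIV. \<Sum>k\<in>UNIV. \<Sum>a\<in>UNIV. A $ a $ i * ?t (a, j, k) (i, j, k))
   + (\<Sum>i\<in>UNIV. \<Sum>j\<in>UNIV. \<Sum>k\<in>UNIV. \<Sum>a\<in>UNIV. B $ a $ j * ?t (i, a, k) (i, j, k))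
   + (\<Sum>i\<in>UNIV. \<Sum>j\<in>UNIV. \<Sum>k\<in>UNIV. \<Sum>a\<in>UNIV. C $ a $ k * ?t (i, j, a) (i, j, k))"
    unfolding act_def mcoeff_sum sum_idx * sum.distrib ..
  \<comment> \<open>In each of the three sums the differentiated index is renamed to
    \<open>b\<close>, the new index stays \<open>a\<close>, and both are pulled to the
    front.\<close>
  also have "(\<Sum>i\<in>UNIV. \<Sum>j\<in>UNIV. \<Sum>k\<in>UNIV. \<Sum>a\<in>UNIV. A $ a $ i * ?t (a, j, k) (i, j, k)) =
     (\<Sum>a\<in>UNIV. \<Sum>b\<in>UNIV. A $ a $ b * rel1 (mcoeff f) a b G)"
    unfolding rel1_def sum_distrib_left
    by (simp only: sum.cartesian_product split_def fst_conv snd_conv,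
        rule sum.reindex_bij_witness[where i = "\<lambda>(a,b,j,k). (b,j,k,a)" and j = "\<lambda>(b,j,k,a). (a,b,j,k)"]) auto
  also have "(\<Sum>i\<in>UNIV. \<Sum>j\<in>UNIV. \<Sum>k\<in>UNIV. \<Sum>a\<in>UNIV. B $ a $ j * ?t (i, a, k) (i, j, k)) =
     (\<Sum>a\<in>UNIV. \<Sum>b\<in>UNIV. B $ a $ b * rel2 (mcoeff f) a b G)"
    unfolding rel2_def sum_distrib_left
    by (simp only: sum.cartesian_product split_def fst_conv snd_conv,
        rule sum.reindex_bij_witness[where i = "\<lambda>(a,b,j,k). (j,b,k,a)" and j = "\<lambda>(j,b,k,a). (a,b,j,k)"]) auto
  also have "(\<Sum>i\<in>UNIV. \<Sum>j\<in>UNIV. \<Sum>k\<in>UNIV. \<Sum>a\<in>UNIV. C $ a $ k * ?t (i, j, a) (i, j, k)) =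
     (\<Sum>a\<in>UNIV. \<Sum>b\<in>UNIV. C $ a $ b * rel3 (mcoeff f) a b G)"
    unfolding rel3_def sum_distrib_left
    by (simp only: sum.cartesian_product split_def fst_conv snd_conv,
        rule sum.reindex_bij_witness[where i = "\<lambda>(a,b,j,k). (j,k,b,a)" and j = "\<lambda>(j,k,b,a). (a,b,j,k)"]) auto
  finally show ?thesis .
qed
text \<open>x_v d/dx_v multiplies a monomial by its exponent at v. Hence diagonal matrix units act
  by weights, which are the row, column and slice sums.\<close>

lemma mterm_self: "mterm c G v v = of_nat (G v) * c G"
  by (simp add: mterm_def move_def Let_def)

lemma rel1_self: "rel1 c a a G = of_nat (\<Sum>j\<in>UNIV. \<Sum>k\<in>UNIV. G (a, j, k)) * c G"
  by (simp add: rel1_def mterm_self sum_distrib_right)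

lemma rel2_self: "rel2 c a a G = of_nat (\<Sum>i\<in>UNIV. \<Sum>k\<in>UNIV. G (i, a, k)) * c G"
  by (simp add: rel2_def mterm_self sum_distrib_right)

lemma rel3_self: "rel3 c a a G = of_nat (\<Sum>i\<in>UNIV. \<Sum>j\<in>UNIV. G (i, j, a)) * c G"
  by (simp add: rel3_def mterm_self sum_distrib_right)

text \<open>Off-diagonal matrix units and differences of diagonal ones span the traceless matrices;
  a single diagonal unit is not traceless, so the diagonal relations can only be equated with each
  other.\<close>

definition invariant_coeffs :: "(array \<Rightarrow> complex) \<Rightarrow> bool" where
  "invariant_coeffs c \<longleftrightarrow> (\<forall>G.
     (\<forall>a b. a \<noteq> b \<longrightarrow> rel1 c a b G = 0 \<and> rel2 c a b G = 0)
   \<and> (\<forall>a b. a \<noteq> b \<longrightarrow> rel3 c a b G = 0)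
   \<and> (\<forall>a b. rel1 c a a G = rel1 c b b G \<and> rel2 c a a G = rel2 c b b G)
   \<and> (\<forall>a b. rel3 c a a G = rel3 c b b G))"

definition elem :: "'n \<Rightarrow> 'n \<Rightarrow> complex^'n^'n" where
  "elem a b = (\<chi> i j. if i = a \<and> j = b then 1 else 0)"

lemma elem_sl: "a \<noteq> b \<Longrightarrow> elem a b \<in> sl" "elem a a - elem b b \<in> sl"
  by (auto simp: sl_def trace_def elem_def sum_subtractf intro!: sum.neutral)

lemma sum_elem:
  "(\<Sum>i\<in>UNIV. \<Sum>j\<in>UNIV. elem a b $ i $ j * r i j) = r a (b::'n::finite)"
proof -
  have "(\<Sum>i\<in>UNIV. \<Sum>j\<in>UNIV. elem a b $ i $ j * r i j) =
      (\<Sum>i\<in>UNIV. \<Sum>j\<in>UNIV. if j = b then if i = a then r a b else 0 else 0)"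
    by (intro sum.cong refl) (auto simp: elem_def)
  then show ?thesis by simp
qed

text \<open>Off the diagonal every summand vanishes; on it the common value factors out and leaves
  the trace.\<close>

lemma sum_traceless:
  fixes r :: "'n::finite \<Rightarrow> 'n \<Rightarrow> complex"
  assumes "A \<in> sl" "\<And>a b. a \<noteq> b \<Longrightarrow> r a b = 0" "\<And>a b. r a a = r b b"
  shows "(\<Sum>a\<in>UNIV. \<Sum>b\<in>UNIV. A $ a $ b * r a b) = 0"
proof -
  fix z :: 'n
  have "(\<Sum>a\<in>UNIV. \<Sum>b\<in>UNIV. A $ a $ b * r a b) =
      (\<Sum>a\<in>UNIV. \<Sum>b\<in>UNIV. if a = b then A $ a $ a * r z z else 0)"
    using assms(2,3) by (intro sum.cong refl) auto
  also have "\<dots> = trace A * r z z"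
    by (simp add: trace_def sum_distrib_right)
  also have "\<dots> = 0" using assms(1) by (simp add: sl_def)
  finally show ?thesis .
qed

lemma invariant_iff: "invariant f \<longleftrightarrow> invariant_coeffs (mcoeff f)"
proof
  assume inv: "invariant f"
  have zero: "(0 :: complex^4^4) \<in> sl" "(0 :: complex^2^2) \<in> sl" by (simp_all add: sl_def trace_def)
  have 0: "mcoeff (act D f) G = 0" if "D \<in> lie_algebra" for D G
    using inv that by (simp add: invariant_def)
  have 1: "(\<Sum>a\<in>UNIV. \<Sum>b\<in>UNIV. A $ a $ b * rel1 (mcoeff f) a b G) = 0" if "A \<in> sl" for A G
    using 0[of "(A, 0, 0)" G] that zero by (simp add: lie_algebra_def mcoeff_act)
  have 2: "(\<Sum>a\<in>UNIV. \<Sum>b\<in>UNIV. A $ a $ b * rel2 (mcoeff f) a b G) = 0" if "A \<in> sl" for A G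
    using 0[of "(0, A, 0)" G] that zero by (simp add: lie_algebra_def mcoeff_act)
  have 3: "(\<Sum>a\<in>UNIV. \<Sum>b\<in>UNIV. A $ a $ b * rel3 (mcoeff f) a b G) = 0" if "A \<in> sl" for A G
    using 0[of "(0, 0, A)" G] that zero by (simp add: lie_algebra_def mcoeff_act)
  show "invariant_coeffs (mcoeff f)"
    unfolding invariant_coeffs_def
  proof (intro allI conjI impI)
    fix G and a b :: 4
    show "rel1 (mcoeff f) a a G = rel1 (mcoeff f) b b G"
      using 1[OF elem_sl(2)[of a b], of G] by (simp add: left_diff_distrib sum_subtractf sum_elem)
    show "rel2 (mcoeff f) a a G = rel2 (mcoeff f) b b G"
      using 2[OF elem_sl(2)[of a b], of G] by (simp add: left_diff_distrib sum_subtractf sum_elem)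
    assume "a \<noteq> b"
    then show "rel1 (mcoeff f) a b G = 0" "rel2 (mcoeff f) a b G = 0"
      using 1[OF elem_sl(1)] 2[OF elem_sl(1)] by (simp_all add: sum_elem)
  next
    fix G and a b :: 2
    show "rel3 (mcoeff f) a a G = rel3 (mcoeff f) b b G"
      using 3[OF elem_sl(2)[of a b], of G] by (simp add: left_diff_distrib sum_subtractf sum_elem)
    assume "a \<noteq> b"
    then show "rel3 (mcoeff f) a b G = 0"
      using 3[OF elem_sl(1)] by (simp_all add: sum_elem)
  qed
next
  assume "invariant_coeffs (mcoeff f)"
  note inv = this[unfolded invariant_coeffs_def, rule_format]
  have 1: "rel1 (mcoeff f) a b G = 0" "rel2 (mcoeff f) a b G = 0" if "a \<noteq> b" for a b G
    using inv that by blast+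
  have 2: "rel3 (mcoeff f) a b G = 0" if "a \<noteq> b" for a b G
    using inv that by blast
  have 3: "rel1 (mcoeff f) a a G = rel1 (mcoeff f) b b G"
      "rel2 (mcoeff f) a a G = rel2 (mcoeff f) b b G" for a b G
    using inv by blast+
  have 4: "rel3 (mcoeff f) a a G = rel3 (mcoeff f) b b G" for a b G
    using inv by blast
  show "invariant f"
    unfolding invariant_def
  proof
    fix D assume "D \<in> lie_algebra"
    then obtain A B C where D: "D = (A, B, C)" "A \<in> sl" "B \<in> sl" "C \<in> sl"
      by (auto simp: lie_algebra_def)
    show "act D f = 0"
    proof (rule cpoly_eqI)
      fix G
      show "mcoeff (act D f) G = mcoeff 0 G"
        unfolding D(1) mcoeff_act
        using sum_traceless[OF D(2), of "\<lambda>a b. rel1 (mcoeff f) a b G"]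
          sum_traceless[OF D(3), of "\<lambda>a b. rel2 (mcoeff f) a b G"]
          sum_traceless[OF D(4), of "\<lambda>a b. rel3 (mcoeff f) a b G"] 1 2 3 4
        by simp
    qed
  qed
qed

text \<open>The last three facts compare weights: \<open>c G\<close> is a common nonzero factor of
  the diagonal relations and cancels.\<close>

lemma invariant_coeffsD:
  assumes "invariant_coeffs c"
  shows "a \<noteq> b \<Longrightarrow> rel1 c a b G = 0" "a \<noteq> b \<Longrightarrow> rel2 c a b G = 0" "k \<noteq> l \<Longrightarrow> rel3 c k l G = 0"
    and "c G \<noteq> 0 \<Longrightarrow> (\<Sum>j\<in>UNIV. \<Sum>k\<in>UNIV. G (a, j, k)) = (\<Sum>j\<in>UNIV. \<Sum>k\<in>UNIV. G (b, j, k))"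
    and "c G \<noteq> 0 \<Longrightarrow> (\<Sum>i\<in>UNIV. \<Sum>k\<in>UNIV. G (i, a, k)) = (\<Sum>i\<in>UNIV. \<Sum>k\<in>UNIV. G (i, b, k))"
    and "c G \<noteq> 0 \<Longrightarrow> (\<Sum>i\<in>UNIV. \<Sum>j\<in>UNIV. G (i, j, k)) = (\<Sum>i\<in>UNIV. \<Sum>j\<in>UNIV. G (i, j, l))"
proof -
  have e: "x = y" if "of_nat x * z = of_nat y * z" "z \<noteq> 0" for x y and z :: complex
    using that by (simp only: mult_cancel_right of_nat_eq_iff) simp
  show "a \<noteq> b \<Longrightarrow> rel1 c a b G = 0" "a \<noteq> b \<Longrightarrow> rel2 c a b G = 0" "k \<noteq> l \<Longrightarrow> rel3 c k l G = 0"
    using assms unfolding invariant_coeffs_def by blast+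
  have r: "rel1 c a a G = rel1 c b b G" "rel2 c a a G = rel2 c b b G" "rel3 c k k G = rel3 c l l G"
    using assms unfolding invariant_coeffs_def by blast+
  show "c G \<noteq> 0 \<Longrightarrow> (\<Sum>j\<in>UNIV. \<Sum>k\<in>UNIV. G (a, j, k)) = (\<Sum>j\<in>UNIV. \<Sum>k\<in>UNIV. G (b, j, k))"
    by (rule e[OF r(1)[unfolded rel1_self]])
  show "c G \<noteq> 0 \<Longrightarrow> (\<Sum>i\<in>UNIV. \<Sum>k\<in>UNIV. G (i, a, k)) = (\<Sum>i\<in>UNIV. \<Sum>k\<in>UNIV. G (i, b, k))"
    by (rule e[OF r(2)[unfolded rel2_self]])
  show "c G \<noteq> 0 \<Longrightarrow> (\<Sum>i\<in>UNIV. \<Sum>j\<in>UNIV. G (i, j, k)) = (\<Sum>i\<in>UNIV. \<Sum>j\<in>UNIV. G (i, j, l))"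
    by (rule e[OF r(3)[unfolded rel3_self]])
qed

lemma homogeneous_invariant_dvd:
  assumes "homogeneous d f" "f \<noteq> 0" "invariant f"
  shows "4 dvd d"
proof -
  obtain E where E: "mcoeff f E \<noteq> 0"
    using assms(2) cpoly_eqI[of f 0] by auto
  define s where "s i = (\<Sum>j\<in>UNIV. \<Sum>k\<in>UNIV. E (i, j, k))" for i
  have "s i = s 0" for i
    unfolding s_def using assms(3) E by (intro invariant_coeffsD(4)) (auto simp: invariant_iff)
  then have "(\<Sum>i\<in>UNIV. s i) = (\<Sum>i\<in>(UNIV::4 set). s 0)" by (intro sum.cong refl) 
  also have "\<dots> = 4 * s 0" by simp
  finally have "(\<Sum>i\<in>UNIV. s i) = 4 * s 0" .
  moreover have "d = (\<Sum>i\<in>UNIV. s i)"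
    using assms(1) E by (auto simp: homogeneous_def monomials_def sum_idx s_def)
  ultimately show ?thesis by simp
qed

section \<open>Uniqueness of invariants in degree at most 8\<close>

definition offdiag :: "array \<Rightarrow> nat" where
  "offdiag E = (\<Sum>v | fst v \<noteq> fst (snd v). E v)"

lemma move_apply:
  "w \<noteq> v \<Longrightarrow> move G w v u = (if u = v then Suc (G u) else if u = w then G u - 1 else G u)"
  by (auto simp: move_def Let_def)

text \<open>The two indicators are added on opposite sides so that no truncated subtraction
  enters.\<close>

lemma offdiag_move:
  assumes "G w > 0" "w \<noteq> v"
  shows "offdiag (move G w v) + (if fst w \<noteq> fst (snd w) then 1 else 0)
       = offdiag G + (if fst v \<noteq> fst (snd v) then 1 else 0)"
proof -
  let ?S = "{v :: idx. fst v \<noteq> fst (snd v)}"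
  have fin: "finite ?S" by simp
  have "offdiag (move G w v) + (if w \<in> ?S then 1 else 0)
      = (\<Sum>u\<in>?S. move G w v u + (if u = w then 1 else 0))"
    by (simp add: offdiag_def sum.distrib)
  also have "\<dots> = (\<Sum>u\<in>?S. G u + (if u = v then 1 else 0))"
    using assms by (intro sum.cong refl) (auto simp: move_apply)
  also have "\<dots> = offdiag G + (if v \<in> ?S then 1 else 0)"
    by (simp add: offdiag_def sum.distrib)
  finally show ?thesis by simp
qed

lemma move_back: "G w > 0 \<Longrightarrow> w \<noteq> v \<Longrightarrow> move (move G w v) v w = G"
  by (auto simp: move_apply fun_eq_iff)

lemma UNIV_2_cases: "k \<noteq> l \<Longrightarrow> UNIV = {k, l :: 2}"
  using exhaust_2[of k] exhaust_2[of l] UNIV_2 by auto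

text \<open>Moving a unit from \<open>(b, a, k)\<close> to \<open>(a, a, k)\<close> gives an array
  \<open>G\<close> with one unit less off the diagonal. In the row relation at \<open>G\<close>, all
  terms from columns other than \<open>a\<close> stay below \<open>offdiag E\<close>. Column
  \<open>a\<close> contributes \<open>E\<close> itself from slice \<open>k\<close> and one
  competitor from slice \<open>l\<close>, which \<open>next0\<close> removes.\<close>

lemma row_step:
  assumes inv: "invariant_coeffs c" and ab: "a \<noteq> b" and kl: "k \<noteq> l" and pos: "E (b, a, k) > 0"
    and small: "\<And>E'. offdiag E' < offdiag E \<Longrightarrow> c E' = 0"
    and next0: "E (a, a, l) > 0 \<Longrightarrow> c (move (move E (b, a, k) (a, a, k)) (a, a, l) (b, a, l)) = 0"
  shows "c E = 0"
proof -
  define G where "G = move E (b, a, k) (a, a, k)"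
  have offG: "offdiag G + 1 = offdiag E"
    using offdiag_move[of E "(b, a, k)" "(a, a, k)"] pos ab by (simp add: G_def)
  have other: "mterm c G (a, j, k') (b, j, k') = 0" if "j \<noteq> a" for j k'
  proof (cases "G (a, j, k') = 0")
    case False
    then have "offdiag (move G (a, j, k') (b, j, k')) \<le> offdiag G"
      using offdiag_move[of G "(a, j, k')" "(b, j, k')"] that ab by (simp split: if_splits)
    then show ?thesis using small offG by (simp add: mterm_def)
  qed (simp add: mterm_def)
  have l0: "mterm c G (a, a, l) (b, a, l) = 0"
    using next0 ab kl by (auto simp: mterm_def G_def move_apply)
  have k0: "mterm c G (a, a, k) (b, a, k) = of_nat (E (b, a, k)) * c E"
    using pos ab by (auto simp: mterm_def G_def move_back) (simp add: move_apply)
  have "0 = rel1 c a b G" using invariant_coeffsD(1)[OF inv ab] by simp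
  also have "\<dots> = (\<Sum>j\<in>UNIV. if j = a then mterm c G (a, a, k) (b, a, k) + mterm c G (a, a, l) (b, a, l) else 0)"
    unfolding rel1_def using other kl by (intro sum.cong refl) (auto simp: UNIV_2_cases[OF kl])
  also have "\<dots> = of_nat (E (b, a, k)) * c E"
    by (simp add: l0 k0)
  finally show ?thesis using pos by simp
qed

text \<open>Mirror image of \<open>row_step\<close>: the unit moves within its row to
  \<open>(b, b, k)\<close>, and a column relation takes the place of the row relation.\<close>

lemma col_step:
  assumes inv: "invariant_coeffs c" and ab: "a \<noteq> b" and kl: "k \<noteq> l" and pos: "E (b, a, k) > 0"
    and small: "\<And>E'. offdiag E' < offdiag E \<Longrightarrow> c E' = 0"
    and next0: "E (b, b, l) > 0 \<Longrightarrow> c (move (move E (b, a, k) (b, b, k)) (b, b, l) (b, a, l)) = 0"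
  shows "c E = 0"
proof -
  define G where "G = move E (b, a, k) (b, b, k)"
  have offG: "offdiag G + 1 = offdiag E"
    using offdiag_move[of E "(b, a, k)" "(b, b, k)"] pos ab by (simp add: G_def)
  have other: "mterm c G (i, b, k') (i, a, k') = 0" if "i \<noteq> b" for i k'
  proof (cases "G (i, b, k') = 0")
    case False
    then have "offdiag (move G (i, b, k') (i, a, k')) \<le> offdiag G"
      using offdiag_move[of G "(i, b, k')" "(i, a, k')"] that ab by (simp split: if_splits)
    then show ?thesis using small offG by (simp add: mterm_def)
  qed (simp add: mterm_def)
  have l0: "mterm c G (b, b, l) (b, a, l) = 0"
    using next0 ab kl by (auto simp: mterm_def G_def move_apply)
  have k0: "mterm c G (b, b, k) (b, a, k) = of_nat (E (b, a, k)) * c E"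
    using pos ab by (auto simp: mterm_def G_def move_back) (simp add: move_apply)
  have "0 = rel2 c b a G" using invariant_coeffsD(2)[OF inv, of b a] ab by simp
  also have "\<dots> = (\<Sum>i\<in>UNIV. if i = b then mterm c G (b, b, k) (b, a, k) + mterm c G (b, b, l) (b, a, l) else 0)"
    unfolding rel2_def using other kl by (intro sum.cong refl) (auto simp: UNIV_2_cases[OF kl])
  also have "\<dots> = of_nat (E (b, a, k)) * c E"
    by (simp add: l0 k0)
  finally show ?thesis using pos by simp
qed

text \<open>Up to factors and terms with smaller \<open>offdiag\<close>, a row step followed by a column step leads from \<open>D\<close>
  to an array with the same \<open>offdiag\<close> in which the entry at \<open>(a, a, l)\<close> is smaller by one.\<close>

lemma eq_zero_of_diagonal_eq_zero:
  assumes inv: "invariant_coeffs c"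
    and diag: "\<And>E. (\<And>i j k. i \<noteq> j \<Longrightarrow> E (i, j, k) = 0) \<Longrightarrow> c E = 0"
  shows "c E = 0"
proof (induction "offdiag E" arbitrary: E rule: less_induct)
  case (less E)
  have step: "c D = 0"
    if "offdiag D = offdiag E" "D (b, a, k) > 0" "a \<noteq> b" "k \<noteq> l" "D (a, a, l) = m" for D a b k l m
    using that
  proof (induction m arbitrary: D)
    case 0
    \<comment> \<open>Without a unit at \<open>(a, a, l)\<close> the competing term of the row
      relation is absent.\<close>
    then show ?case
      using less by (intro row_step[OF inv, of a b k l D]) auto
  next
    case (Suc m)
    note D = Suc.prems
    show ?case
    proof (rule row_step[OF inv])
      show "a \<noteq> b" "k \<noteq> l" "D (b, a, k) > 0" by fact+
      show "c E' = 0" if "offdiag E' < offdiag D" for E'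
        using that less D by simp
      let ?E1 = "move D (b, a, k) (a, a, k)"
      define E2 where "E2 = move ?E1 (a, a, l) (b, a, l)"
      have "offdiag ?E1 + 1 = offdiag D"
        using offdiag_move[of D "(b, a, k)" "(a, a, k)"] D by simp
      moreover have "offdiag E2 = offdiag ?E1 + 1"
        using offdiag_move[of ?E1 "(a, a, l)" "(b, a, l)"] D by (simp add: E2_def move_apply)
      ultimately have off2: "offdiag E2 = offdiag E" using D by simp
      have E2_pos: "E2 (b, a, l) > 0" using D by (simp add: E2_def move_apply)
      have "c E2 = 0"
      proof (rule col_step[OF inv, of a b l k])
        show "a \<noteq> b" "l \<noteq> k" "E2 (b, a, l) > 0" using D E2_pos by auto
        show "c E' = 0" if "offdiag E' < offdiag E2" for E'
          using that less off2 by simp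
        assume pos: "E2 (b, b, k) > 0"
        let ?E3 = "move E2 (b, a, l) (b, b, l)"
        \<comment> \<open>Altogether \<open>E4\<close> is \<open>D\<close> with one unit moved from
          slice \<open>l\<close> to \<open>k\<close> at \<open>(a, a)\<close> and one from
          \<open>k\<close> to \<open>l\<close> at \<open>(b, b)\<close>; off the diagonal nothing
          has changed.\<close>
        define E4 where "E4 = move ?E3 (b, b, k) (b, a, k)"
        have "offdiag ?E3 + 1 = offdiag E2"
          using offdiag_move[of E2 "(b, a, l)" "(b, b, l)"] D E2_pos by simp
        moreover have "offdiag E4 = offdiag ?E3 + 1"
          using offdiag_move[of ?E3 "(b, b, k)" "(b, a, k)"] D pos by (simp add: E4_def move_apply)
        ultimately have "offdiag E4 = offdiag E" using off2 by simp
        moreover have "E4 (b, a, k) > 0" using D by (simp add: E4_def move_apply)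
        moreover have "E4 (a, a, l) = m" using D by (simp add: E4_def E2_def move_apply)
        ultimately have "c E4 = 0" using D by (intro Suc.IH)
        then show "c (move (move E2 (b, a, l) (b, b, l)) (b, b, k) (b, a, k)) = 0" by (simp add: E4_def)
      qed
      then show "c (move ?E1 (a, a, l) (b, a, l)) = 0" by (simp add: E2_def)
    qed
  qed
  show "c E = 0"
  proof (cases "\<exists>b a k. a \<noteq> b \<and> E (b, a, k) > 0")
    case True
    then obtain b a k where *: "a \<noteq> b" "E (b, a, k) > 0" by (elim exE conjE)
    have "k \<noteq> (if k = 1 then 2 else 1)" by simp
    then obtain l where "k \<noteq> l" by blast
    with * show ?thesis by (intro step[OF refl, of b a k l "E (a, a, l)"]) auto
  next
    case False
    then have "E (i, j, k) = 0" if "i \<noteq> j" for i j k using that by (metis gr0I)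
    then show ?thesis by (intro diag)
  qed
qed

text \<open>The letters \<open>A\<close>, \<open>B\<close>, \<open>U\<close>, \<open>V\<close> stand for the positions \<open>(a, a)\<close>, \<open>(b, b)\<close>, \<open>(a, b)\<close>, \<open>(b, a)\<close>, the digit
  for the slice.\<close>

definition block :: "array \<Rightarrow> 4 \<Rightarrow> 4 \<Rightarrow> nat \<Rightarrow> nat \<Rightarrow> nat \<Rightarrow> nat \<Rightarrow> nat \<Rightarrow> nat \<Rightarrow> nat \<Rightarrow> nat \<Rightarrow> array" where
  "block H a b A1 A2 B1 B2 U1 U2 V1 V2 =
     H((a, a, 1) := A1, (a, a, 2) := A2, (b, b, 1) := B1, (b, b, 2) := B2,
       (a, b, 1) := U1, (a, b, 2) := U2, (b, a, 1) := V1, (b, a, 2) := V2)"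

text \<open>This is \<open>mterm\<close> in terms of its source entry \<open>x\<close>, its target
  entry \<open>y\<close> and the coefficient \<open>z\<close> after the move. Relations at blocks
  with numeral entries then evaluate by simplification.\<close>

definition wterm :: "nat \<Rightarrow> nat \<Rightarrow> complex \<Rightarrow> complex" where
  "wterm x y z = (if x = 0 then 0 else of_nat (Suc y) * z)"

lemma sum_two:
  assumes "a \<noteq> b" "\<And>j. j \<noteq> a \<Longrightarrow> j \<noteq> b \<Longrightarrow> f j = 0"
  shows "(\<Sum>j\<in>UNIV. f j) = f a + f (b :: 'n::finite)"
proof -
  have "(\<Sum>j\<in>UNIV. f j) = (\<Sum>j\<in>{a, b}. f j)"
    using assms(2) by (intro sum.mono_neutral_right) auto
  then show ?thesis using assms(1) by simp
qed

text \<open>Outside the block, rows and columns \<open>a\<close> and \<open>b\<close> contain only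
  zeros because \<open>H\<close> vanishes off the diagonal. Hence the row and column relations for
  \<open>a\<close> and \<open>b\<close> never leave the 2 x 2 x 2 block.\<close>

lemma block_relations:
  fixes A1 A2 B1 B2 U1 U2 V1 V2 :: nat
  assumes inv: "invariant_coeffs c" and ab: "a \<noteq> b" and H: "\<And>i j k. i \<noteq> j \<Longrightarrow> H (i, j, k) = 0"
  defines "h \<equiv> \<lambda>A1 A2 B1 B2 U1 U2 V1 V2. c (block H a b A1 A2 B1 B2 U1 U2 V1 V2)"
  shows "wterm A1 V1 (h (A1 - 1) A2 B1 B2 U1 U2 (Suc V1) V2) + wterm A2 V2 (h A1 (A2 - 1) B1 B2 U1 U2 V1 (Suc V2))
       + wterm U1 B1 (h A1 A2 (Suc B1) B2 (U1 - 1) U2 V1 V2) + wterm U2 B2 (h A1 A2 B1 (Suc B2) U1 (U2 - 1) V1 V2) = 0" (is ?r1)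
    and "wterm B1 U1 (h A1 A2 (B1 - 1) B2 (Suc U1) U2 V1 V2) + wterm B2 U2 (h A1 A2 B1 (B2 - 1) U1 (Suc U2) V1 V2)
       + wterm V1 A1 (h (Suc A1) A2 B1 B2 U1 U2 (V1 - 1) V2) + wterm V2 A2 (h A1 (Suc A2) B1 B2 U1 U2 V1 (V2 - 1)) = 0" (is ?r2)
    and "wterm A1 U1 (h (A1 - 1) A2 B1 B2 (Suc U1) U2 V1 V2) + wterm A2 U2 (h A1 (A2 - 1) B1 B2 U1 (Suc U2) V1 V2)
       + wterm V1 B1 (h A1 A2 (Suc B1) B2 U1 U2 (V1 - 1) V2) + wterm V2 B2 (h A1 A2 B1 (Suc B2) U1 U2 V1 (V2 - 1)) = 0" (is ?r3)
    and "wterm B1 V1 (h A1 A2 (B1 - 1) B2 U1 U2 (Suc V1) V2) + wterm B2 V2 (h A1 A2 B1 (B2 - 1) U1 U2 V1 (Suc V2))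
       + wterm U1 A1 (h (Suc A1) A2 B1 B2 (U1 - 1) U2 V1 V2) + wterm U2 A2 (h A1 (Suc A2) B1 B2 U1 (U2 - 1) V1 V2) = 0" (is ?r4)
proof -
  let ?G = "block H a b A1 A2 B1 B2 U1 U2 V1 V2"
  have t: "mterm c ?G w v = wterm (?G w) (?G v) (c (move ?G w v))" if "w \<noteq> v" for w v
    using that by (simp add: mterm_def wterm_def move_apply)
  have G: "?G (i, j, k) = H (i, j, k)" if "i \<notin> {a, b} \<or> j \<notin> {a, b}" for i j k
    using that by (elim disjE) (simp_all add: block_def)
  have z: "mterm c ?G (a, j, k) v = 0" "mterm c ?G (b, j, k) v = 0"
    "mterm c ?G (j, a, k) v = 0" "mterm c ?G (j, b, k) v = 0" if "j \<noteq> a" "j \<noteq> b" for j k v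
    using that by (simp_all add: mterm_def G H)
  have m: "move ?G w v = ?G(w := ?G w - 1, v := Suc (?G v))" if "w \<noteq> v" for w v
    using that by (auto simp: fun_eq_iff move_apply)
  note simps = sum_2 t m ab ab[symmetric]
  have v: "?G (a, a, 1) = A1" "?G (a, a, 2) = A2" "?G (b, b, 1) = B1" "?G (b, b, 2) = B2"
    "?G (a, b, 1) = U1" "?G (a, b, 2) = U2" "?G (b, a, 1) = V1" "?G (b, a, 2) = V2"
    using ab by (auto simp: block_def)
  have u: "?G((a, a, 1) := x, (b, a, 1) := y) = block H a b x A2 B1 B2 U1 U2 y V2"
    "?G((a, a, 2) := x, (b, a, 2) := y) = block H a b A1 x B1 B2 U1 U2 V1 y"
    "?G((a, b, 1) := x, (b, b, 1) := y) = block H a b A1 A2 y B2 x U2 V1 V2"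
    "?G((a, b, 2) := x, (b, b, 2) := y) = block H a b A1 A2 B1 y U1 x V1 V2"
    "?G((b, b, 1) := x, (a, b, 1) := y) = block H a b A1 A2 x B2 y U2 V1 V2"
    "?G((b, b, 2) := x, (a, b, 2) := y) = block H a b A1 A2 B1 x U1 y V1 V2"
    "?G((b, a, 1) := x, (a, a, 1) := y) = block H a b y A2 B1 B2 U1 U2 x V2"
    "?G((b, a, 2) := x, (a, a, 2) := y) = block H a b A1 y B1 B2 U1 U2 V1 x"
    "?G((a, a, 1) := x, (a, b, 1) := y) = block H a b x A2 B1 B2 y U2 V1 V2"
    "?G((a, a, 2) := x, (a, b, 2) := y) = block H a b A1 x B1 B2 U1 y V1 V2"
    "?G((b, a, 1) := x, (b, b, 1) := y) = block H a b A1 A2 y B2 U1 U2 x V2"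
    "?G((b, a, 2) := x, (b, b, 2) := y) = block H a b A1 A2 B1 y U1 U2 V1 x"
    "?G((b, b, 1) := x, (b, a, 1) := y) = block H a b A1 A2 x B2 U1 U2 y V2"
    "?G((b, b, 2) := x, (b, a, 2) := y) = block H a b A1 A2 B1 x U1 U2 V1 y"
    "?G((a, b, 1) := x, (a, a, 1) := y) = block H a b y A2 B1 B2 x U2 V1 V2"
    "?G((a, b, 2) := x, (a, a, 2) := y) = block H a b A1 y B1 B2 U1 x V1 V2" for x y
    using ab ab[symmetric] by (simp_all add: block_def fun_eq_iff)
  have "rel1 c a b ?G = (\<Sum>k\<in>UNIV. mterm c ?G (a, a, k) (b, a, k)) + (\<Sum>k\<in>UNIV. mterm c ?G (a, b, k) (b, b, k))"
    unfolding rel1_def using ab z by (intro sum_two) auto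
  then show ?r1 using invariant_coeffsD(1)[OF inv ab, of ?G] by (simp add: simps v u h_def add.assoc)
  have "rel1 c b a ?G = (\<Sum>k\<in>UNIV. mterm c ?G (b, b, k) (a, b, k)) + (\<Sum>k\<in>UNIV. mterm c ?G (b, a, k) (a, a, k))"
    unfolding rel1_def using ab z by (intro sum_two) auto
  then show ?r2 using invariant_coeffsD(1)[OF inv ab[symmetric], of ?G] by (simp add: simps v u h_def add.assoc)
  have "rel2 c a b ?G = (\<Sum>k\<in>UNIV. mterm c ?G (a, a, k) (a, b, k)) + (\<Sum>k\<in>UNIV. mterm c ?G (b, a, k) (b, b, k))"
    unfolding rel2_def using ab z by (intro sum_two) auto
  then show ?r3 using invariant_coeffsD(2)[OF inv ab, of ?G] by (simp add: simps v u h_def add.assoc)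
  have "rel2 c b a ?G = (\<Sum>k\<in>UNIV. mterm c ?G (b, b, k) (b, a, k)) + (\<Sum>k\<in>UNIV. mterm c ?G (a, b, k) (a, a, k))"
    unfolding rel2_def using ab z by (intro sum_two) auto
  then show ?r4 using invariant_coeffsD(2)[OF inv ab[symmetric], of ?G] by (simp add: simps v u h_def add.assoc)
qed

text \<open>Coefficients of blocks with units in \<open>U\<close> and \<open>V\<close> are
  eliminated between row and column relations.\<close>

lemma block_swap:
  assumes "invariant_coeffs c" "a \<noteq> b" "\<And>i j k. i \<noteq> j \<Longrightarrow> H (i, j, k) = 0"
  defines "h \<equiv> \<lambda>A1 A2 B1 B2 U1 U2 V1 V2. c (block H a b A1 A2 B1 B2 U1 U2 V1 V2)"
  shows "h 1 0 0 1 0 0 0 0 = h 0 1 1 0 0 0 0 0"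
    and "h 2 0 0 2 0 0 0 0 = h 0 2 2 0 0 0 0 0"
    and "h 2 0 1 1 0 0 0 0 = h 1 1 2 0 0 0 0 0"
    and "h 0 2 1 1 0 0 0 0 = h 1 1 0 2 0 0 0 0"
proof -
  note r = block_relations[of c a b H, OF assms(1-3), folded h_def]
  note w = wterm_def numeral_2_eq_2
  show "h 1 0 0 1 0 0 0 0 = h 0 1 1 0 0 0 0 0"
    \<comment> \<open>The row relation at the block A1 U2 and the column relation at A2 V1 both lead
      to U2 V1, so both sides equal minus the coefficient there. The numerals follow the order in
      which the variables first occur in each relation.\<close>
    using r(1)[of 1 0 0 0 0 0 1 0] r(3)[of 0 0 1 0 0 0 1 0] by (simp add: w h_def) algebra
  \<comment> \<open>The column relations at A1^2 B2 V2 and A2^2 B1 V1 give minus the coefficients at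
    A1 B2 U1 V2 and A2 B1 U2 V1. These agree because the row relations at A1 A2 B1 U2 and A1 B1 B2
    V2 share their other two terms.\<close>
  have "2 * h 2 0 0 2 0 0 0 0 = 2 * h 0 2 2 0 0 0 0 0"
    using r(3)[of 2 0 0 0 1 0 0 1] r(3)[of 0 0 2 1 0 0 1 0] r(1)[of 1 0 1 1 0 0 1 0] r(2)[of 1 0 1 0 1 0 0 1]
    by (simp add: w h_def) algebra
  then show "h 2 0 0 2 0 0 0 0 = h 0 2 2 0 0 0 0 0" by simp
  \<comment> \<open>Here both sides equal minus the coefficient at A1 B1 U1 V2, in the next identity
    minus that at A2 B2 U2 V1.\<close>
  show "h 2 0 1 1 0 0 0 0 = h 1 1 2 0 0 0 0 0"
    using r(2)[of 2 0 1 0 0 0 0 1] r(3)[of 2 0 0 1 0 0 0 1] by (simp add: w h_def) algebra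
  show "h 0 2 1 1 0 0 0 0 = h 1 1 0 2 0 0 0 0"
    using r(2)[of 0 0 0 1 2 0 1 0] r(3)[of 0 0 2 0 1 0 1 0] by (simp add: w h_def) algebra
qed

section \<open>Coefficients at diagonal arrays\<close>

definition diag_array :: "nat \<Rightarrow> (4 \<Rightarrow> nat) \<Rightarrow> array" where
  "diag_array r q = (\<lambda>(i, j, k). if i = j then if k = 1 then r - q i else q i else 0)"

lemma diag_array_fun_upd:
  assumes "a \<noteq> b"
  shows "diag_array r (q(a := x, b := y)) = block (diag_array r q) a b (r - x) x (r - y) y 0 0 0 0"
proof
  fix v :: idx
  obtain i j k where v: "v = (i, j, k)" by (cases v) auto
  consider "k = 1" | "k = 2" using exhaust_2 by blast
  then show "diag_array r (q(a := x, b := y)) v = block (diag_array r q) a b (r - x) x (r - y) y 0 0 0 0 v"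
    by cases (use assms in \<open>auto simp: v diag_array_def block_def\<close>)
qed

text \<open>For row sums 1 and 2 the unequal pairs of entries are (0,1), (0,2) and (1,2), which are
  the cases of \<open>block_swap\<close>.\<close>

lemma diag_array_swap:
  assumes inv: "invariant_coeffs c" and ab: "a \<noteq> b" and r: "r = 1 \<or> r = 2" and xy: "x \<le> r" "y \<le> r"
  shows "c (diag_array r (q(a := x, b := y))) = c (diag_array r (q(a := y, b := x)))"
proof -
  have H: "diag_array r q (i, j, k) = 0" if "i \<noteq> j" for i j k
    using that by (simp add: diag_array_def)
  note swap = block_swap[of c a b "diag_array r q", OF inv ab H]
  have "x = 0 \<or> x = 1 \<or> x = 2" "y = 0 \<or> y = 1 \<or> y = 2" using r xy by auto
  then show ?thesis
    using r swap xy unfolding diag_array_fun_upd[OF ab]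
    by (elim disjE) (simp_all add: numeral_2_eq_2)
qed

definition vec4 :: "nat \<Rightarrow> nat \<Rightarrow> nat \<Rightarrow> nat \<Rightarrow> 4 \<Rightarrow> nat" where
  "vec4 x y z w = (\<lambda>i. if i = 1 then x else if i = 2 then y else if i = 3 then z else w)"

lemma vec4_simps [simp]:
  "vec4 x y z w 1 = x" "vec4 x y z w 2 = y" "vec4 x y z w 3 = z" "vec4 x y z w 4 = w"
  "(vec4 x y z w)(1 := t) = vec4 t y z w" "(vec4 x y z w)(2 := t) = vec4 x t z w"
  "(vec4 x y z w)(3 := t) = vec4 x y t w" "(vec4 x y z w)(4 := t) = vec4 x y z t"
  using exhaust_4 by (auto simp: vec4_def fun_eq_iff)

lemma vec4_eta: "vec4 (q 1) (q 2) (q 3) (q 4) = q"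
  using exhaust_4 by (auto simp: vec4_def fun_eq_iff)

text \<open>The three adjacent transpositions generate all permutations of the diagonal
  positions.\<close>

lemma diag_vec4_swaps:
  assumes "invariant_coeffs c" "r = 1 \<or> r = 2" "x \<le> r" "y \<le> r" "z \<le> r" "w \<le> r"
  shows "c (diag_array r (vec4 x y z w)) = c (diag_array r (vec4 y x z w))"
    and "c (diag_array r (vec4 x y z w)) = c (diag_array r (vec4 x z y w))"
    and "c (diag_array r (vec4 x y z w)) = c (diag_array r (vec4 x y w z))"
proof -
  show "c (diag_array r (vec4 x y z w)) = c (diag_array r (vec4 y x z w))"
    using diag_array_swap[OF assms(1), of 1 2 r x y "vec4 x y z w"] assms by simp
  show "c (diag_array r (vec4 x y z w)) = c (diag_array r (vec4 x z y w))"
    using diag_array_swap[OF assms(1), of 2 3 r y z "vec4 x y z w"] assms by simp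
  show "c (diag_array r (vec4 x y z w)) = c (diag_array r (vec4 x y w z))"
    using diag_array_swap[OF assms(1), of 3 4 r z w "vec4 x y z w"] assms by simp
qed

text \<open>A move from the first slice to the second at \<open>(i, i)\<close> raises
  \<open>q i\<close> by one and needs \<open>q i < r\<close>; off-diagonal positions hold no unit to
  move.\<close>

lemma diag_array_slice_relation:
  assumes "invariant_coeffs c"
  shows "(\<Sum>i\<in>UNIV. if q i < r then of_nat (Suc (q i)) * c (diag_array r (q(i := Suc (q i)))) else 0) = 0"
proof -
  let ?G = "diag_array r q"
  have "mterm c ?G (i, j, 1) (i, j, 2) =
      (if j = i then if q i < r then of_nat (Suc (q i)) * c (diag_array r (q(i := Suc (q i)))) else 0 else 0)" for i j
  proof (cases "j = i \<and> q i < r")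
    case True
    have "move ?G (i, i, 1) (i, i, 2) = diag_array r (q(i := Suc (q i)))"
    proof
      fix v :: idx
      obtain i' j' k where v: "v = (i', j', k)" by (cases v) auto
      consider "k = 1" | "k = 2" using exhaust_2 by blast
      then show "move ?G (i, i, 1) (i, i, 2) v = diag_array r (q(i := Suc (q i))) v"
        by cases (use True in \<open>auto simp: v diag_array_def move_apply\<close>)
    qed
    then show ?thesis using True by (simp add: mterm_def diag_array_def)
  next
    case False
    then show ?thesis by (auto simp: mterm_def diag_array_def)
  qed
  then have "rel3 c 1 2 ?G =
      (\<Sum>i\<in>UNIV. if q i < r then of_nat (Suc (q i)) * c (diag_array r (q(i := Suc (q i)))) else 0)"
    by (simp add: rel3_def)
  then show ?thesis using invariant_coeffsD(3)[OF assms, of 1 2 ?G] by simp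
qed

text \<open>On a diagonal array of the support, equal row sums leave \<open>r\<close> units at each
  diagonal position, and equal slice sums put half of all units into the second slice. So the array
  is some \<open>diag_array r q\<close> whose \<open>q\<close> has sum \<open>2 * r\<close>.\<close>

lemma eq_zero_of_diag_array_eq_zero:
  assumes inv: "invariant_coeffs c" and deg: "\<And>E. c E \<noteq> 0 \<Longrightarrow> (\<Sum>v\<in>UNIV. E v) = 4 * r"
    and diag: "\<And>q. (\<And>i. q i \<le> r) \<Longrightarrow> (\<Sum>i\<in>UNIV. q i) = 2 * r \<Longrightarrow> c (diag_array r q) = 0"
  shows "c E = 0"
proof (rule eq_zero_of_diagonal_eq_zero[OF inv])
  fix E :: array
  assume off: "\<And>i j k. i \<noteq> j \<Longrightarrow> E (i, j, k) = 0"
  show "c E = 0"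
  proof (rule ccontr)
    assume E: "c E \<noteq> 0"
    have diag_sum: "(\<Sum>j\<in>UNIV. E (i, j, k)) = E (i, i, k)" for i k
    proof -
      have "(\<Sum>j\<in>UNIV. E (i, j, k)) = (\<Sum>j\<in>{i}. E (i, j, k))"
        using off by (intro sum.mono_neutral_right) auto
      then show ?thesis by simp
    qed
    have row: "(\<Sum>j\<in>UNIV. \<Sum>k\<in>UNIV. E (i, j, k)) = E (i, i, 1) + E (i, i, 2)" for i
      by (subst sum.swap) (simp add: sum_2 diag_sum)
    have rows: "E (i, i, 1) + E (i, i, 2) = E (1, 1, 1) + E (1, 1, 2)" for i
      using invariant_coeffsD(4)[OF inv E, of i 1] unfolding row .
    have "(\<Sum>i\<in>UNIV. E (i, i, 1) + E (i, i, 2)) = 4 * r"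
      using deg[OF E] unfolding sum_idx row .
    moreover have "(\<Sum>i\<in>UNIV. E (i, i, 1) + E (i, i, 2)) = (\<Sum>i\<in>(UNIV :: 4 set). E (1, 1, 1) + E (1, 1, 2))"
      by (intro sum.cong refl rows)
    ultimately have r: "E (i, i, 1) + E (i, i, 2) = r" for i
      using rows[of i] by simp
    have slice: "(\<Sum>i\<in>UNIV. E (i, i, 1)) = (\<Sum>i\<in>UNIV. E (i, i, 2))"
      using invariant_coeffsD(6)[OF inv E, of 1 2] unfolding diag_sum .
    define q where "q i = E (i, i, 2)" for i
    have "E = diag_array r q"
    proof
      fix v :: idx
      obtain i j k where v: "v = (i, j, k)" by (cases v) auto
      consider "k = 1" | "k = 2" using exhaust_2 by blast
      then show "E v = diag_array r q v"
        by cases (use off[of i j k] r[of i] in \<open>auto simp: v diag_array_def q_def\<close>)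
    qed
    moreover have "c (diag_array r q) = 0"
    proof (rule diag)
      show "q i \<le> r" for i using r[of i] by (simp add: q_def)
      have "(\<Sum>i\<in>UNIV. E (i, i, 1)) + (\<Sum>i\<in>UNIV. E (i, i, 2)) = 4 * r"
        using r by (simp flip: sum.distrib)
      then show "(\<Sum>i\<in>UNIV. q i) = 2 * r" using slice by (simp add: q_def)
    qed
    ultimately show False using E by simp
  qed
qed

lemma homogeneous_invariantD:
  assumes "f \<in> invariants d"
  shows "invariant_coeffs (mcoeff f)" "mcoeff f E \<noteq> 0 \<Longrightarrow> (\<Sum>v\<in>UNIV. E v) = d"
  using assms by (auto simp: invariants_def invariant_iff homogeneous_def monomials_def)

lemma all_compositions_2:
  fixes g :: "nat \<Rightarrow> nat \<Rightarrow> nat \<Rightarrow> nat \<Rightarrow> complex"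
  assumes z: "g 1 1 0 0 = 0" "g 1 0 1 0 = 0" "g 1 0 0 1 = 0" "g 0 1 1 0 = 0" "g 0 1 0 1 = 0" "g 0 0 1 1 = 0"
  shows "x \<le> 1 \<Longrightarrow> y \<le> 1 \<Longrightarrow> z \<le> 1 \<Longrightarrow> w \<le> 1 \<Longrightarrow> x + y + z + w = 2 \<Longrightarrow> g x y z w = 0"
proof goal_cases
  case 1
  then have "x = 0 \<or> x = 1" "y = 0 \<or> y = 1" "z = 0 \<or> z = 1" "w = 0 \<or> w = 1" by auto
  then show ?case using 1(5) by (elim disjE) (simp_all add: z[simplified])
qed

text \<open>There are 6 + 12 + 1 = 19 ways to write 4 as an ordered sum of four parts at most 2. The
  premises stand in the order in which \<open>invariants_8_eq_0\<close> obtains them.\<close>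

lemma all_compositions_4:
  fixes g :: "nat \<Rightarrow> nat \<Rightarrow> nat \<Rightarrow> nat \<Rightarrow> complex"
  assumes z: "g 2 2 0 0 = 0" "g 2 0 2 0 = 0" "g 2 0 0 2 = 0" "g 0 2 2 0 = 0" "g 0 2 0 2 = 0" "g 0 0 2 2 = 0"
    "g 2 1 1 0 = 0" "g 2 1 0 1 = 0" "g 2 0 1 1 = 0" "g 1 2 1 0 = 0" "g 1 2 0 1 = 0" "g 0 2 1 1 = 0"
    "g 1 1 2 0 = 0" "g 1 0 2 1 = 0" "g 0 1 2 1 = 0" "g 1 1 0 2 = 0" "g 1 0 1 2 = 0" "g 0 1 1 2 = 0" "g 1 1 1 1 = 0"
  shows "x \<le> 2 \<Longrightarrow> y \<le> 2 \<Longrightarrow> z \<le> 2 \<Longrightarrow> w \<le> 2 \<Longrightarrow> x + y + z + w = 4 \<Longrightarrow> g x y z w = 0"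
proof goal_cases
  case 1
  then have "x = 0 \<or> x = 1 \<or> x = 2" "y = 0 \<or> y = 1 \<or> y = 2" "z = 0 \<or> z = 1 \<or> z = 2" "w = 0 \<or> w = 1 \<or> w = 2" by auto
  then show ?case using 1(5) by (elim disjE) (simp_all add: z[simplified])
qed

section \<open>Invariants of degrees 4, 8 and 0\<close>

lemma invariants_4_eq_0:
  assumes "f \<in> invariants 4"
  shows "f = 0"
proof (rule cpoly_eqI)
  fix E
  let ?g = "\<lambda>x y z w. mcoeff f (diag_array 1 (vec4 x y z w))"
  note inv = homogeneous_invariantD(1)[OF assms]
  note swap = diag_vec4_swaps[of "mcoeff f" 1, OF inv]
  \<comment> \<open>By symmetry the three terms agree, so three times one of them vanishes.\<close>
  have "?g 1 1 0 0 + ?g 1 0 1 0 + ?g 1 0 0 1 = 0"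
    using diag_array_slice_relation[OF inv, of "vec4 1 0 0 0" 1] by (simp add: sum_4 add.assoc)
  moreover have 1: "?g 1 0 1 0 = ?g 1 1 0 0" "?g 1 0 0 1 = ?g 1 0 1 0"
    using swap(2)[of 1 0 1 0] swap(3)[of 1 0 0 1] by simp_all
  ultimately have "3 * ?g 1 1 0 0 = 0" by algebra
  with 1 have 2: "?g 1 1 0 0 = 0" "?g 1 0 1 0 = 0" "?g 1 0 0 1 = 0" by simp_all
  then have 3: "?g 0 1 1 0 = 0" "?g 0 1 0 1 = 0"
    using swap(1)[of 0 1 1 0] swap(1)[of 0 1 0 1] by simp_all
  then have "?g 0 0 1 1 = 0"
    using swap(2)[of 0 0 1 1] by simp
  note zero = 2 3(1) 3(2) this
  have "mcoeff f (diag_array 1 q) = 0" if "\<And>i. q i \<le> 1" "(\<Sum>i\<in>UNIV. q i) = 2 * 1" for q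
  proof -
    have "?g (q 1) (q 2) (q 3) (q 4) = 0"
      by (rule all_compositions_2[of ?g, OF zero]) (use that in \<open>simp_all add: sum_4\<close>)
    then show ?thesis by (simp add: vec4_eta)
  qed
  then show "mcoeff f E = mcoeff 0 E"
    using eq_zero_of_diag_array_eq_zero[OF inv, of 1 E] homogeneous_invariantD(2)[OF assms] by simp
qed

lemma invariants_8_eq_0:
  assumes "f \<in> invariants 8" and zero: "mcoeff f (diag_array 2 (vec4 2 2 0 0)) = 0"
  shows "f = 0"
proof (rule cpoly_eqI)
  fix E
  let ?g = "\<lambda>x y z w. mcoeff f (diag_array 2 (vec4 x y z w))"
  note inv = homogeneous_invariantD(1)[OF assms(1)]
  note swap = diag_vec4_swaps[of "mcoeff f" 2, OF inv]
  have a1: "?g 2 0 2 0 = 0" using swap(2)[of 2 0 2 0] zero by simp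
  have a2: "?g 2 0 0 2 = 0" "?g 0 2 2 0 = 0"
    using swap(3)[of 2 0 0 2] swap(1)[of 0 2 2 0] a1 by simp_all
  have a3: "?g 0 2 0 2 = 0" using swap(1)[of 0 2 0 2] a2 by simp
  have a4: "?g 0 0 2 2 = 0" using swap(2)[of 0 0 2 2] a3 by simp
  \<comment> \<open>The slice relation at (2,1,0,0) is 2 g(2,2,0,0) + g(2,1,1,0) + g(2,1,0,1) = 0;
    the first position is already full and gives no term.\<close>
  have "?g 2 1 1 0 + ?g 2 1 0 1 = 0"
    using diag_array_slice_relation[OF inv, of "vec4 2 1 0 0" 2] zero by (simp add: sum_4 numeral_2_eq_2)
  moreover have "?g 2 1 0 1 = ?g 2 1 1 0" using swap(3)[of 2 1 0 1] by simp
  ultimately have b1: "?g 2 1 1 0 = 0" "?g 2 1 0 1 = 0" by auto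
  have b2: "?g 2 0 1 1 = 0" using swap(2)[of 2 0 1 1] b1 by simp
  have b3: "?g 1 2 1 0 = 0" "?g 1 2 0 1 = 0" "?g 0 2 1 1 = 0"
    using swap(1)[of 1 2 1 0] swap(1)[of 1 2 0 1] swap(1)[of 0 2 1 1] b1 b2 by simp_all
  have b4: "?g 1 1 2 0 = 0" "?g 1 0 2 1 = 0" "?g 0 1 2 1 = 0"
    using swap(2)[of 1 1 2 0] swap(2)[of 1 0 2 1] swap(2)[of 0 1 2 1] b3 by simp_all
  have b5: "?g 1 1 0 2 = 0" "?g 1 0 1 2 = 0" "?g 0 1 1 2 = 0"
    using swap(3)[of 1 1 0 2] swap(3)[of 1 0 1 2] swap(3)[of 0 1 1 2] b4 by simp_all
  \<comment> \<open>The slice relation at (1,1,1,0) is 2 g(2,1,1,0) + 2 g(1,2,1,0) + 2 g(1,1,2,0) +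
    g(1,1,1,1) = 0.\<close>
  have c: "?g 1 1 1 1 = 0"
    using diag_array_slice_relation[OF inv, of "vec4 1 1 1 0" 2] b1 b3 b4 by (simp add: sum_4 numeral_2_eq_2)
  note zeros = zero a1 a2 a3 a4 b1 b2 b3 b4 b5 c
  have "mcoeff f (diag_array 2 q) = 0" if "\<And>i. q i \<le> 2" "(\<Sum>i\<in>UNIV. q i) = 2 * 2" for q
  proof -
    have "?g (q 1) (q 2) (q 3) (q 4) = 0"
      by (rule all_compositions_4[of ?g, OF zeros]) (use that in \<open>simp_all add: sum_4\<close>)
    then show ?thesis by (simp add: vec4_eta)
  qed
  then show "mcoeff f E = mcoeff 0 E"
    using eq_zero_of_diag_array_eq_zero[OF inv, of 2 E] homogeneous_invariantD(2)[OF assms(1)] by simp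
qed

lemma invariants_0_eq: "invariants 0 = cpoly.span {1}"
proof -
  have one: "mcoeff 1 E = (if E = (\<lambda>_. 0) then 1 else 0)" for E
    using mcoeff_X[of "\<lambda>_. 0" E] by (auto simp: X_def)
  have "f \<in> cpoly.span {1}" if "f \<in> invariants 0" for f
  proof -
    have "f = poly_scale (mcoeff f (\<lambda>_. 0)) 1"
    proof (rule cpoly_eqI)
      fix E
      have "E = (\<lambda>_. 0)" if "mcoeff f E \<noteq> 0"
        using homogeneous_invariantD(2)[OF \<open>f \<in> invariants 0\<close> that] by (auto simp: fun_eq_iff)
      then show "mcoeff f E = mcoeff (poly_scale (mcoeff f (\<lambda>_. 0)) 1) E"
        by (cases "E = (\<lambda>_. 0)") (auto simp: mcoeff_scale one)
    qed
    then show ?thesis by (simp add: cpoly.span_singleton)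
  qed
  moreover have "1 \<in> invariants 0"
  proof -
    have "act D 1 = 0" for D
      using act_mult[of D 1 1] by simp
    moreover have "homogeneous 0 1"
      by (auto simp: homogeneous_def monomials_def one split: if_splits)
    ultimately show ?thesis by (simp add: invariants_def invariant_def)
  qed
  ultimately show ?thesis
    using cpoly.span_minimal[OF _ subspace_invariants, of "{1}" 0] by blast
qed

section \<open>Executable test of the orbit list\<close>

text \<open>An array is given by the list of its four rows, each listing the entries of the first slice before
  those of the second. The simplifier evaluates these functions: every case distinction is a pattern
  match of an auxiliary function, because the congruence rules for \<open>if\<close> and \<open>case\<close> would make the simplifier
  traverse the trie again and again.\<close>

datatype comparison = LT | EQ | GT

fun cmp_nat :: "nat \<Rightarrow> nat \<Rightarrow> comparison" where
  "cmp_nat 0 0 = EQ"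
| "cmp_nat 0 (Suc _) = LT"
| "cmp_nat (Suc _) 0 = GT"
| "cmp_nat (Suc a) (Suc b) = cmp_nat a b"

fun cmp_list :: "nat list \<Rightarrow> nat list \<Rightarrow> comparison"
  and cmp_list_aux :: "comparison \<Rightarrow> nat list \<Rightarrow> nat list \<Rightarrow> comparison" where
  "cmp_list [] [] = EQ"
| "cmp_list [] (_ # _) = LT"
| "cmp_list (_ # _) [] = GT"
| "cmp_list (x # xs) (y # ys) = cmp_list_aux (cmp_nat x y) xs ys"
| "cmp_list_aux LT _ _ = LT"
| "cmp_list_aux GT _ _ = GT"
| "cmp_list_aux EQ xs ys = cmp_list xs ys"

fun insert_row :: "nat list \<Rightarrow> nat list list \<Rightarrow> nat list list"
  and insert_row_aux :: "comparison \<Rightarrow> nat list \<Rightarrow> nat list \<Rightarrow> nat list list \<Rightarrow> nat list list" where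
  "insert_row x [] = [x]"
| "insert_row x (y # ys) = insert_row_aux (cmp_list x y) x y ys"
| "insert_row_aux LT x y ys = x # y # ys"
| "insert_row_aux EQ x y ys = x # y # ys"
| "insert_row_aux GT x y ys = y # insert_row x ys"

fun sort_rows :: "nat list list \<Rightarrow> nat list list" where
  "sort_rows [] = []"
| "sort_rows (x # xs) = insert_row x (sort_rows xs)"

text \<open>Three branches suffice, since an array with row sums 2 has only entries 0, 1 and 2. A
  concatenated key has length 32, so all values sit at the same depth.\<close>

datatype trie = Empty | Val int | Node trie trie trie

fun trie_lookup :: "trie \<Rightarrow> nat list \<Rightarrow> int option" where
  "trie_lookup (Val c) [] = Some c"
| "trie_lookup (Node t0 t1 t2) (0 # ks) = trie_lookup t0 ks"
| "trie_lookup (Node t0 t1 t2) (Suc 0 # ks) = trie_lookup t1 ks"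
| "trie_lookup (Node t0 t1 t2) (Suc (Suc 0) # ks) = trie_lookup t2 ks"
| "trie_lookup _ _ = None"

fun trie_insert :: "nat list \<Rightarrow> int \<Rightarrow> trie \<Rightarrow> trie" where
  "trie_insert [] c t = Val c"
| "trie_insert (0 # ks) c (Node t0 t1 t2) = Node (trie_insert ks c t0) t1 t2"
| "trie_insert (Suc 0 # ks) c (Node t0 t1 t2) = Node t0 (trie_insert ks c t1) t2"
| "trie_insert (Suc (Suc 0) # ks) c (Node t0 t1 t2) = Node t0 t1 (trie_insert ks c t2)"
| "trie_insert (0 # ks) c _ = Node (trie_insert ks c Empty) Empty Empty"
| "trie_insert (Suc 0 # ks) c _ = Node Empty (trie_insert ks c Empty) Empty"
| "trie_insert (Suc (Suc 0) # ks) c _ = Node Empty Empty (trie_insert ks c Empty)"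
| "trie_insert _ c t = t"

text \<open>A free datatype lets columns be selected by pattern matching, without arithmetic in the
  numeral type \<open>4\<close>.\<close>

datatype i4 = I1 | I2 | I3 | I4

fun select :: "i4 \<Rightarrow> 'a \<Rightarrow> 'a \<Rightarrow> 'a \<Rightarrow> 'a \<Rightarrow> 'a" where
  "select I1 a b c d = a"
| "select I2 a b c d = b"
| "select I3 a b c d = c"
| "select I4 a b c d = d"

type_synonym perm4 = "i4 \<times> i4 \<times> i4 \<times> i4"

definition perms4 :: "perm4 list" where
  "perms4 = [(x, y, z, w). x \<leftarrow> [I1, I2, I3, I4], y \<leftarrow> [I1, I2, I3, I4], z \<leftarrow> [I1, I2, I3, I4],
     w \<leftarrow> [I1, I2, I3, I4], distinct [x, y, z, w]]"

fun permute_row :: "perm4 \<Rightarrow> nat list \<Rightarrow> nat list" where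
  "permute_row (x, y, z, w) [a, b, c, d, e, f, g, h] =
     [select x a b c d, select y a b c d, select z a b c d, select w a b c d,
      select x e f g h, select y e f g h, select z e f g h, select w e f g h]"
| "permute_row _ r = r"

fun permute_columns :: "perm4 \<Rightarrow> nat list list \<Rightarrow> nat list list" where
  "permute_columns p [] = []"
| "permute_columns p (r # rs) = permute_row p r # permute_columns p rs"

fun swap_row :: "nat list \<Rightarrow> nat list" where
  "swap_row [a, b, c, d, e, f, g, h] = [e, f, g, h, a, b, c, d]"
| "swap_row r = r"

fun swap_slices :: "nat list list \<Rightarrow> nat list list" where
  "swap_slices [] = []"
| "swap_slices (r # rs) = swap_row r # swap_slices rs"

fun zip4 :: "nat list \<Rightarrow> nat list \<Rightarrow> nat list \<Rightarrow> nat list \<Rightarrow> nat list list" where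
  "zip4 (a # as) (b # bs) (c # cs) (d # ds) = [a, b, c, d] # zip4 as bs cs ds"
| "zip4 _ _ _ _ = []"

fun join_halves :: "nat list list \<Rightarrow> nat list list" where
  "join_halves [a, b, c, d, e, f, g, h] = [a @ e, b @ f, c @ g, d @ h]"
| "join_halves r = r"

fun transpose_rows :: "nat list list \<Rightarrow> nat list list" where
  "transpose_rows [a, b, c, d] = join_halves (zip4 a b c d)"
| "transpose_rows r = r"

fun column_keys :: "perm4 list \<Rightarrow> nat list list \<Rightarrow> nat list list list \<Rightarrow> nat list list list" where
  "column_keys [] A ks = ks"
| "column_keys (p # ps) A ks = sort_rows (permute_columns p A) # column_keys ps A ks"

text \<open>With all 24 permutations the list has 96 keys, usually with repetitions. Row
  permutations do not appear because sorting the rows absorbs them.\<close>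

definition orbit_keys :: "perm4 list \<Rightarrow> nat list list \<Rightarrow> nat list list list" where
  "orbit_keys ps A = column_keys ps A (column_keys ps (swap_slices A)
     (column_keys ps (transpose_rows A) (column_keys ps (swap_slices (transpose_rows A)) [])))"

fun count_equal :: "comparison \<Rightarrow> nat \<Rightarrow> nat" where
  "count_equal EQ n = Suc n"
| "count_equal LT n = n"
| "count_equal GT n = n"

text \<open>The number of distinct arrangements of four rows, in terms of the number of equal pairs among them.\<close>

fun multiplicity_of :: "nat \<Rightarrow> int" where
  "multiplicity_of 0 = 24"
| "multiplicity_of (Suc 0) = 12"
| "multiplicity_of (Suc (Suc 0)) = 6"
| "multiplicity_of (Suc (Suc (Suc 0))) = 4"
| "multiplicity_of (Suc (Suc (Suc (Suc _)))) = 1"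

fun arrangements :: "nat list list \<Rightarrow> int" where
  "arrangements [p, q, r, s] = multiplicity_of
     (count_equal (cmp_list p q) (count_equal (cmp_list p r) (count_equal (cmp_list p s)
     (count_equal (cmp_list q r) (count_equal (cmp_list q s) (count_equal (cmp_list r s) 0))))))"
| "arrangements _ = 0"

datatype state = State trie int

text \<open>A key that is already present is not counted again, so repetitions among the 96 keys do
  no harm to the orbit size.\<close>

fun insert_key :: "int option \<Rightarrow> int \<Rightarrow> nat list list \<Rightarrow> trie \<Rightarrow> int \<Rightarrow> state" where
  "insert_key (Some _) c k t n = State t n"
| "insert_key None c k t n = State (trie_insert (concat k) c t) (n + arrangements k)"

fun insert_keys :: "int \<Rightarrow> nat list list list \<Rightarrow> state \<Rightarrow> state" where
  "insert_keys c [] st = st"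
| "insert_keys c (k # ks) (State t n) =
     insert_keys c ks (insert_key (trie_lookup t (concat k)) c k t n)"

datatype result = Failure | Success trie

fun success_if :: "bool \<Rightarrow> trie \<Rightarrow> result" where
  "success_if True t = Success t"
| "success_if False t = Failure"

fun check_size :: "int \<Rightarrow> state \<Rightarrow> result" where
  "check_size s (State t n) = success_if (n = s) t"

fun insert_orbit :: "int option \<Rightarrow> perm4 list \<Rightarrow> int \<times> nat list list \<times> int \<Rightarrow> trie \<Rightarrow> result" where
  "insert_orbit (Some _) ps x t = Failure"
| "insert_orbit None ps (c, A, s) t = check_size s (insert_keys c (orbit_keys ps A) (State t 0))"

text \<open>An orbit is disjoint from the earlier ones as soon as the key of its representative is new.\<close>

fun add_orbit :: "perm4 list \<Rightarrow> int \<times> nat list list \<times> int \<Rightarrow> result \<Rightarrow> result" where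
  "add_orbit ps x Failure = Failure"
| "add_orbit ps (c, A, s) (Success t) =
     insert_orbit (trie_lookup t (concat (sort_rows A))) ps (c, A, s) t"

fun build :: "perm4 list \<Rightarrow> (int \<times> nat list list \<times> int) list \<Rightarrow> result \<Rightarrow> result" where
  "build ps [] r = r"
| "build ps (x # L) r = build ps L (add_orbit ps x r)"

section \<open>Relations as sums over unit moves\<close>

fun cons_pairs :: "nat \<Rightarrow> nat \<Rightarrow> (nat \<times> nat list \<times> nat list) list \<Rightarrow> (nat \<times> nat list \<times> nat list) list" where
  "cons_pairs a b [] = []"
| "cons_pairs a b ((w, xs, ys) # L) = (w, a # xs, b # ys) # cons_pairs a b L"

text \<open>All ways to move one unit from the first list to the same position of the second list, together
  with the new entry of the second list.\<close>

fun unit_moves :: "nat list \<Rightarrow> nat list \<Rightarrow> (nat \<times> nat list \<times> nat list) list" where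
  "unit_moves (0 # as) (b # bs) = cons_pairs 0 b (unit_moves as bs)"
| "unit_moves (Suc a # as) (b # bs) = (Suc b, a # as, Suc b # bs) # cons_pairs (Suc a) b (unit_moves as bs)"
| "unit_moves _ _ = []"

fun value_of :: "int option \<Rightarrow> int" where
  "value_of None = 0"
| "value_of (Some c) = c"

definition coeff :: "trie \<Rightarrow> nat list list \<Rightarrow> int" where
  "coeff t A = value_of (trie_lookup t (concat (sort_rows A)))"

fun nat_mult :: "nat \<Rightarrow> int \<Rightarrow> int" where
  "nat_mult 0 c = 0"
| "nat_mult (Suc n) c = c + nat_mult n c"

fun row_sum :: "trie \<Rightarrow> nat list list \<Rightarrow> (nat \<times> nat list \<times> nat list) list \<Rightarrow> int" where
  "row_sum t rs [] = 0"
| "row_sum t rs ((w, x, y) # L) = nat_mult w (coeff t (x # y # rs)) + row_sum t rs L"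

text \<open>An item of \<open>L\<close> describes an array \<open>G\<close> one move away from the
  representative. The inner \<open>unit_moves x y\<close> goes in the opposite direction, so it runs
  through the terms of the relation at \<open>G\<close>, one of which is the representative.\<close>

fun all_row_sums :: "trie \<Rightarrow> nat list list \<Rightarrow> (nat \<times> nat list \<times> nat list) list \<Rightarrow> bool" where
  "all_row_sums t rs [] = True"
| "all_row_sums t rs ((w, y, x) # L) = (row_sum t rs (unit_moves x y) = 0 \<and> all_row_sums t rs L)"

text \<open>All twelve ordered pairs of rows are tested; the other two rows are merely carried
  along, and their order is immaterial because \<open>coeff\<close> sorts.\<close>

fun check_rows :: "trie \<Rightarrow> nat list list \<Rightarrow> bool" where
  "check_rows t [p, q, r, s] = (
     all_row_sums t [r, s] (unit_moves q p) \<and> all_row_sums t [r, s] (unit_moves p q)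
   \<and> all_row_sums t [q, s] (unit_moves r p) \<and> all_row_sums t [q, s] (unit_moves p r)
   \<and> all_row_sums t [q, r] (unit_moves s p) \<and> all_row_sums t [q, r] (unit_moves p s)
   \<and> all_row_sums t [p, s] (unit_moves q r) \<and> all_row_sums t [p, s] (unit_moves r q)
   \<and> all_row_sums t [p, r] (unit_moves q s) \<and> all_row_sums t [p, r] (unit_moves s q)
   \<and> all_row_sums t [p, q] (unit_moves r s) \<and> all_row_sums t [p, q] (unit_moves s r))"
| "check_rows t _ = False"

fun slice1 :: "nat list list \<Rightarrow> nat list" where
  "slice1 ([a, b, c, d, e, f, g, h] # rs) = a # b # c # d # slice1 rs"
| "slice1 _ = []"

fun slice2 :: "nat list list \<Rightarrow> nat list" where
  "slice2 ([a, b, c, d, e, f, g, h] # rs) = e # f # g # h # slice2 rs"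
| "slice2 _ = []"

fun merge_slices :: "nat list \<Rightarrow> nat list \<Rightarrow> nat list list" where
  "merge_slices (a # b # c # d # as) (e # f # g # h # bs) = [a, b, c, d, e, f, g, h] # merge_slices as bs"
| "merge_slices _ _ = []"

fun slice_sum :: "trie \<Rightarrow> (nat \<times> nat list \<times> nat list) list \<Rightarrow> int" where
  "slice_sum t [] = 0"
| "slice_sum t ((w, x, y) # L) = nat_mult w (coeff t (merge_slices x y)) + slice_sum t L"

fun all_slice_sums :: "trie \<Rightarrow> (nat \<times> nat list \<times> nat list) list \<Rightarrow> bool" where
  "all_slice_sums t [] = True"
| "all_slice_sums t ((w, y, x) # L) = (slice_sum t (unit_moves x y) = 0 \<and> all_slice_sums t L)"

text \<open>Only units moved from the second slice to the first are considered; the other direction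
  is covered by applying the test to the array with its slices exchanged.\<close>

definition check_slices :: "trie \<Rightarrow> nat list list \<Rightarrow> bool" where
  "check_slices t A = all_slice_sums t (unit_moves (slice2 A) (slice1 A))"

fun check_relations :: "trie \<Rightarrow> (int \<times> nat list list \<times> int) list \<Rightarrow> bool" where
  "check_relations t [] = True"
| "check_relations t ((c, A, s) # L) = (check_rows t A \<and> check_rows t (transpose_rows A)
     \<and> check_slices t A \<and> check_slices t (swap_slices A) \<and> check_relations t L)"

fun check_result :: "(int \<times> nat list list \<times> int) list \<Rightarrow> result \<Rightarrow> bool" where
  "check_result L Failure = False"
| "check_result L (Success t) = check_relations t L"

definition orbit_rows :: "(int \<times> nat list list \<times> int) list" where
  "orbit_rows = map (\<lambda>(c, bs, s). (c, map (\<lambda>(x, y). x @ y) bs, int s)) orbit_list"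

text \<open>This single evaluation contains the sizes and disjointness of the orbits and all
  relations at the representatives; what follows interprets it.\<close>

lemma check_orbit_rows: "check_result orbit_rows (build perms4 orbit_rows (Success Empty))"
  by code_simp

section \<open>Orbits and keys\<close>

definition array_row :: "array \<Rightarrow> 4 \<Rightarrow> nat list" where
  "array_row E i = [E (i, 1, 1), E (i, 2, 1), E (i, 3, 1), E (i, 4, 1), E (i, 1, 2), E (i, 2, 2), E (i, 3, 2), E (i, 4, 2)]"

definition array_rows :: "array \<Rightarrow> nat list list" where
  "array_rows E = [array_row E 1, array_row E 2, array_row E 3, array_row E 4]"

definition permuted :: "(4 \<Rightarrow> 4) \<Rightarrow> (4 \<Rightarrow> 4) \<Rightarrow> (2 \<Rightarrow> 2) \<Rightarrow> array \<Rightarrow> array" where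
  "permuted \<alpha> \<beta> \<gamma> E = (\<lambda>(i, j, k). E (\<alpha> i, \<beta> j, \<gamma> k))"

definition key :: "array \<Rightarrow> nat list list" where
  "key E = sort_rows (array_rows E)"

lemma array_row_eq_iff: "array_row E i = array_row E' i' \<longleftrightarrow> (\<forall>j k. E (i, j, k) = E' (i', j, k))"
  by (auto simp: array_row_def forall_4 forall_2)

lemma array_rows_eq_iff: "array_rows E = array_rows E' \<longleftrightarrow> E = E'"
proof -
  have "E = E' \<longleftrightarrow> (\<forall>i. \<forall>j k. E (i, j, k) = E' (i, j, k))"
    by (simp add: fun_eq_iff)
  then show ?thesis
    unfolding forall_4[where P = "\<lambda>i. \<forall>j k. E (i, j, k) = E' (i, j, k)"] by (simp add: array_rows_def array_row_eq_iff)
qed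

lemma cmp_nat_eq: "cmp_nat x y = (if x < y then LT else if x = y then EQ else GT)"
  by (induction x y rule: cmp_nat.induct) auto

lemma cmp_list_eq: "cmp_list xs ys = (if xs < ys then LT else if xs = ys then EQ else GT)"
proof (induction xs arbitrary: ys)
  case Nil
  then show ?case by (cases ys) auto
next
  case (Cons x xs)
  then show ?case by (cases ys) (auto simp: cmp_nat_eq)
qed

lemma insert_row_eq: "insert_row x ys = insort x ys"
  by (induction ys) (auto simp: cmp_list_eq)

lemma sort_rows_eq: "sort_rows xs = sort xs"
  by (induction xs) (auto simp: insert_row_eq)

lemma sort_rows_eq_iff: "sort_rows xs = sort_rows ys \<longleftrightarrow> mset xs = mset ys"
  unfolding sort_rows_eq
proof
  assume "sort xs = sort ys"
  then have "mset (sort xs) = mset (sort ys)" by simp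
  then show "mset xs = mset ys" by simp
next
  assume "mset xs = mset ys"
  then show "sort xs = sort ys" by (intro properties_for_sort) simp_all
qed

lemma mset_rows: "mset (array_rows E) = image_mset (array_row E) (mset_set UNIV)"
proof -
  have "mset_set (UNIV :: 4 set) = {#1, 2, 3, 4#}"
    by (subst UNIV_4) simp
  then show ?thesis by (simp add: array_rows_def)
qed

text \<open>Equal keys mean equal multisets of rows, and two families over the same finite index set
  have equal multisets exactly if a bijection of the indices matches them.\<close>

lemma key_eq_iff: "key E = key E' \<longleftrightarrow> (\<exists>\<alpha>. bij \<alpha> \<and> E = permuted \<alpha> id id E')"
proof -
  have "key E = key E' \<longleftrightarrow> image_mset (array_row E) (mset_set UNIV) = image_mset (array_row E') (mset_set UNIV)"
    by (simp add: key_def sort_rows_eq_iff mset_rows)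
  also have "\<dots> \<longleftrightarrow> (\<exists>\<alpha>. bij \<alpha> \<and> (\<forall>i. array_row E i = array_row E' (\<alpha> i)))"
  proof
    assume "image_mset (array_row E) (mset_set UNIV) = image_mset (array_row E') (mset_set UNIV)"
    then obtain p where "p permutes (UNIV :: 4 set)" "\<forall>i\<in>UNIV. array_row E i = array_row E' (p i)"
      using image_mset_eq_implies_permutes[of UNIV "array_row E" "array_row E'"] by auto
    then show "\<exists>\<alpha>. bij \<alpha> \<and> (\<forall>i. array_row E i = array_row E' (\<alpha> i))"
      using permutes_bij by blast
  next
    assume "\<exists>\<alpha>. bij \<alpha> \<and> (\<forall>i. array_row E i = array_row E' (\<alpha> i))"
    then obtain \<alpha> where \<alpha>: "bij \<alpha>" "\<And>i. array_row E i = array_row E' (\<alpha> i)" by blast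
    have "image_mset (array_row E) (mset_set UNIV) = image_mset (array_row E') (image_mset \<alpha> (mset_set UNIV))"
      by (simp add: multiset.map_comp comp_def flip: \<alpha>(2))
    also have "image_mset \<alpha> (mset_set UNIV) = mset_set UNIV"
      using \<alpha>(1) by (simp add: image_mset_mset_set bij_def)
    finally show "image_mset (array_row E) (mset_set UNIV) = image_mset (array_row E') (mset_set UNIV)" .
  qed
  also have "\<dots> \<longleftrightarrow> (\<exists>\<alpha>. bij \<alpha> \<and> E = permuted \<alpha> id id E')"
    by (simp add: array_row_eq_iff permuted_def fun_eq_iff)
  finally show ?thesis .
qed

fun index :: "i4 \<Rightarrow> 4" where
  "index I1 = 1" | "index I2 = 2" | "index I3 = 3" | "index I4 = 4"

fun perm_of :: "perm4 \<Rightarrow> 4 \<Rightarrow> 4" where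
  "perm_of (x, y, z, w) = (\<lambda>j. if j = 1 then index x else if j = 2 then index y else if j = 3 then index z else index w)"

lemma index_eq_iff [simp]: "index x = index y \<longleftrightarrow> x = y"
  by (cases x; cases y) simp_all

lemma ex_index: "\<exists>x. index x = i"
  using exhaust_4[of i] index.simps by metis

lemma select_index: "select x (f 1) (f 2) (f 3) (f 4) = f (index x)"
  by (cases x) simp_all

lemma in_perms4_iff: "(x, y, z, w) \<in> set perms4 \<longleftrightarrow> distinct [x, y, z, w]"
proof -
  have "(x, y, z, w) \<in> set [(x, y, z, w). x \<leftarrow> L, y \<leftarrow> L, z \<leftarrow> L, w \<leftarrow> L, distinct [x, y, z, w]]
      \<longleftrightarrow> {x, y, z, w} \<subseteq> set L \<and> distinct [x, y, z, w]" for L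
    by auto
  moreover have "u \<in> set [I1, I2, I3, I4]" for u
    by (cases u) simp_all
  ultimately show ?thesis
    unfolding perms4_def by blast
qed

lemma bij_iff_perm_of: "bij \<beta> \<longleftrightarrow> (\<exists>p\<in>set perms4. \<beta> = perm_of p)"
proof
  assume "bij \<beta>"
  then have inj: "\<beta> i = \<beta> j \<longleftrightarrow> i = j" for i j by (metis bij_pointE)
  obtain x y z w where *: "index x = \<beta> 1" "index y = \<beta> 2" "index z = \<beta> 3" "index w = \<beta> 4"
    using ex_index by metis
  have "distinct [\<beta> 1, \<beta> 2, \<beta> 3, \<beta> 4]" by (simp add: inj)
  then have "distinct [x, y, z, w]" by (simp flip: *)
  then have "(x, y, z, w) \<in> set perms4"
    by (simp only: in_perms4_iff)
  moreover have "\<beta> = perm_of (x, y, z, w)"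
    by (simp add: * fun_eq_iff forall_4)
  ultimately show "\<exists>p\<in>set perms4. \<beta> = perm_of p" by blast
next
  assume "\<exists>p\<in>set perms4. \<beta> = perm_of p"
  then obtain x y z w where "(x, y, z, w) \<in> set perms4" and \<beta>: "\<beta> = perm_of (x, y, z, w)"
    by auto
  then have "distinct [x, y, z, w]" by (simp only: in_perms4_iff)
  then have "i = j" if "\<beta> i = \<beta> j" for i j
    using exhaust_4[of i] exhaust_4[of j] that unfolding \<beta> by (elim disjE) simp_all
  then have "inj \<beta>" by (intro injI)
  then show "bij \<beta>" using finite_UNIV_inj_surj[of \<beta>] by (simp add: bij_def)
qed

definition swap2 :: "2 \<Rightarrow> 2" where
  "swap2 k = (if k = 1 then 2 else 1)"

lemma bij_2_iff: "bij (\<gamma> :: 2 \<Rightarrow> 2) \<longleftrightarrow> \<gamma> = id \<or> \<gamma> = swap2"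
proof
  assume "bij \<gamma>"
  then have "\<gamma> 1 \<noteq> \<gamma> 2" using inj_eq[OF bij_is_inj, of \<gamma> 1 2] by simp
  then show "\<gamma> = id \<or> \<gamma> = swap2"
    using exhaust_2[of "\<gamma> 1"] exhaust_2[of "\<gamma> 2"] by (auto simp: fun_eq_iff forall_2 swap2_def)
next
  have "swap2 (swap2 k) = k" for k
    using exhaust_2[of k] by (auto simp: swap2_def)
  then have "bij swap2" by (intro o_bij[of swap2]) (simp_all add: fun_eq_iff)
  then show "\<gamma> = id \<or> \<gamma> = swap2 \<Longrightarrow> bij \<gamma>" by auto
qed

lemma array_rows_permute_columns: "array_rows (permuted id (perm_of p) id E) = permute_columns p (array_rows E)"
proof -
  obtain x y z w where p: "p = (x, y, z, w)" by (cases p) auto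
  have "array_row (permuted id (perm_of p) id E) i = permute_row p (array_row E i)" for i
    by (simp add: array_row_def permuted_def p select_index[where f = "\<lambda>j. E (i, j, _)"])
  then show ?thesis by (simp add: array_rows_def)
qed

lemma array_rows_swap_slices: "array_rows (permuted id id swap2 E) = swap_slices (array_rows E)"
  by (simp add: array_rows_def array_row_def permuted_def swap2_def)

lemma array_rows_flip: "array_rows (flip_array E) = transpose_rows (array_rows E)"
  by (simp add: array_rows_def array_row_def flip_array_def)

lemma set_column_keys:
  "set (column_keys ps A ks) = (\<lambda>p. sort_rows (permute_columns p A)) ` set ps \<union> set ks"
  by (induction ps) auto

lemma permuted_id [simp]: "permuted id id id E = E"
  by (simp add: permuted_def)

lemma permuted_permuted: "permuted \<alpha> \<beta> \<gamma> (permuted \<alpha>' \<beta>' \<gamma>' E) = permuted (\<alpha>' \<circ> \<alpha>) (\<beta>' \<circ> \<beta>) (\<gamma>' \<circ> \<gamma>) E"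
  by (simp add: permuted_def fun_eq_iff)

text \<open>The multiplication rule of the semidirect product: the flip exchanges the two copies of
  S4. It brings products and inverses of group elements back to the form used in
  \<open>orbit_iff\<close>.\<close>

lemma flip_permuted: "flip_array (permuted \<alpha> \<beta> \<gamma> E) = permuted \<beta> \<alpha> \<gamma> (flip_array E)"
  by (simp add: permuted_def flip_array_def fun_eq_iff)

lemma flip_flip [simp]: "flip_array (flip_array E) = E"
  by (simp add: flip_array_def fun_eq_iff)

lemma orbit_iff:
  "E \<in> orbit D \<longleftrightarrow> (\<exists>B\<in>{D, flip_array D}. \<exists>\<alpha> \<beta> \<gamma>. bij \<alpha> \<and> bij \<beta> \<and> bij \<gamma> \<and> E = permuted \<alpha> \<beta> \<gamma> B)"
proof -
  have "act_array (\<alpha>, \<beta>, \<gamma>, t) D = permuted \<alpha> \<beta> \<gamma> (if t then flip_array D else D)" for \<alpha> \<beta> \<gamma> t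
    by (simp add: permuted_def)
  moreover have "E \<in> orbit D \<longleftrightarrow> (\<exists>\<alpha> \<beta> \<gamma> t. bij \<alpha> \<and> bij \<beta> \<and> bij \<gamma> \<and> E = act_array (\<alpha>, \<beta>, \<gamma>, t) D)"
    unfolding orbit_def array_group_def by (auto simp del: act_array.simps)
  ultimately show ?thesis by (simp add: ex_bool_eq) blast
qed

lemma permuted_in_orbit:
  assumes "B \<in> {D, flip_array D}" "bij \<alpha>" "bij \<beta>" "bij \<gamma>"
  shows "permuted \<alpha> \<beta> \<gamma> B \<in> orbit D"
  using assms unfolding orbit_iff by blast

lemma orbit_self: "D \<in> orbit D"
  using permuted_in_orbit[of D D id id id] by simp

lemma orbit_sym:
  assumes "E \<in> orbit D"
  shows "D \<in> orbit E"
proof -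
  obtain \<alpha> \<beta> \<gamma> B where *: "B \<in> {D, flip_array D}" "bij \<alpha>" "bij \<beta>" "bij \<gamma>" "E = permuted \<alpha> \<beta> \<gamma> B"
    using assms unfolding orbit_iff by blast
  have inv: "\<delta> \<circ> inv \<delta> = id" if "bij \<delta>" for \<delta> :: "'x \<Rightarrow> 'x"
    using that by (simp add: bij_is_surj surj_iff[symmetric])
  have B: "B = permuted (inv \<alpha>) (inv \<beta>) (inv \<gamma>) E"
    using *(2-4) by (simp add: *(5) permuted_permuted inv)
  have "flip_array B = permuted (inv \<beta>) (inv \<alpha>) (inv \<gamma>) (flip_array E)"
    by (simp only: B flip_permuted)
  moreover have "D = B \<or> D = flip_array B" using *(1) by auto
  moreover have "bij (inv \<alpha>)" "bij (inv \<beta>)" "bij (inv \<gamma>)" using *(2-4) by (simp_all add: bij_imp_bij_inv)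
  ultimately show ?thesis
    using B permuted_in_orbit by (elim disjE) simp_all
qed

lemma orbit_trans:
  assumes "E \<in> orbit D" "D \<in> orbit C"
  shows "E \<in> orbit C"
proof -
  obtain \<alpha> \<beta> \<gamma> B where *: "B \<in> {D, flip_array D}" "bij \<alpha>" "bij \<beta>" "bij \<gamma>" "E = permuted \<alpha> \<beta> \<gamma> B"
    using assms(1) unfolding orbit_iff by blast
  obtain \<alpha>' \<beta>' \<gamma>' B' where **: "B' \<in> {C, flip_array C}" "bij \<alpha>'" "bij \<beta>'" "bij \<gamma>'" "D = permuted \<alpha>' \<beta>' \<gamma>' B'"
    using assms(2) unfolding orbit_iff by blast
  have "E = permuted (\<alpha>' \<circ> \<alpha>) (\<beta>' \<circ> \<beta>) (\<gamma>' \<circ> \<gamma>) B' \<or>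
        E = permuted (\<beta>' \<circ> \<alpha>) (\<alpha>' \<circ> \<beta>) (\<gamma>' \<circ> \<gamma>) (flip_array B')"
    using *(1,5) **(5) by (auto simp: flip_permuted permuted_permuted)
  moreover have "flip_array B' \<in> {C, flip_array C}" using **(1) by auto
  ultimately show ?thesis
    using *(2-4) **(1-4) by (elim disjE) (simp_all only:, (rule permuted_in_orbit; simp add: bij_comp)+)
qed

lemma orbit_eq: "E \<in> orbit D \<Longrightarrow> orbit E = orbit D"
  using orbit_sym orbit_trans by blast

lemma set_orbit_keys:
  "set (orbit_keys perms4 (array_rows D)) =
     {key (permuted id \<beta> \<gamma> B) | B \<beta> \<gamma>. B \<in> {D, flip_array D} \<and> bij \<beta> \<and> bij \<gamma>}"
proof -
  have 1: "(\<lambda>p. sort_rows (permute_columns p (array_rows C))) ` set perms4 = {key (permuted id \<beta> id C) | \<beta>. bij \<beta>}" for C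
  proof -
    have *: "sort_rows (permute_columns p (array_rows C)) = key (permuted id (perm_of p) id C)" for p
      by (simp add: key_def array_rows_permute_columns)
    show ?thesis unfolding * bij_iff_perm_of by blast
  qed
  have 2: "permuted id \<beta> id (permuted id id swap2 C) = permuted id \<beta> swap2 C" for \<beta> C
    by (simp add: permuted_permuted)
  have "set (orbit_keys perms4 (array_rows D)) =
      {key (permuted id \<beta> id D) | \<beta>. bij \<beta>} \<union> {key (permuted id \<beta> swap2 D) | \<beta>. bij \<beta>}
    \<union> {key (permuted id \<beta> id (flip_array D)) | \<beta>. bij \<beta>} \<union> {key (permuted id \<beta> swap2 (flip_array D)) | \<beta>. bij \<beta>}"
    unfolding orbit_keys_def set_column_keys array_rows_flip[symmetric] array_rows_swap_slices[symmetric] 1 2 by auto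
  also have "\<dots> = {key (permuted id \<beta> \<gamma> B) | B \<beta> \<gamma>. B \<in> {D, flip_array D} \<and> bij \<beta> \<and> bij \<gamma>}"
    unfolding bij_2_iff by blast
  finally show ?thesis .
qed

text \<open>The choice of the row permutation \<alpha> in \<open>orbit_iff\<close> amounts to
  equality of keys, which leaves finitely many keys to compare with.\<close>

lemma orbit_iff_key: "E \<in> orbit D \<longleftrightarrow> key E \<in> set (orbit_keys perms4 (array_rows D))"
proof -
  have "E \<in> orbit D \<longleftrightarrow> (\<exists>B\<in>{D, flip_array D}. \<exists>\<beta> \<gamma>. bij \<beta> \<and> bij \<gamma> \<and> (\<exists>\<alpha>. bij \<alpha> \<and> E = permuted \<alpha> \<beta> \<gamma> B))"
    unfolding orbit_iff by blast
  also have "\<dots> \<longleftrightarrow> (\<exists>B\<in>{D, flip_array D}. \<exists>\<beta> \<gamma>. bij \<beta> \<and> bij \<gamma> \<and> key E = key (permuted id \<beta> \<gamma> B))"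
    unfolding key_eq_iff by (simp add: permuted_permuted)
  also have "\<dots> \<longleftrightarrow> key E \<in> set (orbit_keys perms4 (array_rows D))"
    unfolding set_orbit_keys by auto
  finally show ?thesis .
qed

lemma array_rows_array_of:
  assumes "length bs = 4" "\<And>x y. (x, y) \<in> set bs \<Longrightarrow> length x = 4 \<and> length y = 4"
  shows "array_rows (array_of bs) = map (\<lambda>(x, y). x @ y) bs"
proof -
  obtain b1 b2 b3 b4 where bs: "bs = [b1, b2, b3, b4]"
    using assms(1) by (auto simp: length_Suc_conv numeral_eq_Suc)
  have list4: "x = [x ! 0, x ! 1, x ! 2, x ! 3]" if "length x = 4" for x :: "nat list"
    using that by (auto simp: length_Suc_conv numeral_eq_Suc)
  have "array_row (array_of bs) i = fst (bs ! pos i) @ snd (bs ! pos i)" for i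
  proof -
    have "bs ! pos i \<in> set bs" by (simp add: pos_def bs)
    then have "length (fst (bs ! pos i)) = 4" "length (snd (bs ! pos i)) = 4"
      using assms(2)[of "fst (bs ! pos i)" "snd (bs ! pos i)"] by simp_all
    note l = list4[OF this(1)] list4[OF this(2)]
    show ?thesis
      by (subst l(1), subst l(2)) (simp add: array_row_def array_of_def pos_def del: nth_Cons_0)
  qed
  then show ?thesis by (simp add: array_rows_def bs pos_def split_def)
qed

section \<open>Orbit sizes\<close>

lemma count_equal_cmp_list: "count_equal (cmp_list p q) n = (if p = q then Suc n else n)"
  by (simp add: cmp_list_eq)

text \<open>The number of equal pairs determines the class sizes among four rows: 0, 1, 2, 3, 6
  pairs belong to 1+1+1+1, 2+1+1, 2+2, 3+1, 4, with multinomial coefficients 24, 12, 6, 4,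
  1.\<close>

lemma card_arrangements: "int (card (permutations_of_multiset {#p, q, r, s#})) = arrangements [p, q, r, s]"
proof -
  have c: "card (permutations_of_multiset {#p, q, r, s#}) =
      fact 4 div (\<Prod>x\<in>{p, q, r, s}. fact (count {#p, q, r, s#} x))"
    by (simp add: card_permutations_of_multiset numeral_eq_Suc)
  have f: "fact (Suc 0) = (1::nat)" "fact (Suc (Suc 0)) = (2::nat)" "fact (Suc (Suc (Suc 0))) = (6::nat)"
    "fact (Suc (Suc (Suc (Suc 0)))) = (24::nat)" "fact 4 = (24::nat)"
    by (simp_all add: fact_numeral)
  show ?thesis
    unfolding c arrangements.simps count_equal_cmp_list
    by (cases "p = q"; cases "p = r"; cases "p = s"; cases "q = r"; cases "q = s"; cases "r = s")
       (simp_all add: prod.insert_if f del: fact_Suc)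
qed

lemma key_shape:
  shows "length (key E) = 4" "r \<in> set (key E) \<Longrightarrow> length r = 8"
    "r \<in> set (key E) \<Longrightarrow> x \<in> set r \<Longrightarrow> x \<in> range E" "mset (key E) = mset (array_rows E)"
proof -
  show m: "mset (key E) = mset (array_rows E)" by (simp only: key_def sort_rows_eq mset_sort)
  then have s: "set (key E) = set (array_rows E)" by (rule mset_eq_setD)
  show "length (key E) = 4"
    using mset_eq_length[OF m] by (simp add: array_rows_def)
  show "r \<in> set (key E) \<Longrightarrow> length r = 8" "r \<in> set (key E) \<Longrightarrow> x \<in> set r \<Longrightarrow> x \<in> range E"
    unfolding s by (auto simp: array_rows_def array_row_def)
qed

text \<open>Keys consist of four rows of length 8, so concatenation loses no information and the
  trie may be indexed by flat lists.\<close>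

lemma concat_key_eq_iff: "concat (key E) = concat (key E') \<longleftrightarrow> key E = key E'"
proof (rule concat_eq_concat_iff)
  show "\<forall>(x, y)\<in>set (zip (key E) (key E')). length x = length y"
  proof clarify
    fix x y assume "(x, y) \<in> set (zip (key E) (key E'))"
    then have "x \<in> set (key E)" "y \<in> set (key E')"
      by (rule set_zip_leftD, rule set_zip_rightD)
    then show "length x = length y" by (simp add: key_shape(2))
  qed
qed (simp add: key_shape)

text \<open>Arrays with a given key correspond, via their rows, to the orderings of one multiset of
  four rows.\<close>

lemma card_key_fiber: "int (card {E. key E = key B}) = arrangements (key B)" and finite_key_fiber: "finite {E. key E = key B}"
proof -
  let ?M = "mset (array_rows B)"
  have "array_rows ` {E. key E = key B} = permutations_of_multiset ?M"
  proof (intro equalityI subsetI)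
    fix xs assume "xs \<in> array_rows ` {E. key E = key B}"
    then show "xs \<in> permutations_of_multiset ?M"
      by (auto simp: permutations_of_multiset_def key_def sort_rows_eq_iff)
  next
    fix xs assume "xs \<in> permutations_of_multiset ?M"
    then have m: "mset xs = ?M" by (simp add: permutations_of_multiset_def)
    let ?bs = "map (\<lambda>r. (take 4 r, drop 4 r)) xs"
    have "length xs = 4"
      using arg_cong[OF m, of size] by (simp add: array_rows_def)
    moreover have "length r = 8" if "r \<in> set xs" for r
      using that unfolding mset_eq_setD[OF m] by (auto simp: array_rows_def array_row_def)
    ultimately have "array_rows (array_of ?bs) = map (\<lambda>(x, y). x @ y) ?bs"
      by (intro array_rows_array_of) auto
    also have "\<dots> = xs" by (simp add: comp_def)
    finally have "array_rows (array_of ?bs) = xs" .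
    moreover from this m have "key (array_of ?bs) = key B"
      by (simp add: key_def sort_rows_eq_iff)
    ultimately show "xs \<in> array_rows ` {E. key E = key B}" 
      by (intro image_eqI[of _ _ "array_of ?bs"]) simp_all
  qed
  moreover have inj: "inj_on array_rows {E. key E = key B}"
    by (intro inj_onI) (simp add: array_rows_eq_iff)
  ultimately have *: "bij_betw array_rows {E. key E = key B} (permutations_of_multiset ?M)"
    by (simp add: bij_betw_def)
  then show "finite {E. key E = key B}"
    using bij_betw_finite finite_permutations_of_multiset by blast
  obtain p q r s where k: "key B = [p, q, r, s]"
    using key_shape(1)[of B] by (auto simp: length_Suc_conv numeral_eq_Suc)
  have "int (card {E. key E = key B}) = int (card (permutations_of_multiset ?M))"
    using bij_betw_same_card[OF *] by simp
  also have "?M = {#p, q, r, s#}"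
    using key_shape(4)[of B] by (simp add: k)
  finally show "int (card {E. key E = key B}) = arrangements (key B)"
    by (simp only: card_arrangements k)
qed

lemma key_surj_on_orbit_keys:
  assumes "k \<in> set (orbit_keys perms4 (array_rows D))"
  obtains E where "E \<in> orbit D" "key E = k"
proof -
  have "k \<in> {key (permuted id \<beta> \<gamma> B) | B \<beta> \<gamma>. B \<in> {D, flip_array D} \<and> bij \<beta> \<and> bij \<gamma>}"
    using assms by (simp only: set_orbit_keys)
  then obtain B \<beta> \<gamma> where "B \<in> {D, flip_array D}" "bij \<beta>" "bij \<gamma>" "k = key (permuted id \<beta> \<gamma> B)"
    by blast
  then show ?thesis using that permuted_in_orbit[of B D id \<beta> \<gamma>] by simp
qed

text \<open>The orbit is the disjoint union of the fibers of \<open>key\<close> over its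
  keys.\<close>

lemma card_orbit: "int (card (orbit D)) = (\<Sum>k\<in>set (orbit_keys perms4 (array_rows D)). arrangements k)"
proof -
  let ?K = "set (orbit_keys perms4 (array_rows D))"
  have "orbit D = (\<Union>k\<in>?K. {E. key E = k})"
    using orbit_iff_key by auto
  moreover have fib: "finite {E. key E = k} \<and> int (card {E. key E = k}) = arrangements k" if k: "k \<in> ?K" for k
  proof -
    obtain E where "key E = k" using key_surj_on_orbit_keys[OF k] by blast
    then show ?thesis using card_key_fiber[of E] finite_key_fiber[of E] by simp
  qed
  have "card (\<Union>k\<in>?K. {E. key E = k}) = (\<Sum>k\<in>?K. card {E. key E = k})"
    by (rule card_UN_disjoint) (use fib in auto)
  ultimately show ?thesis using fib by simp
qed

section \<open>Correctness of the trie\<close>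

lemma orbit_le:
  assumes "\<And>v. D v \<le> m" "E \<in> orbit D"
  shows "E v \<le> m"
proof -
  have "flip_array D v \<le> m" for v using assms(1) by (cases v) (simp add: flip_array_def)
  then show ?thesis using assms unfolding orbit_iff by (cases v) (auto simp: permuted_def)
qed

text \<open>An insertion that runs into a \<open>Val\<close> discards it; with keys of equal length
  such a value is not reachable by the list looked up.\<close>

lemma trie_lookup_insert:
  assumes "set ks \<subseteq> {0, 1, 2}" "length ks' = length ks"
  shows "trie_lookup (trie_insert ks c t) ks' = (if ks' = ks then Some c else trie_lookup t ks')"
  using assms
proof (induction ks arbitrary: ks' t)
  case Nil
  then show ?case by simp
next
  case (Cons k ks)
  obtain k' ks'' where ks': "ks' = k' # ks''" "length ks'' = length ks"
    using Cons.prems(2) by (cases ks') auto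
  have k: "k = 0 \<or> k = Suc 0 \<or> k = Suc (Suc 0)" using Cons.prems(1) by auto
  \<comment> \<open>The entries of \<open>ks'\<close> are not bounded; for an entry of 3 or more
    both lookups fall through to \<open>None\<close>.\<close>
  have k': "k' = 0 \<or> k' = Suc 0 \<or> k' = Suc (Suc 0) \<or> (\<exists>m. k' = Suc (Suc (Suc m)))"
    by presburger
  have IH: "trie_lookup (trie_insert ks c u) ks'' = (if ks'' = ks then Some c else trie_lookup u ks'')" for u
    using Cons.IH Cons.prems(1) ks'(2) by simp
  show ?case
    using k k' unfolding ks'(1) by (cases t; elim disjE exE) (simp_all add: IH)
qed

text \<open>Keys present at the start keep their value and are not counted. A repeated new key is
  found at its second occurrence, hence the sum over a set of keys.\<close>

lemma insert_keys_spec: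
  assumes "insert_keys c ks (State t n) = State t' n'"
    and "\<forall>k\<in>set ks. \<exists>B. k = key B \<and> (\<forall>v. B v \<le> 2)"
  shows "trie_lookup t' (concat (key E)) =
      (if trie_lookup t (concat (key E)) = None \<and> key E \<in> set ks then Some c else trie_lookup t (concat (key E)))"
    and "n' = n + (\<Sum>k | k \<in> set ks \<and> trie_lookup t (concat k) = None. arrangements k)"
proof -
  have "(\<forall>E. trie_lookup t' (concat (key E)) =
      (if trie_lookup t (concat (key E)) = None \<and> key E \<in> set ks then Some c else trie_lookup t (concat (key E))))
    \<and> n' = n + (\<Sum>k | k \<in> set ks \<and> trie_lookup t (concat k) = None. arrangements k)"
    using assms
  proof (induction ks arbitrary: t n)
    case (Cons k ks)
    have prems: "\<forall>k\<in>set ks. \<exists>B. k = key B \<and> (\<forall>v. B v \<le> 2)" using Cons.prems(2) by simp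
    show ?case
    proof (cases "trie_lookup t (concat k)")
      case (Some d)
      then have "insert_keys c ks (State t n) = State t' n'" using Cons.prems(1) by simp
      note IH = Cons.IH[OF this prems]
      have "{l. l \<in> set (k # ks) \<and> trie_lookup t (concat l) = None} = {l. l \<in> set ks \<and> trie_lookup t (concat l) = None}"
        using Some by auto
      with IH Some show ?thesis by auto
    next
      case None
      obtain B where B: "k = key B" "\<forall>v. B v \<le> 2" using Cons.prems(2) by auto
      let ?t = "trie_insert (concat k) c t"
      have "set (concat k) \<subseteq> {0, 1, 2}"
      proof
        fix x assume "x \<in> set (concat k)"
        then have "x \<in> range B" using key_shape(3)[where E = B and x = x] by (auto simp: B(1))
        then obtain v where "x = B v" by blast
        then have "x \<le> 2" using B(2)[rule_format, of v] by (simp only:)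
        then show "x \<in> {0, 1, 2}" by auto
      qed
      moreover have "length (concat (key E)) = length (concat (key B))" for E
      proof -
        have "length (concat (key E)) = 32" for E
        proof -
          have "map length (key E) = replicate 4 8"
            by (intro replicate_eqI) (auto simp: key_shape)
          then show ?thesis by (simp add: length_concat sum_list_replicate)
        qed
        then show ?thesis by simp
      qed
      ultimately have look: "trie_lookup ?t (concat (key E)) = (if key E = k then Some c else trie_lookup t (concat (key E)))" for E
        unfolding B(1) by (subst trie_lookup_insert) (auto simp: concat_key_eq_iff)
      have "insert_keys c ks (State ?t (n + arrangements k)) = State t' n'" using Cons.prems(1) None by simp
      note IH = Cons.IH[OF this prems]
      have eq: "{l. l \<in> set (k # ks) \<and> trie_lookup t (concat l) = None} =
          insert k {l. l \<in> set ks \<and> trie_lookup ?t (concat l) = None}"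
      proof -
        have "trie_lookup ?t (concat l) = (if l = k then Some c else trie_lookup t (concat l))" if "l \<in> set ks" for l
          using prems that look by force
        then show ?thesis using None by (auto split: if_splits)
      qed
      have "k \<notin> {l. l \<in> set ks \<and> trie_lookup ?t (concat l) = None}"
        using look[of B] by (simp add: B(1))
      then have "n + (\<Sum>l | l \<in> set (k # ks) \<and> trie_lookup t (concat l) = None. arrangements l) =
          n + arrangements k + (\<Sum>l | l \<in> set ks \<and> trie_lookup ?t (concat l) = None. arrangements l)"
        unfolding eq by (subst sum.insert) auto
      with IH look None show ?thesis by auto
    qed
  qed auto
  then show "trie_lookup t' (concat (key E)) =
      (if trie_lookup t (concat (key E)) = None \<and> key E \<in> set ks then Some c else trie_lookup t (concat (key E)))"
    "n' = n + (\<Sum>k | k \<in> set ks \<and> trie_lookup t (concat k) = None. arrangements k)" by blast+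
qed

definition trie_value :: "trie \<Rightarrow> array \<Rightarrow> int option" where
  "trie_value t E = trie_lookup t (concat (key E))"

text \<open>The domain of the trie is a union of orbits. This is what makes a test at the
  representative alone decide disjointness.\<close>

definition orbit_closed :: "trie \<Rightarrow> bool" where
  "orbit_closed t \<longleftrightarrow> (\<forall>E. \<forall>E'\<in>orbit E. trie_value t E' = None \<longleftrightarrow> trie_value t E = None)"

lemma build_Failure: "build ps L Failure = Failure"
  by (induction L) auto

lemma add_orbit_spec:
  assumes add: "add_orbit perms4 (c, array_rows D, s) (Success t) = Success t'" and le: "\<And>v. D v \<le> 2"
    and closed: "orbit_closed t"
  shows "int (card (orbit D)) = s" "trie_value t D = None"
    and "trie_value t' E = (if E \<in> orbit D then Some c else trie_value t E)"
proof -
  let ?ks = "orbit_keys perms4 (array_rows D)"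
  show none: "trie_value t D = None"
    using add by (cases "trie_value t D") (simp_all add: trie_value_def key_def)
  obtain t1 n where st: "insert_keys c ?ks (State t 0) = State t1 n"
    by (cases "insert_keys c ?ks (State t 0)") auto
  have "success_if (n = s) t1 = Success t'"
    using add none by (simp add: trie_value_def key_def st)
  then have n: "n = s" and t1: "t1 = t'"
    by (cases "n = s"; simp)+
  have form: "\<forall>k\<in>set ?ks. \<exists>B. k = key B \<and> (\<forall>v. B v \<le> 2)"
  proof
    fix k assume k: "k \<in> set ?ks"
    obtain E where E: "E \<in> orbit D" "key E = k" using key_surj_on_orbit_keys[OF k] by blast
    then show "\<exists>B. k = key B \<and> (\<forall>v. B v \<le> 2)" using orbit_le[OF le E(1)] by blast
  qed
  note spec = insert_keys_spec[OF st form, unfolded t1]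
  \<comment> \<open>Closedness carries absence from the representative to its whole orbit, so all
    keys of the orbit are new and all are counted.\<close>
  have none': "trie_value t E = None" if "E \<in> orbit D" for E
    using closed that none unfolding orbit_closed_def by blast
  show "trie_value t' E = (if E \<in> orbit D then Some c else trie_value t E)"
    using spec(1)[of E] none'[of E] by (simp add: trie_value_def orbit_iff_key)
  have "{k. k \<in> set ?ks \<and> trie_lookup t (concat k) = None} = set ?ks"
  proof -
    have "trie_lookup t (concat k) = None" if k: "k \<in> set ?ks" for k
    proof -
      obtain E where E: "E \<in> orbit D" "key E = k" using key_surj_on_orbit_keys[OF k] by blast
      then show ?thesis using none'[of E] by (simp add: trie_value_def)
    qed
    then show ?thesis by auto
  qed
  then show "int (card (orbit D)) = s"
    using spec(2) by (simp add: card_orbit n)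
qed

text \<open>The induction continues from the trie obtained after the first orbit. Survival of
  existing entries gives the first orbit its final value; absence of the later representatives from
  that trie makes the first orbit differ from all later ones.\<close>

lemma build_spec:
  assumes "build perms4 (map (\<lambda>(c, D, s). (c, array_rows D, s)) M) (Success t) = Success t'"
    and "\<And>c D s v. (c, D, s) \<in> set M \<Longrightarrow> D v \<le> 2"
    and "orbit_closed t"
  shows "(\<forall>(c, D, s)\<in>set M. int (card (orbit D)) = s \<and> (\<forall>E\<in>orbit D. trie_value t' E = Some c) \<and> trie_value t D = None)
    \<and> (\<forall>E. trie_value t' E \<noteq> None \<longrightarrow> trie_value t E \<noteq> None \<or> (\<exists>(c, D, s)\<in>set M. E \<in> orbit D))
    \<and> (\<forall>E. trie_value t E \<noteq> None \<longrightarrow> trie_value t' E = trie_value t E)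
    \<and> distinct (map (\<lambda>(c, D, s). orbit D) M)"
  using assms
proof (induction M arbitrary: t)
  case Nil
  then show ?case by simp
next
  case (Cons x M)
  obtain c D s where x: "x = (c, D, s)" by (cases x) auto
  obtain t1 where t1: "add_orbit perms4 (c, array_rows D, s) (Success t) = Success t1"
    using Cons.prems(1) by (cases "add_orbit perms4 (c, array_rows D, s) (Success t)") (simp_all add: x build_Failure)
  have le: "D v \<le> 2" for v using Cons.prems(2)[of c D s v] by (simp add: x)
  note spec = add_orbit_spec[OF t1 le Cons.prems(3)]
  have IH: "(\<forall>(c, D, s)\<in>set M. int (card (orbit D)) = s \<and> (\<forall>E\<in>orbit D. trie_value t' E = Some c) \<and> trie_value t1 D = None)
    \<and> (\<forall>E. trie_value t' E \<noteq> None \<longrightarrow> trie_value t1 E \<noteq> None \<or> (\<exists>(c, D, s)\<in>set M. E \<in> orbit D))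
    \<and> (\<forall>E. trie_value t1 E \<noteq> None \<longrightarrow> trie_value t' E = trie_value t1 E)
    \<and> distinct (map (\<lambda>(c, D, s). orbit D) M)"
  proof (rule Cons.IH)
    show "build perms4 (map (\<lambda>(c, D, s). (c, array_rows D, s)) M) (Success t1) = Success t'"
      using Cons.prems(1) t1 by (simp add: x)
    show "D v \<le> 2" if "(c, D, s) \<in> set M" for c D s v
      using Cons.prems(2)[of c D s v] that by simp
    show "orbit_closed t1"
      unfolding orbit_closed_def
    proof (intro allI ballI)
      fix E E' assume E': "E' \<in> orbit E"
      have "E' \<in> orbit D \<longleftrightarrow> E \<in> orbit D" using E' orbit_sym orbit_trans by blast
      moreover have "trie_value t E' = None \<longleftrightarrow> trie_value t E = None"
        using Cons.prems(3) E' unfolding orbit_closed_def by blast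
      ultimately show "trie_value t1 E' = None \<longleftrightarrow> trie_value t1 E = None" using spec(3) by simp
    qed
  qed
  have D: "trie_value t' E = Some c" if "E \<in> orbit D" for E
  proof -
    have "trie_value t1 E = Some c" using spec(3) that by simp
    then show ?thesis using IH by (metis option.distinct(1))
  qed
  have nonmem: "D' \<notin> orbit D \<and> trie_value t D' = None" if "(c', D', s') \<in> set M" for c' D' s'
  proof -
    have "trie_value t1 D' = None" using IH that by fastforce
    then show ?thesis using spec(3)[of D'] by (simp split: if_splits)
  qed
  have "orbit D \<notin> set (map (\<lambda>(c, D, s). orbit D) M)"
    using nonmem orbit_self by fastforce
  then have dist: "distinct (map (\<lambda>(c, D, s). orbit D) (x # M))" using IH by (simp add: x)
  have old: "trie_value t' E = trie_value t E" if "trie_value t E \<noteq> None" for E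
  proof -
    have "E \<notin> orbit D"
    proof
      assume "E \<in> orbit D"
      then have "trie_value t E = None \<longleftrightarrow> trie_value t D = None"
        using Cons.prems(3) unfolding orbit_closed_def by blast
      then show False using that spec(2) by simp
    qed
    then have "trie_value t1 E = trie_value t E" using spec(3) by simp
    then show ?thesis using IH that by metis
  qed
  have new: "trie_value t E \<noteq> None \<or> (\<exists>(c, D, s)\<in>set (x # M). E \<in> orbit D)" if "trie_value t' E \<noteq> None" for E
  proof -
    have "trie_value t1 E \<noteq> None \<or> (\<exists>(c, D, s)\<in>set M. E \<in> orbit D)" using IH that by blast
    then show ?thesis using spec(3)[of E] by (auto simp: x split: if_splits)
  qed
  have "\<forall>(c, D, s)\<in>set (x # M). int (card (orbit D)) = s \<and> (\<forall>E\<in>orbit D. trie_value t' E = Some c) \<and> trie_value t D = None"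
    using IH D spec(1,2) nonmem by (auto simp: x)
  then show ?case using dist old new by blast
qed

section \<open>Relations at orbit representatives\<close>

definition stable :: "(idx \<Rightarrow> idx) \<Rightarrow> (array \<Rightarrow> complex) \<Rightarrow> bool" where
  "stable \<pi> c \<longleftrightarrow> bij \<pi> \<and> (\<forall>E. c (E \<circ> \<pi>) = c E)"

lemma move_comp:
  assumes "bij \<pi>"
  shows "move (G \<circ> \<pi>) w v = move G (\<pi> w) (\<pi> v) \<circ> \<pi>"
  using inj_eq[OF bij_is_inj[OF assms]] by (auto simp: move_def Let_def fun_eq_iff)

text \<open>Moves commute with relabelling the positions, and a \<open>stable\<close> function does
  not notice the relabelling.\<close>

lemma mterm_comp:
  assumes "stable \<pi> c"
  shows "mterm c (G \<circ> \<pi>) w v = mterm c G (\<pi> w) (\<pi> v)"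
  using assms by (simp add: mterm_def stable_def move_comp)

definition idx_map :: "(4 \<Rightarrow> 4) \<Rightarrow> (4 \<Rightarrow> 4) \<Rightarrow> (2 \<Rightarrow> 2) \<Rightarrow> idx \<Rightarrow> idx" where
  "idx_map \<alpha> \<beta> \<gamma> = (\<lambda>(i, j, k). (\<alpha> i, \<beta> j, \<gamma> k))"

lemma idx_map_simp [simp]: "idx_map \<alpha> \<beta> \<gamma> (i, j, k) = (\<alpha> i, \<beta> j, \<gamma> k)"
  by (simp add: idx_map_def)

definition idx_flip :: "idx \<Rightarrow> idx" where
  "idx_flip = (\<lambda>(i, j, k). (j, i, k))"

lemma idx_flip_simp [simp]: "idx_flip (i, j, k) = (j, i, k)"
  by (simp add: idx_flip_def)

lemma permuted_eq: "permuted \<alpha> \<beta> \<gamma> E = E \<circ> idx_map \<alpha> \<beta> \<gamma>"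
  by (simp add: permuted_def fun_eq_iff)

lemma flip_array_eq: "flip_array E = E \<circ> idx_flip"
  by (simp add: flip_array_def fun_eq_iff)

lemma bij_idx_map:
  assumes "bij \<alpha>" "bij \<beta>" "bij \<gamma>"
  shows "bij (idx_map \<alpha> \<beta> \<gamma>)"
proof (rule o_bij)
  show "idx_map (inv \<alpha>) (inv \<beta>) (inv \<gamma>) \<circ> idx_map \<alpha> \<beta> \<gamma> = id"
    using assms by (auto simp: fun_eq_iff bij_is_inj inv_f_f)
  show "idx_map \<alpha> \<beta> \<gamma> \<circ> idx_map (inv \<alpha>) (inv \<beta>) (inv \<gamma>) = id"
    using assms by (auto simp: fun_eq_iff bij_is_surj surj_f_inv_f)
qed

lemma bij_idx_flip: "bij idx_flip"
  by (rule o_bij[of idx_flip]) (auto simp: fun_eq_iff)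

definition orbit_constant :: "(array \<Rightarrow> 'a) \<Rightarrow> bool" where
  "orbit_constant c \<longleftrightarrow> (\<forall>E. \<forall>E'\<in>orbit E. c E' = c E)"

lemma stable_idx_map:
  assumes "orbit_constant c" "bij \<alpha>" "bij \<beta>" "bij \<gamma>"
  shows "stable (idx_map \<alpha> \<beta> \<gamma>) c"
  using assms permuted_in_orbit[of E E \<alpha> \<beta> \<gamma> for E]
  by (simp add: stable_def bij_idx_map orbit_constant_def flip: permuted_eq)

lemma stable_idx_flip:
  assumes "orbit_constant c"
  shows "stable idx_flip c"
  using assms permuted_in_orbit[of "flip_array E" E id id id for E]
  by (simp add: stable_def bij_idx_flip orbit_constant_def flip: flip_array_eq)

lemma sum_bij: "bij \<pi> \<Longrightarrow> (\<Sum>x\<in>UNIV. f (\<pi> x)) = (\<Sum>x\<in>UNIV. f x)"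
  by (rule sum.reindex_bij_betw)

context
  fixes c :: "array \<Rightarrow> complex" and \<alpha> \<beta> :: "4 \<Rightarrow> 4" and \<gamma> :: "2 \<Rightarrow> 2"
  assumes c: "orbit_constant c" and bij: "bij \<alpha>" "bij \<beta>" "bij \<gamma>"
begin

lemma rel1_permuted: "rel1 c a b (permuted \<alpha> \<beta> \<gamma> G) = rel1 c (\<alpha> a) (\<alpha> b) G"
  unfolding rel1_def permuted_eq mterm_comp[OF stable_idx_map[OF c bij]] idx_map_simp
  by (simp only: sum_bij[OF bij(3), where f = "\<lambda>k. mterm c G (\<alpha> a, _, k) (\<alpha> b, _, k)"]
      sum_bij[OF bij(2), where f = "\<lambda>j. \<Sum>k\<in>UNIV. mterm c G (\<alpha> a, j, k) (\<alpha> b, j, k)"])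

lemma rel3_permuted: "rel3 c a b (permuted \<alpha> \<beta> \<gamma> G) = rel3 c (\<gamma> a) (\<gamma> b) G"
  unfolding rel3_def permuted_eq mterm_comp[OF stable_idx_map[OF c bij]] idx_map_simp
  by (simp only: sum_bij[OF bij(2), where f = "\<lambda>j. mterm c G (_, j, \<gamma> a) (_, j, \<gamma> b)"]
      sum_bij[OF bij(1), where f = "\<lambda>i. \<Sum>j\<in>UNIV. mterm c G (i, j, \<gamma> a) (i, j, \<gamma> b)"])

lemma move_permuted: "move (permuted \<alpha> \<beta> \<gamma> G) w v = permuted \<alpha> \<beta> \<gamma> (move G (idx_map \<alpha> \<beta> \<gamma> w) (idx_map \<alpha> \<beta> \<gamma> v))"
  unfolding permuted_eq by (rule move_comp[OF bij_idx_map[OF bij]])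

end

text \<open>Column relations thereby become row relations of the transposed array and need no theory
  of their own.\<close>

lemma rel2_eq_rel1_flip:
  assumes "orbit_constant c"
  shows "rel2 c a b G = rel1 c a b (flip_array G)"
  unfolding rel1_def rel2_def flip_array_eq mterm_comp[OF stable_idx_flip[OF assms]] by simp

lemma rel3_flip:
  assumes "orbit_constant c"
  shows "rel3 c a b (flip_array G) = rel3 c a b G"
  unfolding rel3_def flip_array_eq mterm_comp[OF stable_idx_flip[OF assms]] idx_flip_simp by (rule sum.swap)

text \<open>These are the row relations in which the coefficient at \<open>E\<close> occurs:
  \<open>E\<close> is a term at \<open>G\<close> exactly if undoing its move turns \<open>E\<close>
  into \<open>G\<close>.\<close>

definition row_relations :: "(array \<Rightarrow> complex) \<Rightarrow> array \<Rightarrow> bool" where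
  "row_relations c E \<longleftrightarrow> (\<forall>a b j k. a \<noteq> b \<longrightarrow> E (b, j, k) > 0 \<longrightarrow> rel1 c a b (move E (b, j, k) (a, j, k)) = 0)"

definition slice_relations :: "(array \<Rightarrow> complex) \<Rightarrow> array \<Rightarrow> bool" where
  "slice_relations c E \<longleftrightarrow> (\<forall>k l i j. k \<noteq> l \<longrightarrow> E (i, j, l) > 0 \<longrightarrow> rel3 c k l (move E (i, j, l) (i, j, k)) = 0)"

lemma row_relations_permuted:
  assumes c: "orbit_constant c" and bij: "bij \<alpha>" "bij \<beta>" "bij \<gamma>" and rel: "row_relations c B"
  shows "row_relations c (permuted \<alpha> \<beta> \<gamma> B)"
  unfolding row_relations_def
proof (intro allI impI)
  fix a b j k assume "a \<noteq> b" "permuted \<alpha> \<beta> \<gamma> B (b, j, k) > 0"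
  then have "\<alpha> a \<noteq> \<alpha> b" "B (\<alpha> b, \<beta> j, \<gamma> k) > 0"
    using inj_eq[OF bij_is_inj[OF bij(1)]] by (simp_all add: permuted_def)
  then show "rel1 c a b (move (permuted \<alpha> \<beta> \<gamma> B) (b, j, k) (a, j, k)) = 0"
    using rel by (simp add: move_permuted[OF c bij] rel1_permuted[OF c bij] row_relations_def)
qed

lemma slice_relations_permuted:
  assumes c: "orbit_constant c" and bij: "bij \<alpha>" "bij \<beta>" "bij \<gamma>" and rel: "slice_relations c B"
  shows "slice_relations c (permuted \<alpha> \<beta> \<gamma> B)"
  unfolding slice_relations_def
proof (intro allI impI)
  fix k l i j assume "k \<noteq> l" "permuted \<alpha> \<beta> \<gamma> B (i, j, l) > 0"
  then have "\<gamma> k \<noteq> \<gamma> l" "B (\<alpha> i, \<beta> j, \<gamma> l) > 0"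
    using inj_eq[OF bij_is_inj[OF bij(3)]] by (simp_all add: permuted_def)
  then show "rel3 c k l (move (permuted \<alpha> \<beta> \<gamma> B) (i, j, l) (i, j, k)) = 0"
    using rel by (simp add: move_permuted[OF c bij] rel3_permuted[OF c bij] slice_relations_def)
qed

lemma slice_relations_flip:
  assumes c: "orbit_constant c" and rel: "slice_relations c B"
  shows "slice_relations c (flip_array B)"
  using rel by (simp add: slice_relations_def flip_array_eq move_comp[OF bij_idx_flip] rel3_flip[OF c, unfolded flip_array_eq])

text \<open>Eight units spread evenly over four rows, four columns and two slices: the only weights
  that an invariant of degree 8 admits.\<close>

definition balanced :: "array \<Rightarrow> bool" where
  "balanced E \<longleftrightarrow> (\<forall>i. (\<Sum>j\<in>UNIV. \<Sum>k\<in>UNIV. E (i, j, k)) = 2) \<and> (\<forall>j. (\<Sum>i\<in>UNIV. \<Sum>k\<in>UNIV. E (i, j, k)) = 2)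
     \<and> (\<forall>k. (\<Sum>i\<in>UNIV. \<Sum>j\<in>UNIV. E (i, j, k)) = 4)"

lemma balanced_flip: "balanced E \<Longrightarrow> balanced (flip_array E)"
proof -
  have "(\<Sum>i\<in>UNIV. \<Sum>j\<in>UNIV. E (j, i, k)) = (\<Sum>i\<in>UNIV. \<Sum>j\<in>UNIV. E (i, j, k))" for k
    by (rule sum.swap)
  then show "balanced E \<Longrightarrow> balanced (flip_array E)"
    by (simp add: balanced_def flip_array_def)
qed

lemma balanced_permuted:
  assumes "balanced E" and bij: "bij \<alpha>" "bij \<beta>" "bij \<gamma>"
  shows "balanced (permuted \<alpha> \<beta> \<gamma> E)"
proof -
  have "(\<Sum>j\<in>UNIV. \<Sum>k\<in>UNIV. E (i, \<beta> j, \<gamma> k)) = (\<Sum>j\<in>UNIV. \<Sum>k\<in>UNIV. E (i, j, k))" for i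
    by (simp only: sum_bij[OF bij(3), where f = "\<lambda>k. E (i, _, k)"]
        sum_bij[OF bij(2), where f = "\<lambda>j. \<Sum>k\<in>UNIV. E (i, j, k)"])
  moreover have "(\<Sum>l\<in>UNIV. \<Sum>k\<in>UNIV. E (\<alpha> l, j, \<gamma> k)) = (\<Sum>l\<in>UNIV. \<Sum>k\<in>UNIV. E (l, j, k))" for j
    by (simp only: sum_bij[OF bij(3), where f = "\<lambda>k. E (_, j, k)"]
        sum_bij[OF bij(1), where f = "\<lambda>i. \<Sum>k\<in>UNIV. E (i, j, k)"])
  moreover have "(\<Sum>i\<in>UNIV. \<Sum>j\<in>UNIV. E (\<alpha> i, \<beta> j, k)) = (\<Sum>i\<in>UNIV. \<Sum>j\<in>UNIV. E (i, j, k))" for k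
    by (simp only: sum_bij[OF bij(2), where f = "\<lambda>j. E (_, j, k)"]
        sum_bij[OF bij(1), where f = "\<lambda>i. \<Sum>j\<in>UNIV. E (i, j, k)"])
  ultimately show ?thesis using assms(1) by (simp add: balanced_def permuted_def)
qed

lemma balanced_orbit:
  assumes "balanced D" "E \<in> orbit D"
  shows "balanced E"
  using assms balanced_flip balanced_permuted unfolding orbit_iff by blast

text \<open>A nonzero relation at \<open>G\<close> has a nonzero term, so a move leads from
  \<open>G\<close> to some \<open>E\<close> in the support, and the reverse move recovers
  \<open>G\<close>. The relation is thus one of those transported from \<open>D\<close> to
  \<open>E\<close>. The diagonal relations follow from \<open>balanced\<close>.\<close>

lemma invariant_coeffsI:
  assumes c: "orbit_constant c"
    and support: "\<And>E. c E \<noteq> 0 \<Longrightarrow> \<exists>D. E \<in> orbit D \<and> balanced D \<and> row_relations c D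
      \<and> row_relations c (flip_array D) \<and> slice_relations c D"
  shows "invariant_coeffs c"
proof -
  have rels: "balanced E \<and> row_relations c E \<and> slice_relations c E" if "c E \<noteq> 0" for E
  proof -
    obtain D where D: "E \<in> orbit D" "balanced D" "row_relations c D" "row_relations c (flip_array D)" "slice_relations c D"
      using support[OF \<open>c E \<noteq> 0\<close>] by blast
    obtain B \<alpha> \<beta> \<gamma> where *: "B \<in> {D, flip_array D}" "bij \<alpha>" "bij \<beta>" "bij \<gamma>" "E = permuted \<alpha> \<beta> \<gamma> B"
      using D(1) unfolding orbit_iff by blast
    have "row_relations c B" "slice_relations c B"
      using *(1) D(3-5) slice_relations_flip[OF c D(5)] by auto
    then show ?thesis
      using balanced_orbit[OF D(2,1)] row_relations_permuted[OF c *(2-4)] slice_relations_permuted[OF c *(2-4)]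
      by (simp add: *(5))
  qed
  have r1: "rel1 c a b G = 0" if "a \<noteq> b" for a b G
  proof (rule ccontr)
    assume "rel1 c a b G \<noteq> 0"
    then obtain j where "(\<Sum>k\<in>UNIV. mterm c G (a, j, k) (b, j, k)) \<noteq> 0"
      unfolding rel1_def by (rule sum.not_neutral_contains_not_neutral)
    then obtain k where "mterm c G (a, j, k) (b, j, k) \<noteq> 0"
      by (rule sum.not_neutral_contains_not_neutral)
    then have G: "G (a, j, k) > 0" "c (move G (a, j, k) (b, j, k)) \<noteq> 0"
      by (auto simp: mterm_def split: if_splits)
    let ?E = "move G (a, j, k) (b, j, k)"
    have "move ?E (b, j, k) (a, j, k) = G" "?E (b, j, k) > 0"
      using G(1) that by (auto simp: move_back) (simp add: move_apply)
    moreover have "row_relations c ?E" using rels[OF G(2)] by blast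
    ultimately have "rel1 c a b (move ?E (b, j, k) (a, j, k)) = 0"
      using that unfolding row_relations_def by blast
    with \<open>move ?E (b, j, k) (a, j, k) = G\<close> have "rel1 c a b G = 0" by simp
    then show False using \<open>rel1 c a b G \<noteq> 0\<close> by contradiction
  qed
  have r3: "rel3 c k l G = 0" if "k \<noteq> l" for k l G
  proof (rule ccontr)
    assume "rel3 c k l G \<noteq> 0"
    then obtain i where "(\<Sum>j\<in>UNIV. mterm c G (i, j, k) (i, j, l)) \<noteq> 0"
      unfolding rel3_def by (rule sum.not_neutral_contains_not_neutral)
    then obtain j where "mterm c G (i, j, k) (i, j, l) \<noteq> 0"
      by (rule sum.not_neutral_contains_not_neutral)
    then have G: "G (i, j, k) > 0" "c (move G (i, j, k) (i, j, l)) \<noteq> 0"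
      by (auto simp: mterm_def split: if_splits)
    let ?E = "move G (i, j, k) (i, j, l)"
    have "move ?E (i, j, l) (i, j, k) = G" "?E (i, j, l) > 0"
      using G(1) that by (auto simp: move_back) (simp add: move_apply)
    moreover have "slice_relations c ?E" using rels[OF G(2)] by blast
    ultimately have "rel3 c k l (move ?E (i, j, l) (i, j, k)) = 0"
      using that unfolding slice_relations_def by blast
    with \<open>move ?E (i, j, l) (i, j, k) = G\<close> have "rel3 c k l G = 0" by simp
    then show False using \<open>rel3 c k l G \<noteq> 0\<close> by contradiction
  qed
  have "rel1 c a a G = rel1 c b b G" "rel2 c a a G = rel2 c b b G" for a b G
    unfolding atomize_conj
  proof (cases "c G = 0")
    case False
    then have "balanced G" using rels by blast
    then have "(\<Sum>j\<in>UNIV. \<Sum>k\<in>UNIV. G (i, j, k)) = 2" "(\<Sum>j\<in>UNIV. \<Sum>k\<in>UNIV. G (j, i, k)) = 2" for i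
      unfolding balanced_def by blast+
    then show "rel1 c a a G = rel1 c b b G \<and> rel2 c a a G = rel2 c b b G"
      unfolding rel1_self rel2_self by (simp only:)
  qed (simp add: rel1_self rel2_self)
  moreover have "rel3 c k k G = rel3 c l l G" for k l G
  proof (cases "c G = 0")
    case False
    then have "balanced G" using rels by blast
    then have "(\<Sum>i\<in>UNIV. \<Sum>j\<in>UNIV. G (i, j, k)) = 4" for k
      unfolding balanced_def by blast
    then show ?thesis unfolding rel3_self by (simp only:)
  qed (simp add: rel3_self)
  ultimately show ?thesis
    unfolding invariant_coeffs_def using r1 r3 rel2_eq_rel1_flip[OF c] by simp
qed

section \<open>Correctness of the relation test\<close>

lemma cons_pairs_eq: "cons_pairs a b L = map (\<lambda>(w, xs, ys). (w, a # xs, b # ys)) L"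
  by (induction a b L rule: cons_pairs.induct) auto

text \<open>The component \<open>Suc (g v)\<close> is the derivative factor of \<open>mterm\<close>,
  the target entry after the move.\<close>

lemma unit_moves_map:
  assumes "distinct cs"
  shows "unit_moves (map f cs) (map g cs) =
    map (\<lambda>v. (Suc (g v), map (f(v := f v - 1)) cs, map (g(v := Suc (g v))) cs)) (filter (\<lambda>v. f v > 0) cs)"
  using assms
proof (induction cs)
  case (Cons u cs)
  have tail: "cons_pairs (f u) (g u) (unit_moves (map f cs) (map g cs)) =
      map (\<lambda>v. (Suc (g v), map (f(v := f v - 1)) (u # cs), map (g(v := Suc (g v))) (u # cs))) (filter (\<lambda>v. f v > 0) cs)"
    using Cons by (auto simp: cons_pairs_eq)
  have "map (h(u := x)) cs = map h cs" for h :: "'a \<Rightarrow> nat" and x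
    using Cons.prems by (intro map_cong) auto
  then show ?case
    using tail by (cases "f u") simp_all
qed simp

lemma sum_list_unit_moves:
  assumes "distinct cs" "set cs = UNIV"
  shows "(\<Sum>(w, x, y)\<leftarrow>unit_moves (map f cs) (map g cs). h w x y) =
    (\<Sum>v\<in>UNIV. if f v = 0 then 0 else h (Suc (g v)) (map (f(v := f v - 1)) cs) (map (g(v := Suc (g v))) cs))"
proof -
  have "(\<Sum>(w, x, y)\<leftarrow>unit_moves (map f cs) (map g cs). h w x y) =
      (\<Sum>v\<leftarrow>filter (\<lambda>v. f v > 0) cs. h (Suc (g v)) (map (f(v := f v - 1)) cs) (map (g(v := Suc (g v))) cs))"
    by (simp add: unit_moves_map[OF assms(1)] comp_def)
  also have "\<dots> = (\<Sum>v\<leftarrow>cs. if f v = 0 then 0 else h (Suc (g v)) (map (f(v := f v - 1)) cs) (map (g(v := Suc (g v))) cs))"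
    by (subst sum_list_map_filter') (intro arg_cong[of _ _ sum_list] map_cong refl, simp)
  finally show ?thesis
    using assms by (simp add: sum_list_distinct_conv_sum_set)
qed

lemma nat_mult_eq: "nat_mult n c = int n * c"
  by (induction n) (auto simp: algebra_simps)

lemma row_sum_eq: "row_sum t rs L = (\<Sum>(w, x, y)\<leftarrow>L. int w * coeff t (x # y # rs))"
  by (induction t rs L rule: row_sum.induct) (auto simp: nat_mult_eq)

lemma all_row_sums_iff: "all_row_sums t rs L \<longleftrightarrow> (\<forall>(w, y, x)\<in>set L. row_sum t rs (unit_moves x y) = 0)"
  by (induction t rs L rule: all_row_sums.induct) auto

lemma slice_sum_eq: "slice_sum t L = (\<Sum>(w, x, y)\<leftarrow>L. int w * coeff t (merge_slices x y))"
  by (induction t L rule: slice_sum.induct) (auto simp: nat_mult_eq)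

lemma all_slice_sums_iff: "all_slice_sums t L \<longleftrightarrow> (\<forall>(w, y, x)\<in>set L. slice_sum t (unit_moves x y) = 0)"
  by (induction t L rule: all_slice_sums.induct) auto

lemma coeff_cong: "mset A = mset B \<Longrightarrow> coeff t A = coeff t B"
  using sort_rows_eq_iff[of A B] by (simp add: coeff_def)

definition cells :: "(4 \<times> 2) list" where
  "cells = [(1, 1), (2, 1), (3, 1), (4, 1), (1, 2), (2, 2), (3, 2), (4, 2)]"

lemma distinct_cells: "distinct cells" "set cells = UNIV"
proof -
  have "(j, k) \<in> set cells" for j k
    using exhaust_4[of j] exhaust_2[of k] unfolding cells_def by (elim disjE) simp_all
  then show "set cells = UNIV" by auto
qed (simp add: cells_def)

lemma array_row_eq: "array_row E i = map (\<lambda>u. E (i, u)) cells"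
  by (simp add: array_row_def cells_def)

definition slice_cells :: "(4 \<times> 4) list" where
  "slice_cells = [(1, 1), (1, 2), (1, 3), (1, 4), (2, 1), (2, 2), (2, 3), (2, 4),
     (3, 1), (3, 2), (3, 3), (3, 4), (4, 1), (4, 2), (4, 3), (4, 4)]"

lemma distinct_slice_cells: "distinct slice_cells" "set slice_cells = UNIV"
proof -
  have "(i, j) \<in> set slice_cells" for i j
    using exhaust_4[of i] exhaust_4[of j] unfolding slice_cells_def by (elim disjE) simp_all
  then show "set slice_cells = UNIV" by auto
qed (simp add: slice_cells_def)

lemma slice1_eq: "slice1 (array_rows E) = map (\<lambda>(i, j). E (i, j, 1)) slice_cells"
  by (simp add: array_rows_def array_row_def slice_cells_def)

lemma slice2_eq: "slice2 (array_rows E) = map (\<lambda>(i, j). E (i, j, 2)) slice_cells"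
  by (simp add: array_rows_def array_row_def slice_cells_def)

lemma merge_slices_eq:
  "merge_slices (map f slice_cells) (map g slice_cells) = array_rows (\<lambda>(i, j, k). if k = 1 then f (i, j) else g (i, j))"
  by (simp add: array_rows_def array_row_def slice_cells_def)

definition array_coeff :: "trie \<Rightarrow> array \<Rightarrow> complex" where
  "array_coeff t E = of_int (coeff t (array_rows E))"

lemma mset_array_rows_distinct:
  assumes "distinct [a, b, p, q]"
  shows "mset (array_rows E) = {#array_row E a, array_row E b, array_row E p, array_row E q#}"
proof -
  have "{a, b, p, q} = UNIV"
    using assms by (intro card_subset_eq) auto
  then have "mset_set (UNIV :: 4 set) = mset_set {a, b, p, q}" by simp
  also have "\<dots> = {#a, b, p, q#}" using assms by simp
  finally show ?thesis by (simp add: mset_rows)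
qed

text \<open>The move changes only rows \<open>a\<close> and \<open>b\<close>. As
  \<open>coeff\<close> depends on the multiset of rows, these two may be placed in front of the
  untouched rows \<open>p\<close> and \<open>q\<close>.\<close>

lemma rel1_array_coeff:
  assumes "distinct [a, b, p, q]"
  shows "rel1 (array_coeff t) a b G =
    of_int (row_sum t [array_row G p, array_row G q] (unit_moves (array_row G a) (array_row G b)))"
proof -
  let ?h = "\<lambda>w x y. int w * coeff t [x, y, array_row G p, array_row G q]"
  have ab: "a \<noteq> b" using assms by simp
  have "mterm (array_coeff t) G (a, u) (b, u) =
      of_int (if G (a, u) = 0 then 0 else ?h (Suc (G (b, u))) (map ((\<lambda>u. G (a, u))(u := G (a, u) - 1)) cells)
        (map ((\<lambda>u. G (b, u))(u := Suc (G (b, u)))) cells))" for u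
  proof -
    let ?E = "move G (a, u) (b, u)"
    have rows: "array_row ?E a = map ((\<lambda>u. G (a, u))(u := G (a, u) - 1)) cells"
      "array_row ?E b = map ((\<lambda>u. G (b, u))(u := Suc (G (b, u)))) cells"
      "array_row ?E p = array_row G p" "array_row ?E q = array_row G q"
      using assms unfolding array_row_eq by (auto simp: move_apply intro!: map_cong)
    have "coeff t (array_rows ?E) = coeff t [array_row ?E a, array_row ?E b, array_row ?E p, array_row ?E q]"
      by (rule coeff_cong) (simp add: mset_array_rows_distinct[OF assms])
    then show ?thesis
      using ab unfolding rows by (simp add: mterm_def array_coeff_def move_apply)
  qed
  then have "rel1 (array_coeff t) a b G = of_int (\<Sum>u\<in>UNIV. if G (a, u) = 0 then 0
      else ?h (Suc (G (b, u))) (map ((\<lambda>u. G (a, u))(u := G (a, u) - 1)) cells) (map ((\<lambda>u. G (b, u))(u := Suc (G (b, u)))) cells))"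
    by (simp add: rel1_def sum.cartesian_product flip: of_int_sum)
  then show ?thesis
    unfolding row_sum_eq array_row_eq by (subst sum_list_unit_moves[OF distinct_cells]) simp
qed

lemma rel1_of_all_row_sums:
  assumes dist: "distinct [a, b, p, q]" and pos: "E (b, u) > 0"
    and "all_row_sums t [array_row E p, array_row E q] (unit_moves (array_row E b) (array_row E a))"
  shows "rel1 (array_coeff t) a b (move E (b, u) (a, u)) = 0"
proof -
  let ?G = "move E (b, u) (a, u)"
  have rows: "array_row ?G b = map ((\<lambda>u. E (b, u))(u := E (b, u) - 1)) cells"
    "array_row ?G a = map ((\<lambda>u. E (a, u))(u := Suc (E (a, u)))) cells"
    "array_row ?G p = array_row E p" "array_row ?G q = array_row E q"
    using dist unfolding array_row_eq by (auto simp: move_apply intro!: map_cong)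
  have "u \<in> set cells" by (simp add: distinct_cells)
  then have "(Suc (E (a, u)), array_row ?G b, array_row ?G a) \<in> set (unit_moves (array_row E b) (array_row E a))"
    using pos unfolding rows unfolding array_row_eq unit_moves_map[OF distinct_cells(1)] by auto
  then have "row_sum t [array_row E p, array_row E q] (unit_moves (array_row ?G a) (array_row ?G b)) = 0"
    using assms(3) unfolding all_row_sums_iff by fast
  then show ?thesis
    unfolding rel1_array_coeff[OF dist] rows(3,4) by simp
qed

lemma row_relations_of_check_rows:
  assumes "check_rows t (array_rows E)"
  shows "row_relations (array_coeff t) E"
  unfolding row_relations_def
proof (intro allI impI)
  fix a b j k assume "a \<noteq> b" "E (b, j, k) > 0"
  note rel = rel1_of_all_row_sums[of a b _ _ E "(j, k)" t, OF _ this(2)]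
  note c = assms[unfolded array_rows_def check_rows.simps]
  show "rel1 (array_coeff t) a b (move E (b, j, k) (a, j, k)) = 0"
    \<comment> \<open>The six instances name the two rows other than \<open>a\<close> and
      \<open>b\<close>, in increasing order as in \<open>check_rows\<close>.\<close>
    using exhaust_4[of a] exhaust_4[of b] \<open>a \<noteq> b\<close> c
      rel[of 1 2] rel[of 1 3] rel[of 1 4] rel[of 2 3] rel[of 2 4] rel[of 3 4]
    by (elim disjE) simp_all
qed

lemma rel3_array_coeff:
  "rel3 (array_coeff t) 1 2 G = of_int (slice_sum t (unit_moves (slice1 (array_rows G)) (slice2 (array_rows G))))"
proof -
  let ?h = "\<lambda>w x y. int w * coeff t (merge_slices x y)"
  let ?f = "\<lambda>(i, j). G (i, j, 1)" and ?g = "\<lambda>(i, j). G (i, j, 2)"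
  define K where "K u = (if ?f u = 0 then 0 else ?h (Suc (?g u)) (map (?f(u := ?f u - 1)) slice_cells)
      (map (?g(u := Suc (?g u))) slice_cells))" for u
  have "mterm (array_coeff t) G (i, j, 1) (i, j, 2) = of_int (K (i, j))" for i j
  proof -
    let ?E = "move G (i, j, 1) (i, j, 2)"
    have E: "?E = (\<lambda>(i', j', k). if k = 1 then (?f((i, j) := ?f (i, j) - 1)) (i', j')
        else (?g((i, j) := Suc (?g (i, j)))) (i', j'))"
    proof
      fix v :: idx
      obtain i' j' k where v: "v = (i', j', k)" by (cases v) auto
      consider "k = 1" | "k = 2" using exhaust_2 by blast
      then show "?E v = (\<lambda>(i', j', k). if k = 1 then (?f((i, j) := ?f (i, j) - 1)) (i', j')
          else (?g((i, j) := Suc (?g (i, j)))) (i', j')) v"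
        by cases (auto simp: v move_apply)
    qed
    have h: "?h (Suc (?g (i, j))) (map (?f((i, j) := ?f (i, j) - 1)) slice_cells)
        (map (?g((i, j) := Suc (?g (i, j)))) slice_cells) = int (Suc (G (i, j, 2))) * coeff t (array_rows ?E)"
      by (simp only: merge_slices_eq E prod.case)
    show ?thesis
      unfolding K_def h by (simp add: mterm_def array_coeff_def move_apply)
  qed
  then have "rel3 (array_coeff t) 1 2 G = of_int (\<Sum>u\<in>UNIV. K u)"
    by (simp add: rel3_def sum.cartesian_product flip: of_int_sum)
  then show ?thesis
    unfolding slice_sum_eq slice1_eq slice2_eq K_def by (subst sum_list_unit_moves[OF distinct_slice_cells]) simp
qed

lemma rel3_of_check_slices:
  assumes "check_slices t (array_rows E)" and pos: "E (i, j, 2) > 0"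
  shows "rel3 (array_coeff t) 1 2 (move E (i, j, 2) (i, j, 1)) = 0"
proof -
  let ?G = "move E (i, j, 2) (i, j, 1)"
  let ?f = "\<lambda>(i, j). E (i, j, 1)" and ?g = "\<lambda>(i, j). E (i, j, 2)"
  have s: "slice2 (array_rows ?G) = map (?g((i, j) := ?g (i, j) - 1)) slice_cells"
    "slice1 (array_rows ?G) = map (?f((i, j) := Suc (?f (i, j)))) slice_cells"
    unfolding slice1_eq slice2_eq by (auto simp: move_apply split: if_splits intro!: map_cong)
  have "(i, j) \<in> set slice_cells" by (simp add: distinct_slice_cells)
  then have "(Suc (?f (i, j)), slice2 (array_rows ?G), slice1 (array_rows ?G))
      \<in> set (unit_moves (slice2 (array_rows E)) (slice1 (array_rows E)))"
    using pos unfolding s unfolding slice1_eq slice2_eq unit_moves_map[OF distinct_slice_cells(1)]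
    by (auto intro!: image_eqI[of _ _ "(i, j)"])
  then have "slice_sum t (unit_moves (slice1 (array_rows ?G)) (slice2 (array_rows ?G))) = 0"
    using assms(1) unfolding check_slices_def all_slice_sums_iff by fast
  then show ?thesis unfolding rel3_array_coeff by simp
qed

text \<open>The test treats one direction between the slices; orbit constancy transfers it to the
  other through \<open>swap2\<close>.\<close>

lemma slice_relations_of_check_slices:
  assumes c: "orbit_constant (array_coeff t)"
    and "check_slices t (array_rows E)" "check_slices t (swap_slices (array_rows E))"
  shows "slice_relations (array_coeff t) E"
  unfolding slice_relations_def
proof (intro allI impI)
  fix k l i j assume kl: "k \<noteq> l" and pos: "E (i, j, l) > 0"
  consider "k = 1" "l = 2" | "k = 2" "l = 1"
    using exhaust_2[of k] exhaust_2[of l] kl by auto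
  then show "rel3 (array_coeff t) k l (move E (i, j, l) (i, j, k)) = 0"
  proof cases
    case 1
    then show ?thesis using rel3_of_check_slices[OF assms(2)] pos by simp
  next
    case 2
    have bij: "bij swap2" by (simp add: bij_2_iff)
    have "rel3 (array_coeff t) 1 2 (move (permuted id id swap2 E) (i, j, 2) (i, j, 1)) = 0"
    proof (rule rel3_of_check_slices)
      show "check_slices t (array_rows (permuted id id swap2 E))"
        using assms(3) by (simp only: array_rows_swap_slices)
      show "permuted id id swap2 E (i, j, 2) > 0"
        using pos 2 by (simp add: permuted_def swap2_def)
    qed
    then show ?thesis
      by (simp add: 2 move_permuted[OF c bij_id bij_id bij] rel3_permuted[OF c bij_id bij_id bij] swap2_def)
  qed
qed

section \<open>The invariant of degree 8\<close>

lemma check_relations_iff: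
  "check_relations t L \<longleftrightarrow> (\<forall>(c, A, s)\<in>set L. check_rows t A \<and> check_rows t (transpose_rows A)
     \<and> check_slices t A \<and> check_slices t (swap_slices A))"
  by (induction t L rule: check_relations.induct) auto

lemma orbit_list_shape:
  assumes "(c, bs, s) \<in> set orbit_list"
  shows "length bs = 4" "(x, y) \<in> set bs \<Longrightarrow> length x = 4 \<and> length y = 4 \<and> (\<forall>n\<in>set x \<union> set y. n \<le> 2)"
proof -
  have "\<forall>(c, bs, s)\<in>set orbit_list. length bs = 4 \<and>
      (\<forall>(x, y)\<in>set bs. length x = 4 \<and> length y = 4 \<and> (\<forall>n\<in>set x \<union> set y. n \<le> 2))"
    by (simp add: orbit_list_def)
  then show "length bs = 4" "(x, y) \<in> set bs \<Longrightarrow> length x = 4 \<and> length y = 4 \<and> (\<forall>n\<in>set x \<union> set y. n \<le> 2)"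
    using assms by fast+
qed

lemma array_rows_orbit_list:
  assumes "(c, bs, s) \<in> set orbit_list"
  shows "array_rows (array_of bs) = map (\<lambda>(x, y). x @ y) bs"
  by (rule array_rows_array_of) (use orbit_list_shape[OF assms] in blast)+

lemma orbit_list_le:
  assumes "(c, bs, s) \<in> set orbit_list"
  shows "array_of bs v \<le> 2"
proof -
  obtain i j k where v: "v = (i, j, k)" by (cases v) auto
  have "pos i < length bs" by (simp add: orbit_list_shape(1)[OF assms] pos_def)
  then have "bs ! pos i \<in> set bs" by simp
  then have "length (fst (bs ! pos i)) = 4 \<and> length (snd (bs ! pos i)) = 4
      \<and> (\<forall>n\<in>set (fst (bs ! pos i)) \<union> set (snd (bs ! pos i)). n \<le> 2)"
    using orbit_list_shape(2)[OF assms, of "fst (bs ! pos i)" "snd (bs ! pos i)"] by simp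
  moreover have "pos j < 4" by (simp add: pos_def)
  ultimately show ?thesis by (simp add: v array_of_def)
qed

lemma orbit_list_balanced:
  assumes "(c, bs, s) \<in> set orbit_list"
  shows "balanced (array_of bs)"
proof -
  have "\<forall>(c, bs, s)\<in>set orbit_list. balanced (array_of bs)"
    unfolding orbit_list_def balanced_def forall_4 forall_2 sum_4 sum_2
    by (simp add: array_of_def pos_def)
  then show ?thesis using assms by fast
qed

definition orbit_arrays :: "(int \<times> array \<times> int) list" where
  "orbit_arrays = map (\<lambda>(c, bs, s). (c, array_of bs, int s)) orbit_list"

lemma orbit_rows_eq: "orbit_rows = map (\<lambda>(c, D, s). (c, array_rows D, s)) orbit_arrays"
  unfolding orbit_rows_def orbit_arrays_def using array_rows_orbit_list by (auto simp: comp_def)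

lemma checked_trie:
  obtains t where "build perms4 orbit_rows (Success Empty) = Success t" "check_relations t orbit_rows"
  using check_orbit_rows by (cases "build perms4 orbit_rows (Success Empty)") simp_all

lemma trie_value_orbit_arrays:
  assumes "build perms4 orbit_rows (Success Empty) = Success t"
  shows "(c, D, s) \<in> set orbit_arrays \<Longrightarrow> int (card (orbit D)) = s"
    and "(c, D, s) \<in> set orbit_arrays \<Longrightarrow> E \<in> orbit D \<Longrightarrow> trie_value t E = Some c"
    and "trie_value t E \<noteq> None \<Longrightarrow> \<exists>(c, D, s)\<in>set orbit_arrays. E \<in> orbit D"
    and "distinct (map (\<lambda>(c, D, s). orbit D) orbit_arrays)"
proof -
  have empty: "trie_value Empty E = None" for E by (simp add: trie_value_def)
  have "(\<forall>(c, D, s)\<in>set orbit_arrays. int (card (orbit D)) = s \<and> (\<forall>E\<in>orbit D. trie_value t E = Some c) \<and> trie_value Empty D = None)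
    \<and> (\<forall>E. trie_value t E \<noteq> None \<longrightarrow> trie_value Empty E \<noteq> None \<or> (\<exists>(c, D, s)\<in>set orbit_arrays. E \<in> orbit D))
    \<and> (\<forall>E. trie_value Empty E \<noteq> None \<longrightarrow> trie_value t E = trie_value Empty E)
    \<and> distinct (map (\<lambda>(c, D, s). orbit D) orbit_arrays)"
  proof (rule build_spec)
    show "build perms4 (map (\<lambda>(c, D, s). (c, array_rows D, s)) orbit_arrays) (Success Empty) = Success t"
      using assms by (simp only: orbit_rows_eq)
    show "D v \<le> 2" if "(c, D, s) \<in> set orbit_arrays" for c D s v
    proof -
      obtain bs n where "(c, bs, n) \<in> set orbit_list" "D = array_of bs"
        using \<open>(c, D, s) \<in> set orbit_arrays\<close> by (auto simp: orbit_arrays_def)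
      then show ?thesis using orbit_list_le by blast
    qed
    show "orbit_closed Empty" by (simp add: orbit_closed_def empty)
  qed
  note spec = bspec[OF this[THEN conjunct1]] this[THEN conjunct2]
  show "(c, D, s) \<in> set orbit_arrays \<Longrightarrow> int (card (orbit D)) = s" using spec(1)[of "(c, D, s)"] by simp
  show "(c, D, s) \<in> set orbit_arrays \<Longrightarrow> E \<in> orbit D \<Longrightarrow> trie_value t E = Some c" using spec(1)[of "(c, D, s)"] by simp
  show "trie_value t E \<noteq> None \<Longrightarrow> \<exists>(c, D, s)\<in>set orbit_arrays. E \<in> orbit D" using spec(2) by (simp add: empty)
  show "distinct (map (\<lambda>(c, D, s). orbit D) orbit_arrays)" using spec(2) by (simp only:)
qed

lemma distinct_orbits: "distinct (map (\<lambda>(c, bs, s). orbit (array_of bs)) orbit_list)"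
proof -
  obtain t where "build perms4 orbit_rows (Success Empty) = Success t" by (rule checked_trie)
  from trie_value_orbit_arrays(4)[OF this] show ?thesis
    by (simp add: orbit_arrays_def comp_def split_def)
qed

lemma card_orbit_orbit_list:
  assumes "(c, bs, s) \<in> set orbit_list"
  shows "card (orbit (array_of bs)) = s"
proof -
  obtain t where "build perms4 orbit_rows (Success Empty) = Success t" by (rule checked_trie)
  note size = trie_value_orbit_arrays(1)[OF this]
  have "(c, array_of bs, int s) \<in> set orbit_arrays"
    using assms by (force simp: orbit_arrays_def)
  then show ?thesis using size by fastforce
qed

section \<open>Coefficients of \<open>F\<close>\<close>

lemma finite_orbit: "finite (orbit E)"
  by (simp add: orbit_def)

lemma mcoeff_sum_list: "mcoeff (\<Sum>x\<leftarrow>xs. f x) E = (\<Sum>x\<leftarrow>xs. mcoeff (f x) E)"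
  by (induction xs) (auto simp: mcoeff_add)

lemma of_int_mult_eq_poly_scale: "of_int c * f = poly_scale (of_int c) f"
proof -
  have "(of_int c :: cpoly) = Poly_Mapping.single 0 (of_int c)"
    by (induction c rule: int_induct[of _ 0]) (simp_all add: single_add single_diff)
  then show ?thesis by (simp add: poly_scale_def)
qed

lemma mcoeff_F_eq_sum:
  "mcoeff F E = (\<Sum>(c, bs, s)\<leftarrow>orbit_list. if E \<in> orbit (array_of bs) then of_int c else 0)"
proof -
  have "mcoeff (of_int c * (\<Sum>E'\<in>orbit D. X E')) E = (if E \<in> orbit D then of_int c else 0)" for c D
    using finite_orbit by (simp add: of_int_mult_eq_poly_scale mcoeff_scale mcoeff_sum mcoeff_X)
  then show ?thesis
    unfolding F_def by (simp add: mcoeff_sum_list split_def)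
qed

text \<open>Orbits that share an array are equal, and the listed orbits are distinct, so only one
  summand of \<open>mcoeff_F_eq_sum\<close> is present.\<close>

lemma mcoeff_F:
  assumes "(c, bs, s) \<in> set orbit_list" "E \<in> orbit (array_of bs)"
  shows "mcoeff F E = of_int c"
proof -
  let ?o = "\<lambda>(c :: int, bs, s :: nat). orbit (array_of bs)" and ?g = "\<lambda>x :: int \<times> blocks \<times> nat. of_int (fst x) :: complex"
  have inj: "inj_on ?o (set orbit_list)" and dist: "distinct orbit_list"
    using distinct_orbits by (simp_all add: distinct_map)
  have orbit_o: "?o x = orbit E" if "E \<in> ?o x" for x E
    using orbit_eq[of E "array_of (fst (snd x))"] that by (simp add: split_def)
  have *: "E \<in> ?o x \<longleftrightarrow> x = (c, bs, s)" if "x \<in> set orbit_list" for x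
  proof
    assume "E \<in> ?o x"
    then have "?o x = ?o (c, bs, s)"
      using orbit_o[of E x] orbit_o[of E "(c, bs, s)"] assms(2) by simp
    from inj_onD[OF inj this that assms(1)] show "x = (c, bs, s)" .
  qed (use assms(2) in simp)
  have "mcoeff F E = (\<Sum>x\<leftarrow>orbit_list. if E \<in> ?o x then ?g x else 0)"
    by (simp add: mcoeff_F_eq_sum split_def)
  also have "\<dots> = (\<Sum>x\<in>set orbit_list. if E \<in> ?o x then ?g x else 0)"
    by (rule sum_list_distinct_conv_sum_set[OF dist])
  also have "\<dots> = (\<Sum>x\<in>set orbit_list. if x = (c, bs, s) then of_int c else 0)"
    by (rule sum.cong[OF refl]) (use * in auto)
  also have "\<dots> = of_int c" using assms(1) by simp
  finally show ?thesis .
qed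

lemma mcoeff_F_eq_0:
  assumes "\<And>c bs s. (c, bs, s) \<in> set orbit_list \<Longrightarrow> E \<notin> orbit (array_of bs)"
  shows "mcoeff F E = 0"
proof -
  have "map (\<lambda>(c, bs, s). if E \<in> orbit (array_of bs) then of_int c else (0 :: complex)) orbit_list = map (\<lambda>_. 0) orbit_list"
    by (rule map_cong[OF refl]) (use assms in auto)
  then show ?thesis unfolding mcoeff_F_eq_sum by (simp only: sum_list_0)
qed

lemma monomials_F: "monomials F = (\<Union>(c, bs, s)\<in>set orbit_list. orbit (array_of bs))"
proof -
  have "\<forall>(c, bs, s)\<in>set orbit_list. c \<noteq> 0"
    by (simp add: orbit_list_def)
  then have "mcoeff F E \<noteq> 0" if "(c, bs, s) \<in> set orbit_list" "E \<in> orbit (array_of bs)" for c bs s E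
    using mcoeff_F[OF that] that(1) by auto
  moreover have "\<exists>(c, bs, s)\<in>set orbit_list. E \<in> orbit (array_of bs)" if "mcoeff F E \<noteq> 0" for E
    using mcoeff_F_eq_0[of E] that by fast
  ultimately show ?thesis
    unfolding monomials_def by blast
qed

lemma F_eq_array_coeff:
  assumes t: "build perms4 orbit_rows (Success Empty) = Success t"
  shows "mcoeff F = array_coeff t"
proof
  fix E
  have c: "coeff t (array_rows E) = value_of (trie_value t E)"
    by (simp add: coeff_def trie_value_def key_def)
  show "mcoeff F E = array_coeff t E"
  proof (cases "\<exists>(c, bs, s)\<in>set orbit_list. E \<in> orbit (array_of bs)")
    case True
    then obtain c bs s where *: "(c, bs, s) \<in> set orbit_list" "E \<in> orbit (array_of bs)" by blast
    then have "(c, array_of bs, int s) \<in> set orbit_arrays" by (force simp: orbit_arrays_def)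
    then have "trie_value t E = Some c" using trie_value_orbit_arrays(2)[OF t] *(2) by blast
    then show ?thesis using mcoeff_F[OF *] by (simp add: array_coeff_def c)
  next
    case False
    then have "trie_value t E = None"
      using trie_value_orbit_arrays(3)[OF t, of E] by (fastforce simp: orbit_arrays_def)
    moreover have "mcoeff F E = 0" using False by (intro mcoeff_F_eq_0) fast
    ultimately show ?thesis by (simp add: array_coeff_def c)
  qed
qed

lemma orbit_constant_F: "orbit_constant (mcoeff F)"
  unfolding orbit_constant_def
proof (intro allI ballI)
  fix E E' assume E': "E' \<in> orbit E"
  show "mcoeff F E' = mcoeff F E"
  proof (cases "\<exists>(c, bs, s)\<in>set orbit_list. E \<in> orbit (array_of bs)")
    case True
    then obtain c bs s where *: "(c, bs, s) \<in> set orbit_list" "E \<in> orbit (array_of bs)" by blast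
    then show ?thesis using mcoeff_F[OF *(1)] orbit_trans[OF E' *(2)] by simp
  next
    case False
    then have "mcoeff F E = 0" by (intro mcoeff_F_eq_0) fast
    moreover have "mcoeff F E' = 0"
      using False orbit_trans[OF orbit_sym[OF E']] by (intro mcoeff_F_eq_0) fast
    ultimately show ?thesis by simp
  qed
qed

lemma F_invariant: "F \<in> invariants 8"
proof -
  obtain t where t: "build perms4 orbit_rows (Success Empty) = Success t" and rel: "check_relations t orbit_rows"
    by (rule checked_trie)
  note F = F_eq_array_coeff[OF t]
  have c: "orbit_constant (array_coeff t)" using orbit_constant_F by (simp only: F)
  have "invariant_coeffs (mcoeff F)"
    unfolding F
  proof (rule invariant_coeffsI[OF c])
    fix E assume "array_coeff t E \<noteq> 0"
    then have "E \<in> monomials F" by (simp add: monomials_def F)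
    then obtain d bs s where d: "(d, bs, s) \<in> set orbit_list" "E \<in> orbit (array_of bs)"
      unfolding monomials_F by blast
    let ?D = "array_of bs"
    have "(d, array_rows ?D, int s) \<in> set orbit_rows"
      using d(1) unfolding array_rows_orbit_list[OF d(1)] by (force simp: orbit_rows_def)
    then have "check_rows t (array_rows ?D)" "check_rows t (array_rows (flip_array ?D))"
      "check_slices t (array_rows ?D)" "check_slices t (swap_slices (array_rows ?D))"
      using rel unfolding check_relations_iff array_rows_flip by fast+
    then show "\<exists>D. E \<in> orbit D \<and> balanced D \<and> row_relations (array_coeff t) D
        \<and> row_relations (array_coeff t) (flip_array D) \<and> slice_relations (array_coeff t) D"
      using d(2) orbit_list_balanced[OF d(1)] row_relations_of_check_rows slice_relations_of_check_slices[OF c]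
      by blast
  qed
  moreover have "homogeneous 8 F"
    unfolding homogeneous_def
  proof
    fix E assume "E \<in> monomials F"
    then obtain d bs s where d: "(d, bs, s) \<in> set orbit_list" "E \<in> orbit (array_of bs)"
      unfolding monomials_F by blast
    have "balanced E" by (rule balanced_orbit[OF orbit_list_balanced[OF d(1)] d(2)])
    then show "(\<Sum>v\<in>UNIV. E v) = 8" by (simp add: sum_idx balanced_def)
  qed
  ultimately show ?thesis by (simp add: invariants_def invariant_iff)
qed

section \<open>Dimension in degree 8 and counts for \<open>F\<close>\<close>

abbreviation first_blocks :: blocks where
  "first_blocks \<equiv> [([0,0,0,0],[0,0,0,2]), ([0,0,0,0],[0,0,2,0]), ([0,2,0,0],[0,0,0,0]), ([2,0,0,0],[0,0,0,0])]"

lemma first_blocks_in_orbit_list: "(1, first_blocks, 144) \<in> set orbit_list"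
  by (simp add: orbit_list_def)

lemma diag_in_first_orbit: "diag_array 2 (vec4 2 2 0 0) \<in> orbit (array_of first_blocks)"
proof -
  \<comment> \<open>The first representative is supported on the antidiagonal of the row and column
    indices; reversing the columns puts it on the diagonal.\<close>
  let ?p = "(I4, I3, I2, I1)"
  have "array_rows (diag_array 2 (vec4 2 2 0 0)) = array_rows (permuted id (perm_of ?p) id (array_of first_blocks))"
    unfolding array_rows_permute_columns array_rows_orbit_list[OF first_blocks_in_orbit_list]
    by (simp add: array_rows_def array_row_def diag_array_def)
  then have "diag_array 2 (vec4 2 2 0 0) = permuted id (perm_of ?p) id (array_of first_blocks)"
    by (simp only: array_rows_eq_iff)
  moreover have "?p \<in> set perms4" by (simp add: in_perms4_iff)
  then have "bij (perm_of ?p)" unfolding bij_iff_perm_of by blast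
  ultimately show ?thesis
    by (simp only:) (rule permuted_in_orbit; simp)
qed

text \<open>\<open>F\<close> has coefficient 1 at the diagonal array that determines an invariant of
  degree 8, so subtracting a multiple of \<open>F\<close> makes that coefficient, and hence the
  difference, zero.\<close>

lemma span_F: "cpoly.span {F} = invariants 8"
proof (rule cpoly.span_unique)
  show "{F} \<subseteq> invariants 8" by (simp add: F_invariant)
  show "cpoly.subspace (invariants 8)" by (rule subspace_invariants)
  fix V :: "cpoly set" assume V: "{F} \<subseteq> V" "cpoly.subspace V"
  show "invariants 8 \<subseteq> V"
  proof
    fix f assume f: "f \<in> invariants 8"
    let ?D = "diag_array 2 (vec4 2 2 0 0)"
    let ?g = "f - poly_scale (mcoeff f ?D) F"
    have "?g \<in> invariants 8"
      by (intro cpoly.subspace_diff cpoly.subspace_scale subspace_invariants f F_invariant)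
    moreover have "mcoeff ?g ?D = 0"
    proof -
      have "mcoeff F ?D = 1"
        using mcoeff_F[OF first_blocks_in_orbit_list diag_in_first_orbit] by simp
      moreover have "mcoeff f ?D = mcoeff (?g + poly_scale (mcoeff f ?D) F) ?D" by simp
      ultimately show ?thesis unfolding mcoeff_add mcoeff_scale by simp
    qed
    ultimately have "?g = 0" by (rule invariants_8_eq_0)
    then have "f = poly_scale (mcoeff f ?D) F" by simp
    then show "f \<in> V" using V cpoly.subspace_scale by (metis insert_subset)
  qed
qed

lemma variables_F: "variables F = UNIV"
proof -
  have "v \<in> variables F" for v
  proof -
    obtain i j k where v: "v = (i, j, k)" by (cases v) auto
    \<comment> \<open>The entry of the first representative at \<open>(1, 4, 2)\<close> is 2; the
      three transpositions carry \<open>(i, j, k)\<close> to this position.\<close>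
    let ?\<alpha> = "Transposition.transpose i 1" and ?\<beta> = "Transposition.transpose j 4" and ?\<gamma> = "Transposition.transpose k 2"
    let ?E = "permuted ?\<alpha> ?\<beta> ?\<gamma> (array_of first_blocks)"
    have "?E \<in> orbit (array_of first_blocks)"
      by (rule permuted_in_orbit) simp_all
    then have "?E \<in> monomials F"
      using first_blocks_in_orbit_list unfolding monomials_F by fast
    moreover have "?E v \<noteq> 0"
      by (simp add: v permuted_def array_of_def pos_def)
    ultimately show ?thesis unfolding variables_def by blast
  qed
  then show ?thesis by blast
qed

lemma card_monomials_F: "card (monomials F) = 14148"
proof -
  let ?o = "\<lambda>(c :: int, bs, s :: nat). orbit (array_of bs)" and ?s = "\<lambda>(c :: int, bs :: blocks, s :: nat). s"
  have inj: "inj_on ?o (set orbit_list)" and dist: "distinct orbit_list"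
    using distinct_orbits by (simp_all add: distinct_map)
  have orbit_o: "?o x = orbit E" if "E \<in> ?o x" for x E
    using orbit_eq[of E "array_of (fst (snd x))"] that by (simp add: split_def)
  have "card (monomials F) = (\<Sum>x\<in>set orbit_list. card (?o x))"
    unfolding monomials_F
  proof (rule card_UN_disjoint)
    show "\<forall>x\<in>set orbit_list. finite (?o x)" using finite_orbit by auto
    show "\<forall>x\<in>set orbit_list. \<forall>y\<in>set orbit_list. x \<noteq> y \<longrightarrow> ?o x \<inter> ?o y = {}"
    proof (intro ballI impI, rule ccontr)
      fix x y assume *: "x \<in> set orbit_list" "y \<in> set orbit_list" "x \<noteq> y" "?o x \<inter> ?o y \<noteq> {}"
      then obtain E where "E \<in> ?o x" "E \<in> ?o y" by blast
      then have "?o x = ?o y" using orbit_o[of E x] orbit_o[of E y] by simp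
      from inj_onD[OF inj this *(1,2)] *(3) show False by contradiction
    qed
  qed simp
  also have "\<dots> = (\<Sum>x\<in>set orbit_list. ?s x)"
    by (rule sum.cong[OF refl]) (use card_orbit_orbit_list in auto)
  also have "\<dots> = (\<Sum>x\<leftarrow>orbit_list. ?s x)"
    by (rule sum_list_distinct_conv_sum_set[OF dist, symmetric])
  also have "\<dots> = 14148"
    by (simp add: orbit_list_def)
  finally show ?thesis .
qed

lemma mcoeff_F_image: "mcoeff F ` monomials F = of_int ` fst ` set orbit_list"
proof -
  have "mcoeff F ` orbit (array_of bs) = {of_int c}" if "(c, bs, s) \<in> set orbit_list" for c bs s
  proof -
    have "mcoeff F ` orbit (array_of bs) = (\<lambda>_. of_int c) ` orbit (array_of bs)"
      by (intro image_cong refl) (rule mcoeff_F[OF that])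
    then show ?thesis by (simp only: image_constant[OF orbit_self])
  qed
  then have "mcoeff F ` monomials F = (\<Union>(c, bs, s)\<in>set orbit_list. {of_int c})"
    unfolding monomials_F image_UN by (intro SUP_cong refl) clarsimp
  then show ?thesis by (simp add: split_def UNION_singleton_eq_range image_image)
qed

lemma card_mcoeff_F_image: "card (mcoeff F ` monomials F) = 13"
proof -
  have "card (mcoeff F ` monomials F) = card (fst ` set orbit_list)"
    unfolding mcoeff_F_image by (rule card_image) (simp add: inj_on_def)
  also have "\<dots> = 13"
    by (simp add: orbit_list_def card_insert_if)
  finally show ?thesis .
qed

lemma card_orbits_F: "card (orbit ` monomials F) = 28"
proof -
  have "orbit ` orbit D = {orbit D}" for D
    using orbit_self orbit_eq by blast
  then have "orbit ` monomials F = (\<Union>(c, bs, s)\<in>set orbit_list. {orbit (array_of bs)})"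
    unfolding monomials_F image_UN by (intro SUP_cong refl) clarsimp
  also have "\<dots> = set (map (\<lambda>(c, bs, s). orbit (array_of bs)) orbit_list)"
    by (simp add: split_def UNION_singleton_eq_range)
  finally have "orbit ` monomials F = set (map (\<lambda>(c, bs, s). orbit (array_of bs)) orbit_list)" .
  then show ?thesis
    using distinct_card[OF distinct_orbits] by (simp add: orbit_list_def)
qed

theorem theorem16:
  shows "(\<forall>d f. homogeneous d f \<and> f \<noteq> 0 \<and> invariant f \<longrightarrow> 4 dvd d)
    \<and> invariants 0 = cpoly.span {1}
    \<and> invariants 4 = {0}
    \<and> cpoly.dim (invariants 8) = 1
    \<and> F \<in> invariants 8 \<and> cpoly.independent {F} \<and> cpoly.span {F} = invariants 8
    \<and> card (variables F) = 32
    \<and> card (monomials F) = 14148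
    \<and> mcoeff F ` monomials F \<subseteq> \<int>
    \<and> card (mcoeff F ` monomials F) = 13
    \<and> monomials F = (\<Union>(c, bs, s)\<in>set orbit_list. orbit (array_of bs))
    \<and> card (orbit ` monomials F) = 28
    \<and> distinct (map (\<lambda>(c, bs, s). orbit (array_of bs)) orbit_list)
    \<and> (\<forall>(c, bs, s)\<in>set orbit_list.
         card (orbit (array_of bs)) = s \<and> (\<forall>E\<in>orbit (array_of bs). mcoeff F E = of_int c))"
proof -
  have "monomials F \<noteq> {}" using card_monomials_F by auto
  then have "F \<noteq> 0" by (auto simp: monomials_def)
  then have indep: "cpoly.independent {F}" by simp
  have dim: "cpoly.dim (invariants 8) = 1"
    using cpoly.dim_unique[of "{F}" "invariants 8" 1] indep F_invariant span_F by simp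
  have inv4: "invariants 4 = {0}"
    using invariants_4_eq_0 cpoly.subspace_0[OF subspace_invariants] by blast
  have ints: "mcoeff F ` monomials F \<subseteq> \<int>"
    unfolding mcoeff_F_image by auto
  have "card (variables F) = 32"
    by (simp add: variables_F)
  moreover have "\<forall>(c, bs, s)\<in>set orbit_list.
      card (orbit (array_of bs)) = s \<and> (\<forall>E\<in>orbit (array_of bs). mcoeff F E = of_int c)"
    using card_orbit_orbit_list mcoeff_F by fast
  ultimately show ?thesis
    using homogeneous_invariant_dvd invariants_0_eq inv4 dim F_invariant indep span_F
      card_monomials_F ints card_mcoeff_F_image monomials_F card_orbits_F distinct_orbits by blast
qed

end
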